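(* Let $X$ be a closed semialgebraic subset of $\mathbb{R}^n$ of dimension $k$. Let $f:X\to\mathbb{R}^n$ be a semialgebraic and bi-Lipschitz embedding. If $n\ge 2k+2$, then there exists a tame bi-Lipschitz and semialgebraic homeomorphism $F:\mathbb{R}^n\to\mathbb{R}^n$ such that $F|_X=f$. Moreover, there is a continuous and semialgebraic family of tame bi-Lipschitz and semialgebraic homeomorphisms $F_t:\mathbb{R}^n\to\mathbb{R}^n$, $t\in\mathbb{R}$ (that is, the map $\mathbb{R}^n\times\mathbb{R}\ni(x,t)\mapsto F_t(x)\in\mathbb{R}^n$ is continuous and semialgebraic), such that $F_0$ is the identity and $F_1|_X=f$.
   Context: Subsets of Euclidean spaces carry the outer metric, i.e. the restriction of the Euclidean distance. A semialgebraic and bi-Lipschitz embedding $f:X\to\mathbb{R}^n$ of a closed semialgebraic set $X$ is a semialgebraic map whose image $f(X)$ is a closed subset of $\mathbb{R}^n$ and such that $f:X\to f(X)$ is a bijection with $f$ and $f^{-1}$ Lipschitz (and semialgebraic). A bi-Lipschitz homeomorphism of $\mathbb{R}^n$ is called tame if it is a composition of bi-Lipschitz homeomorphisms of the form $(x_1,\dots,x_n)\mapsto(x_1,\dots,x_{n-1},x_n+p(x_1,\dots,x_{n-1}))$ and linear mappings of $\mathbb{R}^n$ with determinant one. *)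

theory Defs
  imports "HOL-Analysis.Analysis"
begin

text \<open>The semialgebraic sets form the smallest Boolean algebra of subsets that contains all
  sets of the form \<open>{x. p x > 0}\<close> with \<open>p\<close> polynomial. Sets \<open>{x. p x = 0}\<close> need no separate
  clause: they are complements of \<open>{x. p x > 0} \<union> {x. - p x > 0}\<close>.\<close>

inductive semialgebraic :: "'a::euclidean_space set \<Rightarrow> bool" where
  pos: "real_polynomial_function p \<Longrightarrow> semialgebraic {x. p x > 0}"
| Un: "semialgebraic A \<Longrightarrow> semialgebraic B \<Longrightarrow> semialgebraic (A \<union> B)"
| Int: "semialgebraic A \<Longrightarrow> semialgebraic B \<Longrightarrow> semialgebraic (A \<inter> B)"
| Compl: "semialgebraic A \<Longrightarrow> semialgebraic (- A)"

definition semialgebraic_map ::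
  "'a::euclidean_space set \<Rightarrow> ('a \<Rightarrow> 'b::euclidean_space) \<Rightarrow> bool" where
  "semialgebraic_map X f \<longleftrightarrow> semialgebraic {(x, f x) |x. x \<in> X}"

text \<open>For a set \<open>B\<close> of \<open>d\<close> basis vectors this is the open cube \<open>(0,1)\<^sup>d\<close>, placed in the
  coordinate subspace spanned by \<open>B\<close>; for \<open>d = 0\<close> it is the one-point set \<open>{0}\<close>.\<close>

definition open_cube :: "'a::euclidean_space set \<Rightarrow> 'a set" where
  "open_cube B = {x. \<forall>b\<in>Basis. if b \<in> B then 0 < x \<bullet> b \<and> x \<bullet> b < 1 else x \<bullet> b = 0}"

text \<open>The dimension of \<open>X\<close> is the largest \<open>d\<close> such that \<open>X\<close> contains a set semialgebraically
  homeomorphic to \<open>(0,1)\<^sup>d\<close>. The value is an integer because \<open>{}\<close> has dimension \<open>- 1\<close>.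
  The cubes of dimension at most \<open>DIM('a)\<close> suffice by invariance of domain.\<close>

definition semialgebraic_dim :: "'a::euclidean_space set \<Rightarrow> int" where
  "semialgebraic_dim X =
     Max (insert (- 1) {int (card B) |B. B \<subseteq> (Basis :: 'a set) \<and>
       (\<exists>S h g. S \<subseteq> X \<and> homeomorphism (open_cube B) S h g \<and>
                semialgebraic_map (open_cube B) h)})"

definition bilipschitz :: "'a::metric_space set \<Rightarrow> 'b::metric_space set \<Rightarrow> ('a \<Rightarrow> 'b) \<Rightarrow> bool" where
  "bilipschitz X Y f \<longleftrightarrow> bij_betw f X Y \<and>
     (\<exists>L. L-lipschitz_on X f) \<and> (\<exists>L. L-lipschitz_on Y (inv_into X f))"

definition semialgebraic_bilipschitz ::
  "'a::euclidean_space set \<Rightarrow> 'b::euclidean_space set \<Rightarrow> ('a \<Rightarrow> 'b) \<Rightarrow> bool" where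
  "semialgebraic_bilipschitz X Y f \<longleftrightarrow> bilipschitz X Y f \<and>
     semialgebraic_map X f \<and> semialgebraic_map Y (inv_into X f)"

definition semialgebraic_bilipschitz_embedding ::
  "'a::euclidean_space set \<Rightarrow> ('a \<Rightarrow> 'b::euclidean_space) \<Rightarrow> bool" where
  "semialgebraic_bilipschitz_embedding X f \<longleftrightarrow>
     closed (f ` X) \<and> semialgebraic_bilipschitz X (f ` X) f"

text \<open>The index type carries a linear order, so that the last coordinate \<open>x\<^sub>n\<close> is defined.\<close>

definition last_index :: "'n::{finite,linorder}" where
  "last_index = Max UNIV"

definition depends_on_initial_coords :: "(real^'n::{finite,linorder} \<Rightarrow> real) \<Rightarrow> bool" where
  "depends_on_initial_coords p \<longleftrightarrow>
     (\<forall>x y. (\<forall>i. i \<noteq> last_index \<longrightarrow> x $ i = y $ i) \<longrightarrow> p x = p y)"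

definition shear :: "(real^'n::{finite,linorder} \<Rightarrow> real) \<Rightarrow> real^'n::_ \<Rightarrow> real^'n::_" where
  "shear p x = (\<chi> i. if i = last_index then x $ i + p x else x $ i)"

inductive tame :: "(real^'n::{finite,linorder} \<Rightarrow> real^'n::_) \<Rightarrow> bool" where
  shear: "depends_on_initial_coords p \<Longrightarrow> bilipschitz UNIV UNIV (shear p) \<Longrightarrow> tame (shear p)"
| linear: "linear A \<Longrightarrow> det (matrix A) = 1 \<Longrightarrow> tame A"
| comp: "tame F \<Longrightarrow> tame G \<Longrightarrow> tame (F \<circ> G)"

end

theory Submission
  imports Defs
begin

text \<open>
  A shear \<open>u \<mapsto> u + p(u) v\<close>, where \<open>p\<close> is Lipschitz, semialgebraic and constant along \<open>v\<close>, is tame, and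
  so is the family \<open>u \<mapsto> u + t p(u) v\<close>; it suffices to join the inclusion of \<open>X\<close> to \<open>f\<close> by such shears.
  If \<open>v\<close> is not a limit of directions of secants of \<open>g(X)\<close>, then the projection along \<open>v\<close> is
  bi-Lipschitz on \<open>g(X)\<close>, and by McShane extension every Lipschitz semialgebraic \<open>h\<close> on \<open>X\<close> gives a shear
  that carries \<open>g\<close> to \<open>g + h v\<close>. Such \<open>v\<close> are dense: every projection of \<open>g(X)\<close> to \<open>k + 1\<close> coordinates lies
  in a hypersurface, hence polynomials of degree \<open>D\<close> restricted to \<open>g(X)\<close> form a space of dimension
  \<open>O(D\<^sup>k)\<close>, and as \<open>n > 2 k + 1\<close> some nonzero polynomial vanishes on all multiples of all secants.
  Replacing the coordinates of \<open>x\<close> by those of \<open>f(x)\<close> one at a time, along transversal directions close to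
  the axes, leads to \<open>f + B\<close> with \<open>B\<close> linear and as small as desired. The directions of a basis transversal
  to \<open>f(X)\<close> remain transversal for small perturbations of \<open>f\<close>, so \<open>B\<close> can be removed again.

  Quantifier elimination is obtained by counting the roots of a polynomial \<open>p\<close> by sign changes between the
  roots of \<open>p'\<close> and of remainders modulo \<open>p\<close>, which have smaller degree. The projections of \<open>g(X)\<close> to
  \<open>k + 1\<close> coordinates lie in hypersurfaces because a projection with nonempty interior would have a
  semialgebraic section (lexicographic minimum of the fibre) that is continuous on some ball, which would
  give a cube of dimension \<open>k + 1\<close> in \<open>X\<close>.
\<close>

text \<open>Transversality must hold with a uniform constant, and a direction that merely differs
  from all secant directions does not give one. The zeros of the polynomial that vanishes on all
  multiples of secants form a closed set, so a whole ball around any v outside of it misses the cone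
  of secants, which yields the constant. Such v are dense, but the axes themselves may be bad.
  Moving coordinate j along v = e_j + w, with w small and w_j = 0, also changes the other
  coordinates by h w. The shear u \<mapsto> u - u_j w removes the part of this that depends on f and
  leaves an error that is linear in x; this is the origin of B. Roots are counted and not only shown
  to exist, since a root between zeros of p' is visible only as a difference between what happens at
  the left and at the right ends of intervals. Cardinalities can be subtracted, existence statements
  cannot. All shears carry the same factor t, so the family starts at the identity and its member at
  t = 1 settles the first claim as well.\<close>

lemmas rpf_linear = real_polynomial_function.intros(1)
lemmas rpf_const = real_polynomial_function.intros(2)
lemmas rpf_mult = real_polynomial_function.intros(4)

section \<open>Semialgebraic sets and functions with finitely many values\<close>

lemma semialgebraic_UNIV: "semialgebraic (UNIV :: 'a::euclidean_space set)"
proof -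
  have "semialgebraic {x::'a. (1::real) > 0}" by (rule semialgebraic.pos) auto
  then show ?thesis by simp
qed

lemma semialgebraic_empty: "semialgebraic ({} :: 'a::euclidean_space set)"
  using semialgebraic.Compl[OF semialgebraic_UNIV] by simp

lemma semialgebraic_UN:
  assumes "finite I" "\<And>i. i \<in> I \<Longrightarrow> semialgebraic (A i)"
  shows "semialgebraic (\<Union>i\<in>I. A i)"
  using assms by (induction I rule: finite_induct) (auto intro: semialgebraic_empty semialgebraic.Un)

lemma semialgebraic_sgn_eq:
  assumes p: "real_polynomial_function p"
  shows "semialgebraic {x. sgn (p x) = s}"
proof -
  have pos: "semialgebraic {x. p x > 0}" using p by (rule semialgebraic.pos)
  have "real_polynomial_function (\<lambda>x. (-1) * p x)" using p by (intro rpf_mult rpf_const)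
  then have "semialgebraic {x. (-1) * p x > 0}" by (rule semialgebraic.pos)
  then have neg: "semialgebraic {x. p x < 0}" by simp
  have zero: "semialgebraic (- ({x. p x > 0} \<union> {x. p x < 0}))"
    using pos neg by (intro semialgebraic.Compl semialgebraic.Un)
  have "{x. sgn (p x) = s} = (if s = 1 then {x. p x > 0} else if s = -1 then {x. p x < 0}
      else if s = 0 then - ({x. p x > 0} \<union> {x. p x < 0}) else {})"
    by (auto simp: sgn_if)
  then show ?thesis using pos neg zero by (simp add: semialgebraic_empty)
qed

text \<open>Sign vectors and root counts are functions of this kind. They may be combined by
  arbitrary functions, which replaces a syntax of formulas.\<close>

definition sa_simple :: "('a::euclidean_space \<Rightarrow> 'b) \<Rightarrow> bool" where
  "sa_simple f \<longleftrightarrow> finite (range f) \<and> (\<forall>v. semialgebraic {x. f x = v})"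

lemma sa_simple_const: "sa_simple (\<lambda>x. c)"
proof -
  have "semialgebraic {x::'a. c = v}" for v
    by (cases "c = v") (auto simp: semialgebraic_UNIV semialgebraic_empty)
  then show ?thesis by (auto simp: sa_simple_def)
qed

lemma sa_simple_comp2:
  assumes f: "sa_simple f" and g: "sa_simple g"
  shows "sa_simple (\<lambda>x. h (f x) (g x))"
  unfolding sa_simple_def
proof (intro conjI allI)
  have fin: "finite (range f \<times> range g)" using f g by (simp add: sa_simple_def)
  have "range (\<lambda>x. h (f x) (g x)) \<subseteq> (\<lambda>z. h (fst z) (snd z)) ` (range f \<times> range g)"
  proof
    fix y assume "y \<in> range (\<lambda>x. h (f x) (g x))"
    then obtain x where "y = h (f x) (g x)" by blast
    then show "y \<in> (\<lambda>z. h (fst z) (snd z)) ` (range f \<times> range g)"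
      by (intro image_eqI[of _ _ "(f x, g x)"]) simp_all
  qed
  then show "finite (range (\<lambda>x. h (f x) (g x)))"
    using fin by (meson finite_imageI finite_subset)
  fix v
  define Z where "Z = {z \<in> range f \<times> range g. h (fst z) (snd z) = v}"
  have "{x. h (f x) (g x) = v} = (\<Union>z\<in>Z. {x. f x = fst z} \<inter> {x. g x = snd z})"
    unfolding Z_def by force
  moreover have "semialgebraic \<dots>"
  proof (rule semialgebraic_UN)
    show "finite Z" using fin by (simp add: Z_def)
    show "semialgebraic ({x. f x = fst z} \<inter> {x. g x = snd z})" for z
      using f g by (intro semialgebraic.Int) (simp_all add: sa_simple_def)
  qed
  ultimately show "semialgebraic {x. h (f x) (g x) = v}" by simp
qed

lemma sa_simple_comp: "sa_simple f \<Longrightarrow> sa_simple (\<lambda>x. h (f x))"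
  using sa_simple_comp2[of f f "\<lambda>a b. h a"] by simp

lemma sa_simple_bool: "sa_simple P \<longleftrightarrow> semialgebraic {x. P x}"
proof
  assume "sa_simple P"
  then have "semialgebraic {x. P x = True}" unfolding sa_simple_def by blast
  then show "semialgebraic {x. P x}" by simp
next
  assume *: "semialgebraic {x. P x}"
  have "semialgebraic {x. P x = v}" for v
    using * semialgebraic.Compl[OF *] by (cases v) (auto simp: Compl_eq)
  then show "sa_simple P" by (simp add: sa_simple_def)
qed

lemma sa_simple_if:
  "sa_simple c \<Longrightarrow> sa_simple f \<Longrightarrow> sa_simple g \<Longrightarrow> sa_simple (\<lambda>x. if c x then f x else g x)"
  using sa_simple_comp2[of "\<lambda>x. (c x, f x)" g "\<lambda>(a,b) d. if a then b else d"]
    sa_simple_comp2[of c f Pair] by simp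

lemma sa_simple_map:
  assumes "\<And>g. g \<in> set gs \<Longrightarrow> sa_simple (F g)"
  shows "sa_simple (\<lambda>x. map (\<lambda>g. F g x) gs)"
  using assms
proof (induction gs)
  case Nil then show ?case by (simp add: sa_simple_const)
next
  case (Cons g gs)
  then show ?case
    using sa_simple_comp2[of "F g" "\<lambda>x. map (\<lambda>g. F g x) gs" Cons] by simp
qed

lemma sa_simple_sgn:
  assumes "real_polynomial_function p"
  shows "sa_simple (\<lambda>x. sgn (p x))"
proof -
  have "range (\<lambda>x. sgn (p x)) \<subseteq> {-1, 0, 1}" by (auto simp: sgn_if)
  then show ?thesis
    using semialgebraic_sgn_eq[OF assms] by (auto simp: sa_simple_def intro: finite_subset)
qed

text \<open>An arbitrary predicate \<open>\<phi>\<close> on the sign vector serves as normal form,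
  so Boolean operations at most concatenate the lists of polynomials and no disjunctive normal form
  has to be computed.\<close>

lemma semialgebraic_signsE:
  assumes "semialgebraic A"
  obtains ps :: "('a::euclidean_space \<Rightarrow> real) list" and \<phi> where
    "\<And>p. p \<in> set ps \<Longrightarrow> real_polynomial_function p" "A = {x. \<phi> (map (\<lambda>p. sgn (p x)) ps)}"
proof -
  have "\<exists>ps \<phi>. (\<forall>p\<in>set ps. real_polynomial_function p) \<and> A = {x. \<phi> (map (\<lambda>p. sgn (p x)) ps)}"
    using assms
  proof (induction rule: semialgebraic.induct)
    case (pos p)
    show ?case using pos by (intro exI[of _ "[p]"] exI[of _ "\<lambda>l. hd l = 1"]) (auto simp: sgn_if)
  next
    case (Un A B)
    then obtain ps \<phi> qs \<psi> where
      *: "\<forall>p\<in>set ps. real_polynomial_function p" "A = {x. \<phi> (map (\<lambda>p. sgn (p x)) ps)}"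
      "\<forall>p\<in>set qs. real_polynomial_function p" "B = {x. \<psi> (map (\<lambda>p. sgn (p x)) qs)}" by metis
    show ?case
      by (intro exI[of _ "ps @ qs"] exI[of _ "\<lambda>l. \<phi> (take (length ps) l) \<or> \<psi> (drop (length ps) l)"])
         (use * in auto)
  next
    case (Int A B)
    then obtain ps \<phi> qs \<psi> where
      *: "\<forall>p\<in>set ps. real_polynomial_function p" "A = {x. \<phi> (map (\<lambda>p. sgn (p x)) ps)}"
      "\<forall>p\<in>set qs. real_polynomial_function p" "B = {x. \<psi> (map (\<lambda>p. sgn (p x)) qs)}" by metis
    show ?case
      by (intro exI[of _ "ps @ qs"] exI[of _ "\<lambda>l. \<phi> (take (length ps) l) \<and> \<psi> (drop (length ps) l)"])
         (use * in auto)
  next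
    case (Compl A)
    then obtain ps \<phi> where
      *: "\<forall>p\<in>set ps. real_polynomial_function p" "A = {x. \<phi> (map (\<lambda>p. sgn (p x)) ps)}" by metis
    show ?case by (intro exI[of _ ps] exI[of _ "\<lambda>l. \<not> \<phi> l"]) (use * in auto)
  qed
  then show ?thesis using that by blast
qed

section \<open>Polynomials with parameters\<close>

text \<open>The bound \<open>d\<close> is on the number of coefficients: \<open>d = 0\<close> means the zero polynomial.\<close>

definition poly_family :: "nat \<Rightarrow> ('a::euclidean_space \<Rightarrow> real poly) \<Rightarrow> bool" where
  "poly_family d P \<longleftrightarrow> (\<forall>j. real_polynomial_function (\<lambda>x. coeff (P x) j)) \<and> (\<forall>x. \<forall>j\<ge>d. coeff (P x) j = 0)"

lemma poly_family_mono: "poly_family d P \<Longrightarrow> d \<le> e \<Longrightarrow> poly_family e P"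
  by (auto simp: poly_family_def)

lemma poly_family_degree: "poly_family d P \<Longrightarrow> degree (P x) \<le> d"
  by (auto simp: poly_family_def intro!: degree_le)

lemma poly_family_degree_less: "poly_family (Suc d) P \<Longrightarrow> degree (P x) \<le> d"
  by (auto simp: poly_family_def intro!: degree_le)

lemma poly_family_add: "poly_family d P \<Longrightarrow> poly_family d Q \<Longrightarrow> poly_family d (\<lambda>x. P x + Q x)"
  by (auto simp: poly_family_def)

lemma poly_family_smult: "poly_family d P \<Longrightarrow> real_polynomial_function c \<Longrightarrow> poly_family d (\<lambda>x. smult (c x) (P x))"
  by (auto simp: poly_family_def)

lemma poly_family_monom_mult:
  assumes "poly_family d P" "real_polynomial_function c"
  shows "poly_family (k + d) (\<lambda>x. monom (c x) k * P x)"
proof -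
  have "real_polynomial_function (\<lambda>x. if j < k then 0 else c x * coeff (P x) (j - k))" for j
    using assms by (cases "j < k") (auto simp: poly_family_def)
  then show ?thesis using assms by (auto simp: poly_family_def coeff_monom_mult)
qed

lemma poly_family_mult:
  assumes P: "poly_family d P" and Q: "poly_family e Q"
  shows "poly_family (Suc (d + e)) (\<lambda>x. P x * Q x)"
  unfolding poly_family_def
proof (intro conjI allI impI)
  fix j
  show "real_polynomial_function (\<lambda>x. coeff (P x * Q x) j)"
    unfolding coeff_mult using assms
    by (intro real_polynomial_function_sum rpf_mult) (auto simp: poly_family_def)
next
  fix x j assume "Suc (d + e) \<le> j"
  moreover have "degree (P x * Q x) \<le> d + e"
    using degree_mult_le[of "P x" "Q x"] poly_family_degree[OF P, of x] poly_family_degree[OF Q, of x] by linarith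
  ultimately show "coeff (P x * Q x) j = 0" by (simp add: coeff_eq_0)
qed

lemma poly_family_pderiv: "poly_family (Suc d) P \<Longrightarrow> poly_family d (\<lambda>x. pderiv (P x))"
  unfolding poly_family_def coeff_pderiv by auto

lemma real_polynomial_function_split:
  fixes p :: "'a::euclidean_space \<times> real \<Rightarrow> real"
  assumes "real_polynomial_function p"
  obtains d P where "poly_family d P" "\<And>x t. p (x, t) = poly (P x) t"
proof -
  have "\<exists>d P. poly_family d P \<and> (\<forall>x t. p (x, t) = poly (P x) t)"
    using assms
  proof (induction rule: real_polynomial_function.induct)
    case lin: (linear f)
    interpret bounded_linear f by fact
    have eq: "f (x, t) = f (x, 0) + t * f (0, 1)" for x t
      using add[of "(x,0)" "(0,t)"] scaleR[of t "(0,1)"] by simp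
    have "bounded_linear (\<lambda>x. f (x, 0))"
      by (intro bounded_linear_compose[OF lin] bounded_linear_intros)
    then have "real_polynomial_function (\<lambda>x. f (x, 0))" by (rule rpf_linear)
    moreover have cf: "coeff [:a, b:] j = (if j = 0 then a else if j = 1 then b else 0)" for a b :: real and j
      by (cases j) (auto simp: coeff_pCons split: nat.split)
    ultimately have "real_polynomial_function (\<lambda>x. coeff [:f (x,0), f (0,1):] j)" for j
      unfolding cf by (cases "j = 0"; cases "j = 1") (simp_all add: rpf_const)
    then have "poly_family 2 (\<lambda>x. [:f (x,0), f (0,1):])"
      unfolding poly_family_def by (simp add: cf)
    moreover have "\<forall>x t. f (x, t) = poly [:f (x,0), f (0,1):] t"
    proof (intro allI)
      fix x t show "f (x, t) = poly [:f (x,0), f (0,1):] t" using eq[of x t] by simp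
    qed
    ultimately show ?case by blast
  next
    case (const c)
    have "poly_family 1 (\<lambda>x::'a. [:c:])"
      by (simp add: poly_family_def rpf_const coeff_eq_0)
    moreover have "\<forall>x t. c = poly [:c:] t" by simp
    ultimately show ?case by blast
  next
    case (add f g)
    then obtain d P e Q where "poly_family d P" "poly_family e Q" and eq: "\<forall>x t. f (x, t) = poly (P x) t"
      "\<forall>x t. g (x, t) = poly (Q x) t" by blast
    then have "poly_family (max d e) (\<lambda>x. P x + Q x)" by (auto intro!: poly_family_add elim: poly_family_mono)
    then show ?case using eq by (intro exI[of _ "max d e"] exI[of _ "\<lambda>x. P x + Q x"]) auto
  next
    case (mult f g)
    then obtain d P e Q where "poly_family d P" "poly_family e Q" and eq: "\<forall>x t. f (x, t) = poly (P x) t"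
      "\<forall>x t. g (x, t) = poly (Q x) t" by blast
    then have "poly_family (Suc (d + e)) (\<lambda>x. P x * Q x)" by (intro poly_family_mult)
    then show ?case using eq by (intro exI[of _ "Suc (d + e)"] exI[of _ "\<lambda>x. P x * Q x"]) auto
  qed
  then show ?thesis using that by blast
qed

lemma real_polynomial_function_comp_linear:
  assumes "real_polynomial_function p" "bounded_linear f"
  shows "real_polynomial_function (\<lambda>x. p (f x))"
  using real_polynomial_function_compose[OF polynomial_function_bounded_linear[OF assms(2)] assms(1)]
  by (simp add: o_def)

lemma poly_family_imp_real_polynomial_function:
  assumes "poly_family d P"
  shows "real_polynomial_function (\<lambda>z. poly (P (fst z)) (snd z))"
proof -
  have 1: "poly (P x) t = (\<Sum>j\<le>d. coeff (P x) j * t ^ j)" for x t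
    using arg_cong[OF poly_as_sum_of_monoms'[OF poly_family_degree[OF assms, of x]], of "\<lambda>p. poly p t"]
    by (simp add: poly_sum poly_monom)
  have 2: "real_polynomial_function (\<lambda>z::'a \<times> real. snd z)" by (rule rpf_linear) (rule bounded_linear_snd)
  show ?thesis unfolding 1
  proof (intro real_polynomial_function_sum rpf_mult)
    fix j
    show "real_polynomial_function (\<lambda>x::'a \<times> real. coeff (P (fst x)) j)"
      using real_polynomial_function_comp_linear[OF _ bounded_linear_fst, of "\<lambda>x. coeff (P x) j"] assms
      by (auto simp: poly_family_def)
    show "real_polynomial_function (\<lambda>x::'a \<times> real. snd x ^ j)"
      using 2 by (intro real_polynomial_function_power)
  qed simp
qed

text \<open>Pseudo-division: at a root of \<open>P x\<close> any multiple of \<open>P x\<close> may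
  be added, here to cancel the top coefficient of \<open>Q x\<close>. Instead of dividing by the
  leading coefficient a of \<open>P x\<close>, \<open>Q x\<close> is multiplied by a^2, which keeps
  the coefficients polynomial and preserves signs wherever a \<noteq> 0.\<close>

lemma poly_family_reduce:
  assumes P: "poly_family (Suc d) P" and Q: "poly_family e Q"
  shows "\<exists>R. poly_family d R \<and> (\<forall>x t. coeff (P x) d \<noteq> 0 \<longrightarrow> poly (P x) t = 0 \<longrightarrow>
    sgn (poly (R x) t) = sgn (poly (Q x) t))"
  using Q
proof (induction e arbitrary: Q)
  case 0
  then show ?case using poly_family_mono[of 0 Q d] by auto
next
  case (Suc e)
  show ?case
  proof (cases "Suc e \<le> d")
    case True
    then show ?thesis using Suc.prems poly_family_mono by blast
  next
    case False
    define Q' where "Q' = (\<lambda>x. smult (coeff (P x) d * coeff (P x) d) (Q x) +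
      monom (- 1 * (coeff (P x) d * coeff (Q x) e)) (e - d) * P x)"
    have "poly_family (Suc e) Q'"
    proof -
      have "poly_family (e - d + Suc d) (\<lambda>x. monom (- 1 * (coeff (P x) d * coeff (Q x) e)) (e - d) * P x)"
        using P Suc.prems by (intro poly_family_monom_mult rpf_mult rpf_const) (auto simp: poly_family_def)
      moreover have "e - d + Suc d = Suc e" using False by simp
      ultimately show ?thesis unfolding Q'_def using P Suc.prems
        by (intro poly_family_add poly_family_smult rpf_mult) (auto simp: poly_family_def)
    qed
    moreover have "coeff (Q' x) e = 0" for x
      using False by (simp add: Q'_def coeff_monom_mult)
    ultimately have "poly_family e Q'" unfolding poly_family_def by (metis le_neq_implies_less Suc_leI)
    then obtain R where R: "poly_family d R" "\<forall>x t. coeff (P x) d \<noteq> 0 \<longrightarrow> poly (P x) t = 0 \<longrightarrow>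
      sgn (poly (R x) t) = sgn (poly (Q' x) t)" using Suc.IH by blast
    have "sgn (poly (Q' x) t) = sgn (poly (Q x) t)" if "coeff (P x) d \<noteq> 0" "poly (P x) t = 0" for x t
      using that by (simp add: Q'_def sgn_mult)
    then show ?thesis using R by auto
  qed
qed

section \<open>Counting real roots by sign changes\<close>

text \<open>The signs of \<open>p\<close> immediately to the right and left of \<open>t\<close> and near \<open>-\<infinity>\<close>, computed from the
  derivatives at \<open>t\<close> and the coefficients, so that they depend semialgebraically on parameters.\<close>

primrec rgerm :: "nat \<Rightarrow> real poly \<Rightarrow> real \<Rightarrow> real" where
  "rgerm 0 p t = sgn (poly p t)"
| "rgerm (Suc n) p t = (if poly p t \<noteq> 0 then sgn (poly p t) else rgerm n (pderiv p) t)"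

primrec lgerm :: "nat \<Rightarrow> real poly \<Rightarrow> real \<Rightarrow> real" where
  "lgerm 0 p t = sgn (poly p t)"
| "lgerm (Suc n) p t = (if poly p t \<noteq> 0 then sgn (poly p t) else - lgerm n (pderiv p) t)"

definition bgerm :: "real poly \<Rightarrow> real" where
  "bgerm p = (- 1) ^ degree p * sgn (lead_coeff p)"

lemma eventually_sgn_poly_nz:
  fixes p :: "real poly"
  assumes "poly p t \<noteq> 0"
  shows "eventually (\<lambda>u. sgn (poly p u) = sgn (poly p t)) (at t within S)"
proof -
  have "((\<lambda>u. poly p u) \<longlongrightarrow> poly p t) (at t within S)" by (intro tendsto_intros)
  then show ?thesis
    using assms order_tendstoD[of "\<lambda>u. poly p u" "poly p t" "at t within S" 0]
    by (cases "poly p t > 0") (auto elim!: eventually_mono simp: sgn_if)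
qed

lemma degree_pderiv_le: "degree p \<le> Suc n \<Longrightarrow> degree (pderiv p) \<le> n" for p :: "real poly"
  by (simp add: degree_pderiv)

text \<open>At a root t the mean value theorem writes p u as (u - t) p' x with x between t and u, so
  p inherits the sign of p'. To the left of t the factor is negative, which explains the minus sign
  in \<open>lgerm\<close>.\<close>

lemma eventually_rgerm:
  "degree p \<le> n \<Longrightarrow> eventually (\<lambda>u. sgn (poly p u) = rgerm n p t) (at_right t)"
proof (induction n arbitrary: p)
  case 0
  then obtain c where "p = [:c:]" using degree_eq_zeroE by blast
  then show ?case by simp
next
  case (Suc n)
  show ?case
  proof (cases "poly p t = 0")
    case False
    then show ?thesis using eventually_sgn_poly_nz by simp
  next
    case True
    from Suc.IH[OF degree_pderiv_le[OF Suc.prems]]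
    obtain b where b: "b > t" "\<And>u. t < u \<Longrightarrow> u < b \<Longrightarrow> sgn (poly (pderiv p) u) = rgerm n (pderiv p) t"
      by (auto simp: eventually_at_right_field)
    have "sgn (poly p u) = rgerm n (pderiv p) t" if u: "t < u" "u < b" for u
    proof -
      obtain x where x: "t < x" "x < u" "poly p u - poly p t = (u - t) * poly (pderiv p) x"
        using poly_MVT[OF u(1), of p] by blast
      then show ?thesis using b(2)[of x] u True by (simp add: sgn_mult)
    qed
    then show ?thesis using True b(1) by (auto simp: eventually_at_right_field)
  qed
qed

lemma eventually_lgerm:
  "degree p \<le> n \<Longrightarrow> eventually (\<lambda>u. sgn (poly p u) = lgerm n p t) (at_left t)"
proof (induction n arbitrary: p)
  case 0
  then obtain c where "p = [:c:]" using degree_eq_zeroE by blast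
  then show ?case by simp
next
  case (Suc n)
  show ?case
  proof (cases "poly p t = 0")
    case False
    then show ?thesis using eventually_sgn_poly_nz by simp
  next
    case True
    from Suc.IH[OF degree_pderiv_le[OF Suc.prems]]
    obtain b where b: "b < t" "\<And>u. b < u \<Longrightarrow> u < t \<Longrightarrow> sgn (poly (pderiv p) u) = lgerm n (pderiv p) t"
      by (auto simp: eventually_at_left_field)
    have "sgn (poly p u) = - lgerm n (pderiv p) t" if u: "b < u" "u < t" for u
    proof -
      obtain x where x: "u < x" "x < t" "poly p t - poly p u = (t - u) * poly (pderiv p) x"
        using poly_MVT[OF u(2), of p] by blast
      then have "poly p u = - ((t - u) * poly (pderiv p) x)" using True by simp
      then show ?thesis using b(2)[of x] u x by (simp add: sgn_mult sgn_minus)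
    qed
    then show ?thesis using True b(1) by (auto simp: eventually_at_left_field)
  qed
qed

lemma eventually_sgn_at_top:
  fixes p :: "real poly"
  shows "eventually (\<lambda>u. sgn (poly p u) = sgn (lead_coeff p)) at_top"
proof -
  have *: "eventually (\<lambda>u. poly q u > 0) at_top" if "lead_coeff q > 0" for q :: "real poly"
    using poly_pinfty_gt_lc[OF that] that unfolding eventually_at_top_linorder
    by (meson less_le_trans)
  consider "p = 0" | "lead_coeff p > 0" | "lead_coeff p < 0"
    by (metis leading_coeff_neq_0 linorder_neqE_linordered_idom)
  then show ?thesis
  proof cases
    case 2 then show ?thesis using *[of p] by (auto elim!: eventually_mono)
  next
    case 3
    then have "eventually (\<lambda>u. poly (- p) u > 0) at_top" by (intro *) simp
    then show ?thesis using 3 by (auto elim!: eventually_mono)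
  qed simp
qed

lemma eventually_bgerm: "eventually (\<lambda>u. sgn (poly p u) = bgerm p) at_bot"
proof -
  \<comment> \<open>The reflection q u = p (- u) moves the question to +infinity.\<close>
  define q where "q = pcompose p [:0, - 1:]"
  have lc: "sgn (lead_coeff q) = bgerm p"
    unfolding q_def bgerm_def by (subst lead_coeff_comp) (simp_all add: sgn_mult power_sgn)
  have "eventually (\<lambda>u. sgn (poly q u) = sgn (lead_coeff q)) at_top"
    by (rule eventually_sgn_at_top)
  then have "eventually (\<lambda>u. sgn (poly p (- u)) = bgerm p) at_top"
    by (simp add: lc) (simp add: q_def poly_pcompose)
  then show ?thesis unfolding at_bot_mirror eventually_filtermap .
qed

text \<open>The alternative \<open>p = 0\<close> matters because members of a family may vanish
  identically at some parameters; their sign is constant too.\<close>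

lemma sgn_poly_eq:
  fixes p :: "real poly"
  assumes "p = 0 \<or> (\<forall>x. min t u \<le> x \<and> x \<le> max t u \<longrightarrow> poly p x \<noteq> 0)"
  shows "sgn (poly p t) = sgn (poly p u)"
proof (rule ccontr)
  assume neq: "sgn (poly p t) \<noteq> sgn (poly p u)"
  then have nz: "\<forall>x. min t u \<le> x \<and> x \<le> max t u \<longrightarrow> poly p x \<noteq> 0" using assms by auto
  then have "poly p t \<noteq> 0" "poly p u \<noteq> 0" by auto
  with neq have neg: "poly p t * poly p u < 0"
    by (auto simp: sgn_if mult_less_0_iff split: if_splits)
  consider "t < u" | "u < t" using neq by (cases t u rule: linorder_cases) auto
  then show False
  proof cases
    case 1 then show False using poly_IVT[OF 1 neg] nz by auto
  next
    case 2 then show False using poly_IVT[of u t p] neg nz by (auto simp: mult.commute)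
  qed
qed

text \<open>Stated additively so that the contributions of consecutive intervals telescope.\<close>

lemma card_roots_interval:
  fixes p :: "real poly"
  assumes eu: "e < u" and s: "s = 1 \<or> s = - 1"
    and mono: "\<And>t. e < t \<Longrightarrow> t < u \<Longrightarrow> sgn (poly (pderiv p) t) = s"
  shows "card {t. e < t \<and> t < u \<and> poly p t = 0} + (if s * poly p u \<le> 0 then 1 else 0)
    = (if s * poly p e < 0 then 1 else 0)"
proof -
  \<comment> \<open>\<open>q\<close> is increasing on [e, u], so a root inside is unique and exists
    iff q e < 0 < q u. The inequality at u is weak because u lies outside of the counted
    interval.\<close>
  define q where "q = smult s p"
  have q: "poly q t = s * poly p t" for t by (simp add: q_def)
  have incr: "poly q a < poly q b" if ab: "e \<le> a" "a < b" "b \<le> u" for a b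
  proof -
    obtain x where x: "a < x" "x < b" "poly q b - poly q a = (b - a) * poly (pderiv q) x"
      using poly_MVT[OF ab(2), of q] by blast
    have "sgn (poly (pderiv p) x) = s" using x ab by (intro mono) auto
    then have "s * poly (pderiv p) x > 0" using s by (auto simp: sgn_if split: if_splits)
    then have "poly (pderiv q) x > 0" by (simp add: q_def pderiv_smult)
    then have "(b - a) * poly (pderiv q) x > 0" using ab by simp
    then show ?thesis using x(3) by linarith
  qed
  have root: "poly p t = 0 \<longleftrightarrow> poly q t = 0" for t using s q by auto
  show ?thesis
  proof (cases "poly q e < 0 \<and> 0 < poly q u")
    case True
    then obtain z where z: "e < z" "z < u" "poly q z = 0" using poly_IVT_pos[OF eu, of q] by blast
    have "{t. e < t \<and> t < u \<and> poly p t = 0} = {z}"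
    proof -
      have u: "t = z" if "e < t" "t < u" "poly q t = 0" for t
        using linorder_less_linear[of t z]
      proof (elim disjE)
        assume "t < z" with incr[of t z] that z show ?thesis by simp
      next
        assume "t = z" then show ?thesis .
      next
        assume "z < t" with incr[of z t] that z show ?thesis by simp
      qed
      show ?thesis unfolding root using z by (intro set_eqI iffI) (use u in blast)+
    qed
    then show ?thesis using True q by simp
  next
    case False
    have "{t. e < t \<and> t < u \<and> poly p t = 0} = {}"
    proof -
      have False if "e < t" "t < u" "poly q t = 0" for t
        using incr[of e t] incr[of t u] that False by simp
      then show ?thesis using root by auto
    qed
    then have c0: "card {t. e < t \<and> t < u \<and> poly p t = 0} = 0" by (simp only: card.empty)
    have "poly q e < poly q u" using incr eu by simp
    with False show ?thesis unfolding q[symmetric] c0 by auto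
  qed
qed

text \<open>The right-hand side 1 is the left end term taken at -infinity: there p and p' have
  opposite signs, so s p is negative.\<close>

lemma card_roots_below:
  fixes p :: "real poly"
  assumes s: "s = 1 \<or> s = - 1"
    and mono: "\<And>t. t < u \<Longrightarrow> sgn (poly (pderiv p) t) = s"
  shows "card {t. t < u \<and> poly p t = 0} + (if s * poly p u \<le> 0 then 1 else 0) = 1"
proof -
  have pd: "bgerm (pderiv p) = s"
  proof -
    have "eventually (\<lambda>t. t < u) at_bot" by (rule eventually_gt_at_bot)
    with eventually_bgerm[of "pderiv p"]
    have "eventually (\<lambda>t. t < u \<and> sgn (poly (pderiv p) t) = bgerm (pderiv p)) at_bot"
      by eventually_elim auto
    then obtain t where "t < u" "sgn (poly (pderiv p) t) = bgerm (pderiv p)"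
      using eventually_happens'[of "at_bot :: real filter"] by (metis (mono_tags, lifting) trivial_limit_at_bot_linorder)
    then show ?thesis using mono by simp
  qed
  then have "pderiv p \<noteq> 0" using s by (auto simp: bgerm_def)
  then have deg: "degree p \<noteq> 0" using pderiv_eq_0_iff by blast
  have b: "bgerm p = - s"
  proof -
    obtain m where m: "degree p = Suc m" using deg not0_implies_Suc by blast
    then have "bgerm p = - bgerm (pderiv p)"
      by (simp add: bgerm_def degree_pderiv coeff_pderiv sgn_mult del: of_nat_Suc)
    then show ?thesis using pd by simp
  qed
  have "p \<noteq> 0" using deg by auto
  then have fin: "finite {t. poly p t = 0}" by (rule poly_roots_finite)
  \<comment> \<open>A point e to the left of u and of all roots reduces the half-line to a bounded
    interval.\<close>
  define m where "m = Min (insert u {t. poly p t = 0})"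
  have "eventually (\<lambda>t. t < m) at_bot" by (rule eventually_gt_at_bot)
  with eventually_bgerm[of p] have "eventually (\<lambda>t. t < m \<and> sgn (poly p t) = bgerm p) at_bot"
    by eventually_elim auto
  then obtain e where e: "e < m" "sgn (poly p e) = bgerm p"
    using eventually_happens'[of "at_bot :: real filter"] by (metis (mono_tags, lifting) trivial_limit_at_bot_linorder)
  have eu: "e < u" using e(1) fin unfolding m_def by (subst (asm) Min_gr_iff) auto
  have er: "e < t" if "poly p t = 0" for t
    using e(1) fin that unfolding m_def by (subst (asm) Min_gr_iff) auto
  have "{t. t < u \<and> poly p t = 0} = {t. e < t \<and> t < u \<and> poly p t = 0}" using er by auto
  moreover have "s * poly p e < 0" using e(2) b s by (auto simp: sgn_if split: if_splits)
  ultimately show ?thesis using card_roots_interval[OF eu s mono] by simp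
qed

lemma rgerm_interval:
  assumes "degree R \<le> n" "R = 0 \<or> (\<forall>x. e < x \<and> x \<le> t \<longrightarrow> poly R x \<noteq> 0)" "e < t"
  shows "sgn (poly R t) = rgerm n R e"
proof -
  have "eventually (\<lambda>x. e < x \<and> x < t) (at_right e)"
    using assms eventually_at_right_field by force
  with eventually_rgerm[OF assms(1), of e]
  have "eventually (\<lambda>x. e < x \<and> x < t \<and> sgn (poly R x) = rgerm n R e) (at_right e)"
    by eventually_elim auto
  then obtain x where x: "e < x" "x < t" "sgn (poly R x) = rgerm n R e"
    using eventually_happens'[of "at_right e"] by (metis (mono_tags, lifting) trivial_limit_at_right_real)
  have "sgn (poly R t) = sgn (poly R x)" using assms x by (intro sgn_poly_eq) auto
  then show ?thesis using x by simp
qed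

lemma lgerm_interval:
  assumes "degree R \<le> n" "R = 0 \<or> (\<forall>x. e < x \<and> x < u \<longrightarrow> poly R x \<noteq> 0)" "e < t" "t < u"
  shows "sgn (poly R t) = lgerm n R u"
proof -
  have "eventually (\<lambda>x. e < x \<and> x < u) (at_left u)"
    using assms eventually_at_left_field by force
  with eventually_lgerm[OF assms(1), of u]
  have "eventually (\<lambda>x. e < x \<and> x < u \<and> sgn (poly R x) = lgerm n R u) (at_left u)"
    by eventually_elim auto
  then obtain x where x: "e < x" "x < u" "sgn (poly R x) = lgerm n R u"
    using eventually_happens'[of "at_left u"] by (metis (mono_tags, lifting) trivial_limit_at_left_real)
  have "sgn (poly R t) = sgn (poly R x)" using assms x by (intro sgn_poly_eq) (force simp: min_def max_def split: if_splits)
  then show ?thesis using x by simp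
qed

lemma bgerm_interval:
  assumes "R = 0 \<or> (\<forall>x\<le>t. poly R x \<noteq> 0)"
  shows "sgn (poly R t) = bgerm R"
proof -
  have "eventually (\<lambda>x. x < t) at_bot" by (rule eventually_gt_at_bot)
  with eventually_bgerm[of R]
  have "eventually (\<lambda>x. x < t \<and> sgn (poly R x) = bgerm R) at_bot"
    by eventually_elim auto
  then obtain x where x: "x < t" "sgn (poly R x) = bgerm R"
    using eventually_happens'[of "at_bot :: real filter"] by (metis (mono_tags, lifting) trivial_limit_at_bot_linorder)
  have "sgn (poly R t) = sgn (poly R x)" using assms x by (intro sgn_poly_eq) auto
  then show ?thesis using x by simp
qed

text \<open>The roots of \<open>p\<close> outside the zero set \<open>E\<close> of a family containing \<open>p'\<close> are counted by
  sign changes of \<open>p\<close> on the intervals cut out by \<open>E\<close>: every interval contributes a term at its left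
  end point and a term at its right end point. This trades roots of \<open>p\<close> for roots of polynomials
  of smaller degree.\<close>

lemma card_roots_off:
  fixes p :: "real poly" and Rs :: "real poly list" and \<phi> :: "real list \<Rightarrow> bool"
  defines "E \<equiv> {t. \<exists>R\<in>set Rs. R \<noteq> 0 \<and> poly R t = 0}"
  assumes deg: "\<And>R. R \<in> set Rs \<Longrightarrow> degree R \<le> n"
    and pd: "pderiv p \<in> set Rs" "pderiv p \<noteq> 0"
  shows "card {t. t \<notin> E \<and> poly p t = 0 \<and> \<phi> (map (\<lambda>R. sgn (poly R t)) Rs)} +
      card {b\<in>E. \<phi> (map (\<lambda>R. lgerm n R b) Rs) \<and> lgerm n (pderiv p) b * poly p b \<le> 0} =
    card {a\<in>E. \<phi> (map (\<lambda>R. rgerm n R a) Rs) \<and> rgerm n (pderiv p) a * poly p a < 0} +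
      (if \<phi> (map bgerm Rs) then 1 else 0)"
proof -
  define B where "B = (\<lambda>t. \<phi> (map (\<lambda>R. sgn (poly R t)) Rs))"
  define BB where "BB = \<phi> (map bgerm Rs)"
  define L where "L = (\<lambda>b. \<phi> (map (\<lambda>R. lgerm n R b) Rs) \<and> lgerm n (pderiv p) b * poly p b \<le> 0)"
  define G where "G = (\<lambda>a. \<phi> (map (\<lambda>R. rgerm n R a) Rs) \<and> rgerm n (pderiv p) a * poly p a < 0)"
  have finE: "finite E"
  proof -
    have "E = (\<Union>R\<in>{R\<in>set Rs. R \<noteq> 0}. {t. poly R t = 0})" by (auto simp: E_def)
    then show ?thesis by (simp add: poly_roots_finite)
  qed
  have pnz: "p \<noteq> 0" using pd by auto
  have finp: "finite {t. poly p t = 0}" using pnz by (rule poly_roots_finite)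
  \<comment> \<open>One interval without points of \<open>E\<close>: all signs of \<open>Rs\<close>
    are constant on it, in particular that of p', and can be read off from the germs at either
    end.\<close>
  have seg: "card {t. e < t \<and> t < u \<and> poly p t = 0 \<and> B t} + (if L u then 1 else 0) = (if G e then 1 else 0)"
    if eu: "e < u" and none: "\<And>x. e < x \<Longrightarrow> x < u \<Longrightarrow> x \<notin> E" for e u
  proof -
    have nz: "R = 0 \<or> (\<forall>x. e < x \<and> x < u \<longrightarrow> poly R x \<noteq> 0)" if "R \<in> set Rs" for R
      using none that by (auto simp: E_def)
    define m where "m = (e + u) / 2"
    have m: "e < m" "m < u" using eu by (auto simp: m_def)
    have r: "sgn (poly R t) = rgerm n R e" if "R \<in> set Rs" "e < t" "t < u" for R t
      by (rule rgerm_interval) (use deg nz[OF that(1)] that in auto)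
    have l: "sgn (poly R t) = lgerm n R u" if "R \<in> set Rs" "e < t" "t < u" for R t
      by (rule lgerm_interval) (use deg nz that in auto)
    define s where "s = sgn (poly (pderiv p) m)"
    have s: "s = 1 \<or> s = - 1"
      using nz[OF pd(1)] pd(2) m by (auto simp: s_def sgn_if)
    have sr: "rgerm n (pderiv p) e = s" and sl: "lgerm n (pderiv p) u = s"
      using r[OF pd(1) m] l[OF pd(1) m] by (auto simp: s_def)
    have Bt: "B t = B m" if "e < t" "t < u" for t
    proof -
      have "map (\<lambda>R. sgn (poly R t)) Rs = map (\<lambda>R. sgn (poly R m)) Rs"
        using r[OF _ that] r[OF _ m] by simp
      then show ?thesis by (simp only: B_def)
    qed
    have Br: "B m = \<phi> (map (\<lambda>R. rgerm n R e) Rs)"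
    proof -
      have "map (\<lambda>R. sgn (poly R m)) Rs = map (\<lambda>R. rgerm n R e) Rs" using r[OF _ m] by simp
      then show ?thesis by (simp only: B_def)
    qed
    have Bl: "B m = \<phi> (map (\<lambda>R. lgerm n R u) Rs)"
    proof -
      have "map (\<lambda>R. sgn (poly R m)) Rs = map (\<lambda>R. lgerm n R u) Rs" using l[OF _ m] by simp
      then show ?thesis by (simp only: B_def)
    qed
    have L: "L u \<longleftrightarrow> B m \<and> s * poly p u \<le> 0" and G: "G e \<longleftrightarrow> B m \<and> s * poly p e < 0"
      by (simp_all only: L_def G_def Br[symmetric] Bl[symmetric] sr sl)
    show ?thesis
    proof (cases "B m")
      case True
      then have "{t. e < t \<and> t < u \<and> poly p t = 0 \<and> B t} = {t. e < t \<and> t < u \<and> poly p t = 0}"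
        using Bt by blast
      moreover have "card {t. e < t \<and> t < u \<and> poly p t = 0} + (if s * poly p u \<le> 0 then 1 else 0)
        = (if s * poly p e < 0 then 1 else 0)"
        by (rule card_roots_interval[OF eu s]) (use r[OF pd(1)] sr in simp)
      ultimately show ?thesis using True L G by simp
    next
      case False
      then have "{t. e < t \<and> t < u \<and> poly p t = 0 \<and> B t} = {}" using Bt by blast
      then have "card {t. e < t \<and> t < u \<and> poly p t = 0 \<and> B t} = 0" by (simp only: card.empty)
      then show ?thesis using False L G by simp
    qed
  qed
  have first: "card {t. t < u \<and> poly p t = 0 \<and> B t} + (if L u then 1 else 0) = (if BB then 1 else 0)"
    if none: "\<And>x. x < u \<Longrightarrow> x \<notin> E" for u
  proof -
    have nz: "R = 0 \<or> (\<forall>x. x < u \<longrightarrow> poly R x \<noteq> 0)" if "R \<in> set Rs" for R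
      using none that by (auto simp: E_def)
    define m where "m = u - 1"
    have m: "m < u" by (auto simp: m_def)
    have r: "sgn (poly R t) = bgerm R" if "R \<in> set Rs" "t < u" for R t
      by (rule bgerm_interval) (use nz[OF that(1)] that in auto)
    have l: "sgn (poly R m) = lgerm n R u" if "R \<in> set Rs" for R
    proof (rule lgerm_interval[where e = "m - 1"])
      show "R = 0 \<or> (\<forall>x. m - 1 < x \<and> x < u \<longrightarrow> poly R x \<noteq> 0)" using nz[OF that] by blast
    qed (use deg that m in auto)
    define s where "s = sgn (poly (pderiv p) m)"
    have s: "s = 1 \<or> s = - 1"
      using nz[OF pd(1)] pd(2) m by (auto simp: s_def sgn_if)
    have sr: "bgerm (pderiv p) = s" and sl: "lgerm n (pderiv p) u = s"
      using r[OF pd(1) m] l[OF pd(1)] by (auto simp: s_def)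
    have Bt: "B t = BB" if "t < u" for t
    proof -
      have "map (\<lambda>R. sgn (poly R t)) Rs = map bgerm Rs" using r[OF _ that] by simp
      then show ?thesis by (simp only: B_def BB_def)
    qed
    have Bl: "BB = \<phi> (map (\<lambda>R. lgerm n R u) Rs)"
    proof -
      have "map bgerm Rs = map (\<lambda>R. lgerm n R u) Rs" using l r[OF _ m] by simp
      then show ?thesis by (simp only: BB_def)
    qed
    have L: "L u \<longleftrightarrow> BB \<and> s * poly p u \<le> 0"
      by (simp_all only: L_def Bl[symmetric] sl)
    show ?thesis
    proof (cases BB)
      case True
      then have "{t. t < u \<and> poly p t = 0 \<and> B t} = {t. t < u \<and> poly p t = 0}"
        using Bt by blast
      moreover have "card {t. t < u \<and> poly p t = 0} + (if s * poly p u \<le> 0 then 1 else 0) = 1"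
        by (rule card_roots_below[OF s]) (use r[OF pd(1)] sr in simp)
      ultimately show ?thesis using True L by simp
    next
      case False
      then have "{t. t < u \<and> poly p t = 0 \<and> B t} = {}" using Bt by blast
      then have "card {t. t < u \<and> poly p t = 0 \<and> B t} = 0" by (simp only: card.empty)
      then show ?thesis using False L by simp
    qed
  qed
  \<comment> \<open>Induction over the points of \<open>E\<close> below u. The term for u stands
    apart because u need not belong to \<open>E\<close>; in the end u lies to the right of all
    zeros, where this term is 0.\<close>
  have main: "card {t. t < u \<and> t \<notin> E \<and> poly p t = 0 \<and> B t} + card {b\<in>E. b < u \<and> L b} + (if L u then 1 else 0)
    = card {a\<in>E. a < u \<and> G a} + (if BB then 1 else 0)" for u
  proof (induction "card {e\<in>E. e < u}" arbitrary: u rule: less_induct)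
    case less
    show ?case
    proof (cases "{e\<in>E. e < u} = {}")
      case True
      then have "{b\<in>E. b < u \<and> L b} = {}" "{a\<in>E. a < u \<and> G a} = {}"
        "{t. t < u \<and> t \<notin> E \<and> poly p t = 0 \<and> B t} = {t. t < u \<and> poly p t = 0 \<and> B t}" by auto
      moreover have "card {t. t < u \<and> poly p t = 0 \<and> B t} + (if L u then 1 else 0) = (if BB then 1 else 0)"
        by (rule first) (use True in blast)
      ultimately show ?thesis by (simp only: card.empty)
    next
      case False
      define e where "e = Max {e\<in>E. e < u}"
      have fin: "finite {e\<in>E. e < u}" using finE by simp
      have e: "e \<in> E" "e < u" using Max_in[OF fin False] by (auto simp: e_def)
      have emax: "x \<le> e" if "x \<in> E" "x < u" for x using Max_ge[OF fin] that by (auto simp: e_def)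
      have "{x\<in>E. x < e} \<subset> {x\<in>E. x < u}" using e by auto
      then have "card {x\<in>E. x < e} < card {x\<in>E. x < u}" using fin by (rule psubset_card_mono[rotated])
      from less[OF this] have IH: "card {t. t < e \<and> t \<notin> E \<and> poly p t = 0 \<and> B t} + card {b\<in>E. b < e \<and> L b} + (if L e then 1 else 0)
        = card {a\<in>E. a < e \<and> G a} + (if BB then 1 else 0)" .
      have sg: "card {t. e < t \<and> t < u \<and> poly p t = 0 \<and> B t} + (if L u then 1 else 0) = (if G e then 1 else 0)"
        using emax e by (intro seg) force+
      have split: "card {b\<in>E. b < u \<and> Q b} = card {b\<in>E. b < e \<and> Q b} + (if Q e then 1 else 0)" for Q
      proof -
        have "{b\<in>E. b < u \<and> Q b} = (if Q e then insert e {b\<in>E. b < e \<and> Q b} else {b\<in>E. b < e \<and> Q b})"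
          using e emax by (auto simp: less_le)
        then show ?thesis using finE by simp
      qed
      have "{t. t < u \<and> t \<notin> E \<and> poly p t = 0 \<and> B t} =
        {t. t < e \<and> t \<notin> E \<and> poly p t = 0 \<and> B t} \<union> {t. e < t \<and> t < u \<and> poly p t = 0 \<and> B t}" (is "?A = ?B \<union> ?C")
      proof (intro set_eqI iffI)
        fix t assume "t \<in> ?A"
        moreover have "t \<noteq> e" using calculation e by auto
        ultimately show "t \<in> ?B \<union> ?C" by auto
      next
        fix t assume t: "t \<in> ?B \<union> ?C"
        then show "t \<in> ?A" using e emax[of t] by auto
      qed
      moreover have "card (?B \<union> ?C) = card ?B + card ?C"
        by (rule card_Un_disjoint) (auto intro: finite_subset[OF _ finp])
      ultimately have "card ?A = card ?B + card ?C" by simp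
      then show ?thesis using IH sg split[of L] split[of G] by simp
    qed
  qed
  define s where "s = sgn (lead_coeff (pderiv p))"
  have s: "s = 1 \<or> s = - 1" using pd by (auto simp: s_def sgn_if)
  have lp: "sgn (lead_coeff p) = s"
  proof -
    have "degree p \<noteq> 0" using pd pderiv_eq_0_iff by blast
    then obtain m where m: "degree p = Suc m" using not0_implies_Suc by blast
    then show ?thesis by (simp add: s_def degree_pderiv coeff_pderiv sgn_mult del: of_nat_Suc)
  qed
  have "eventually (\<lambda>u. sgn (poly p u) = s) at_top" "eventually (\<lambda>u. sgn (poly (pderiv p) u) = s) at_top"
    using eventually_sgn_at_top[of p] eventually_sgn_at_top[of "pderiv p"] lp by (auto simp: s_def)
  moreover have "eventually (\<lambda>u. u > Max (insert 0 (E \<union> {t. poly p t = 0}))) at_top" by (rule eventually_gt_at_top)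
  ultimately have "eventually (\<lambda>u. sgn (poly p u) = s \<and> sgn (poly (pderiv p) u) = s \<and> u > Max (insert 0 (E \<union> {t. poly p t = 0}))) at_top"
    by eventually_elim auto
  then obtain v where v: "\<And>u. u \<ge> v \<Longrightarrow> sgn (poly p u) = s \<and> sgn (poly (pderiv p) u) = s \<and> u > Max (insert 0 (E \<union> {t. poly p t = 0}))"
    by (auto simp: eventually_at_top_linorder)
  \<comment> \<open>The signs of p and p' are final from v on, so the unit gap provides
    \<open>lgerm_interval\<close> with an interval on which p' has no roots.\<close>
  define u where "u = v + 1"
  have uE: "x < u" if "x \<in> E \<or> poly p x = 0" for x
    using v[of u] finE finp that by (auto simp: u_def)
  have "sgn (poly (pderiv p) (v + 1/2)) = lgerm n (pderiv p) u"
  proof (rule lgerm_interval[where e = v])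
    show "pderiv p = 0 \<or> (\<forall>x. v < x \<and> x < u \<longrightarrow> poly (pderiv p) x \<noteq> 0)"
      using v s by (metis less_eq_real_def sgn_0 zero_neq_one neg_0_equal_iff_equal)
  qed (use deg pd in \<open>auto simp: u_def\<close>)
  then have "lgerm n (pderiv p) u = s" using v[of "v + 1/2"] by simp
  moreover have "s * poly p u > 0" using v[of u] s by (auto simp: u_def sgn_if split: if_splits)
  ultimately have nL: "\<not> L u" by (simp add: L_def)
  have "{t. t < u \<and> t \<notin> E \<and> poly p t = 0 \<and> B t} = {t. t \<notin> E \<and> poly p t = 0 \<and> B t}"
    "{b\<in>E. b < u \<and> L b} = {b\<in>E. L b}" "{a\<in>E. a < u \<and> G a} = {a\<in>E. G a}" using uE by auto
  with main[of u] nL have "card {t. t \<notin> E \<and> poly p t = 0 \<and> B t} + card {b\<in>E. L b}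
    = card {a\<in>E. G a} + (if BB then 1 else 0)" by simp
  then show ?thesis by (simp only: B_def L_def G_def BB_def)
qed

section \<open>Semialgebraic dependence of germs and root counts on the parameters\<close>

lemma sa_simple_sgn_poly_family:
  "poly_family d P \<Longrightarrow> sa_simple (\<lambda>z. sgn (poly (P (fst z)) (snd z)))"
  by (intro sa_simple_sgn poly_family_imp_real_polynomial_function)

lemma sa_simple_rgerm:
  "poly_family d P \<Longrightarrow> sa_simple (\<lambda>z. rgerm n (P (fst z)) (snd z))"
proof (induction n arbitrary: P)
  case 0 then show ?case using sa_simple_sgn_poly_family by simp
next
  case (Suc n)
  have "poly_family d (\<lambda>x. pderiv (P x))" using poly_family_pderiv poly_family_mono[OF Suc.prems, of "Suc d"] by auto
  then have 1: "sa_simple (\<lambda>z. rgerm n (pderiv (P (fst z))) (snd z))" by (rule Suc.IH)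
  have "sa_simple (\<lambda>z. (\<lambda>s r. if s \<noteq> 0 then s else r) (sgn (poly (P (fst z)) (snd z))) (rgerm n (pderiv (P (fst z))) (snd z)))"
    by (rule sa_simple_comp2[OF sa_simple_sgn_poly_family[OF Suc.prems] 1])
  then show ?case by (simp add: sgn_eq_0_iff)
qed

lemma sa_simple_lgerm:
  "poly_family d P \<Longrightarrow> sa_simple (\<lambda>z. lgerm n (P (fst z)) (snd z))"
proof (induction n arbitrary: P)
  case 0 then show ?case using sa_simple_sgn_poly_family by simp
next
  case (Suc n)
  have "poly_family d (\<lambda>x. pderiv (P x))" using poly_family_pderiv poly_family_mono[OF Suc.prems, of "Suc d"] by auto
  then have 1: "sa_simple (\<lambda>z. lgerm n (pderiv (P (fst z))) (snd z))" by (rule Suc.IH)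
  have "sa_simple (\<lambda>z. (\<lambda>s r. if s \<noteq> 0 then s else - r) (sgn (poly (P (fst z)) (snd z))) (lgerm n (pderiv (P (fst z))) (snd z)))"
    by (rule sa_simple_comp2[OF sa_simple_sgn_poly_family[OF Suc.prems] 1])
  then show ?case by (simp add: sgn_eq_0_iff)
qed

lemma sa_simple_coeff_sgn: "poly_family d P \<Longrightarrow> sa_simple (\<lambda>x. sgn (coeff (P x) j))"
  by (intro sa_simple_sgn) (simp add: poly_family_def)

lemma sa_simple_coeff_zero:
  assumes "poly_family d P" shows "sa_simple (\<lambda>x. coeff (P x) j = 0)"
  using sa_simple_comp[OF sa_simple_coeff_sgn[OF assms], of "\<lambda>s. s = 0"] by (simp add: sgn_eq_0_iff)

lemma sa_simple_poly_family_zero: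
  assumes "poly_family d P" shows "sa_simple (\<lambda>x. P x = 0)"
proof -
  have "semialgebraic (\<Union>j\<in>{..<d}. {x. coeff (P x) j \<noteq> 0})"
  proof (rule semialgebraic_UN)
    fix j
    show "semialgebraic {x. coeff (P x) j \<noteq> 0}"
      using sa_simple_comp[OF sa_simple_coeff_zero[OF assms], of Not] by (simp add: sa_simple_bool)
  qed simp
  moreover have "(\<Union>j\<in>{..<d}. {x. coeff (P x) j \<noteq> 0}) = {x. P x \<noteq> 0}"
  proof (intro set_eqI iffI)
    fix x assume "x \<in> {x. P x \<noteq> 0}"
    then obtain j where "coeff (P x) j \<noteq> 0" by (metis leading_coeff_0_iff mem_Collect_eq)
    moreover then have "j < d" using assms unfolding poly_family_def by (meson not_less)
    ultimately show "x \<in> (\<Union>j\<in>{..<d}. {x. coeff (P x) j \<noteq> 0})" by blast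
  qed auto
  ultimately have "sa_simple (\<lambda>x. P x \<noteq> 0)" by (simp add: sa_simple_bool)
  from sa_simple_comp[OF this, of Not] show ?thesis by simp
qed

text \<open>Handles the parameters at which the degree drops: there truncation changes nothing, yet
  the bound on the number of coefficients decreases. The top term is written as a product with 1 to
  have the shape of \<open>poly_family_monom_mult\<close>.\<close>

lemma poly_family_truncate:
  assumes "poly_family (Suc d) P"
  shows "poly_family d (\<lambda>x. P x + monom (- 1 * coeff (P x) d) d * 1)"
    and "coeff (P x) d = 0 \<Longrightarrow> P x + monom (- 1 * coeff (P x) d) d * 1 = P x"
proof -
  have "poly_family 1 (\<lambda>x::'a. 1)" by (auto simp: poly_family_def rpf_const coeff_eq_0)
  then have "poly_family (d + 1) (\<lambda>x. monom (- 1 * coeff (P x) d) d * 1)"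
    using assms by (intro poly_family_monom_mult rpf_mult rpf_const) (auto simp: poly_family_def)
  then have "poly_family (Suc d) (\<lambda>x. P x + monom (- 1 * coeff (P x) d) d * 1)"
    using assms by (intro poly_family_add) auto
  moreover have "coeff (P x + monom (- 1 * coeff (P x) d) d * 1) d = 0" for x
    by simp
  ultimately show "poly_family d (\<lambda>x. P x + monom (- 1 * coeff (P x) d) d * 1)"
    unfolding poly_family_def by (metis Suc_leI le_neq_implies_less)
qed simp

lemma sa_simple_bgerm: "poly_family d P \<Longrightarrow> sa_simple (\<lambda>x. bgerm (P x))"
proof (induction d arbitrary: P)
  case 0
  then have "P = (\<lambda>x. 0)" by (auto simp: poly_family_def poly_eq_iff)
  then show ?case by (simp add: sa_simple_const)
next
  case (Suc d)
  let ?Q = "\<lambda>x. P x + monom (- 1 * coeff (P x) d) d * 1"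
  have "sa_simple (\<lambda>x. bgerm (?Q x))" by (rule Suc.IH[OF poly_family_truncate(1)[OF Suc.prems]])
  moreover have "sa_simple (\<lambda>x. (- 1) ^ d * sgn (coeff (P x) d))"
    by (rule sa_simple_comp[OF sa_simple_coeff_sgn[OF Suc.prems], of "\<lambda>s. (- 1) ^ d * s"])
  ultimately have "sa_simple (\<lambda>x. if coeff (P x) d = 0 then bgerm (?Q x) else (- 1) ^ d * sgn (coeff (P x) d))"
    by (intro sa_simple_if sa_simple_coeff_zero[OF Suc.prems])
  moreover have "(if coeff (P x) d = 0 then bgerm (?Q x) else (- 1) ^ d * sgn (coeff (P x) d)) = bgerm (P x)" for x
  proof (cases "coeff (P x) d = 0")
    case False
    then have "degree (P x) = d" using le_degree poly_family_degree_less[OF Suc.prems] le_antisym by blast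
    then show ?thesis using False by (simp add: bgerm_def)
  qed simp
  ultimately show ?case by simp
qed

lemma sa_simple_mem: "sa_simple (\<lambda>x. x \<in> A) \<longleftrightarrow> semialgebraic A"
  by (simp add: sa_simple_bool)

text \<open>The zero sets are added one polynomial at a time; intersecting with the complement
  \<open>D\<close> of the next zero set prevents double counting. The assumption \<open>IH\<close>
  is the induction hypothesis of \<open>sa_simple_card_roots\<close>. Polynomials that vanish
  identically at x are left out, as their zeros would not be finite in number.\<close>

lemma sa_simple_card_zero_set:
  fixes Rs :: "('a::euclidean_space \<Rightarrow> real poly) list"
  assumes IH: "\<And>(P :: 'a \<Rightarrow> real poly) A. poly_family d P \<Longrightarrow> semialgebraic A \<Longrightarrow>
      sa_simple (\<lambda>x. if P x = 0 then 0 else card {t. poly (P x) t = 0 \<and> (x, t) \<in> A})"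
    and Rs: "\<And>R. R \<in> set Rs \<Longrightarrow> poly_family d R" and C: "semialgebraic C"
  shows "sa_simple (\<lambda>x. card {t. (\<exists>R\<in>set Rs. R x \<noteq> 0 \<and> poly (R x) t = 0) \<and> (x, t) \<in> C})"
  using Rs C
proof (induction Rs arbitrary: C)
  case Nil then show ?case by (simp add: sa_simple_const)
next
  case (Cons R Rs)
  define Z where "Z = (\<lambda>(Rs :: ('a \<Rightarrow> real poly) list) x. {t::real. \<exists>R\<in>set Rs. R x \<noteq> 0 \<and> poly (R x) t = 0})"
  have finZ: "finite (Z Rs x)" for Rs x
  proof -
    have "Z Rs x = (\<Union>R\<in>{R\<in>set Rs. R x \<noteq> 0}. {t. poly (R x) t = 0})" by (auto simp: Z_def)
    then show ?thesis by (simp add: poly_roots_finite)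
  qed
  have R: "poly_family d R" using Cons.prems by simp
  define D where "D = {z. \<not> (R (fst z) \<noteq> 0 \<and> poly (R (fst z)) (snd z) = 0)}"
  have sD: "semialgebraic D"
  proof -
    have 1: "sa_simple (\<lambda>z::'a\<times>real. poly (R (fst z)) (snd z) = 0)"
      using sa_simple_comp[OF sa_simple_sgn_poly_family[OF R], of "\<lambda>s. s = 0"] by (simp add: sgn_eq_0_iff)
    have "poly_family d (\<lambda>z::'a\<times>real. R (fst z))"
      using R real_polynomial_function_comp_linear[OF _ bounded_linear_fst] by (auto simp: poly_family_def)
    then have 2: "sa_simple (\<lambda>z::'a\<times>real. R (fst z) = 0)" by (rule sa_simple_poly_family_zero)
    have "sa_simple (\<lambda>z::'a\<times>real. \<not> (R (fst z) \<noteq> 0 \<and> poly (R (fst z)) (snd z) = 0))"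
      by (rule sa_simple_comp2[OF 2 1, of "\<lambda>a b. \<not> (\<not> a \<and> b)"])
    then show ?thesis by (simp add: sa_simple_bool D_def)
  qed
  have "sa_simple (\<lambda>x. card {t. t \<in> Z Rs x \<and> (x, t) \<in> C \<inter> D})"
    using Cons.IH[of "C \<inter> D"] Cons.prems sD semialgebraic.Int by (auto simp: Z_def)
  moreover have "sa_simple (\<lambda>x. if R x = 0 then 0 else card {t. poly (R x) t = 0 \<and> (x, t) \<in> C})"
    by (rule IH[OF R Cons.prems(2)])
  ultimately have "sa_simple (\<lambda>x. card {t. t \<in> Z Rs x \<and> (x, t) \<in> C \<inter> D} +
      (if R x = 0 then 0 else card {t. poly (R x) t = 0 \<and> (x, t) \<in> C}))"
    by (rule sa_simple_comp2)
  moreover have "card {t. t \<in> Z Rs x \<and> (x, t) \<in> C \<inter> D} +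
      (if R x = 0 then 0 else card {t. poly (R x) t = 0 \<and> (x, t) \<in> C}) = card {t. t \<in> Z (R # Rs) x \<and> (x, t) \<in> C}" for x
  proof (cases "R x = 0")
    case True
    then have "{t. t \<in> Z Rs x \<and> (x, t) \<in> C \<inter> D} = {t. t \<in> Z (R # Rs) x \<and> (x, t) \<in> C}"
      by (auto simp: Z_def D_def)
    then show ?thesis using True by simp
  next
    case False
    have "{t. t \<in> Z (R # Rs) x \<and> (x, t) \<in> C} = {t. t \<in> Z Rs x \<and> (x, t) \<in> C \<inter> D} \<union> {t. poly (R x) t = 0 \<and> (x, t) \<in> C}"
      using False by (auto simp: Z_def D_def)
    moreover have "card ({t. t \<in> Z Rs x \<and> (x, t) \<in> C \<inter> D} \<union> {t. poly (R x) t = 0 \<and> (x, t) \<in> C}) =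
      card {t. t \<in> Z Rs x \<and> (x, t) \<in> C \<inter> D} + card {t. poly (R x) t = 0 \<and> (x, t) \<in> C}"
    proof (rule card_Un_disjoint)
      show "finite {t. t \<in> Z Rs x \<and> (x, t) \<in> C \<inter> D}" using finZ[of Rs x] by simp
      show "finite {t. poly (R x) t = 0 \<and> (x, t) \<in> C}" using poly_roots_finite[OF False] by simp
      show "{t. t \<in> Z Rs x \<and> (x, t) \<in> C \<inter> D} \<inter> {t. poly (R x) t = 0 \<and> (x, t) \<in> C} = {}"
        using False by (auto simp: D_def)
    qed
    ultimately show ?thesis using False by simp
  qed
  ultimately show ?case by (simp add: Z_def)
qed

text \<open>Where the top coefficient vanishes, \<open>P\<close> can be truncated. Elsewhere the
  polynomials that define \<open>A\<close> may be replaced, at the roots of \<open>P\<close>, by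
  remainders; these and p' have fewer coefficients. Roots of \<open>P\<close> in the zero set
  \<open>E\<close> of these polynomials are counted by the induction hypothesis, the other ones by
  sign changes at the points of \<open>E\<close>.\<close>

lemma sa_simple_card_roots:
  assumes "poly_family d P" "semialgebraic A"
  shows "sa_simple (\<lambda>x::'a::euclidean_space. if P x = 0 then 0 else card {t. poly (P x) t = 0 \<and> (x, t) \<in> A})"
  using assms
proof (induction d arbitrary: P A)
  case 0
  then have "P = (\<lambda>x. 0)" by (auto simp: poly_family_def poly_eq_iff)
  then show ?case by (simp add: sa_simple_const)
next
  case (Suc d)
  define a where "a = (\<lambda>x. coeff (P x) d)"
  let ?cnt = "\<lambda>x. card {t. poly (P x) t = 0 \<and> (x, t) \<in> A}"
  have "\<exists>c. sa_simple c \<and> (\<forall>x. a x \<noteq> 0 \<longrightarrow> c x = ?cnt x)"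
  \<comment> \<open>A nonzero constant has no roots. For d > 0 the degree is positive, so p'
    \<noteq> 0 as \<open>card_roots_off\<close> requires.\<close>
  proof (cases "d = 0")
    case True
    have "?cnt x = 0" if "a x \<noteq> 0" for x
    proof -
      have "degree (P x) = 0" using poly_family_degree_less[OF Suc.prems(1), of x] True by simp
      then obtain c where "P x = [:c:]" using degree_eq_zeroE by blast
      then show ?thesis using that True by (simp add: a_def)
    qed
    then show ?thesis by (intro exI[of _ "\<lambda>x. 0"]) (simp add: sa_simple_const)
  next
    case False
    obtain ps \<phi> where ps: "\<And>p. p \<in> set ps \<Longrightarrow> real_polynomial_function p"
      and A: "A = {x. \<phi> (map (\<lambda>p. sgn (p x)) ps)}"
      using semialgebraic_signsE[OF Suc.prems(2)] by blast
    have "\<forall>p\<in>set ps. \<exists>R. poly_family d R \<and> (\<forall>x t. a x \<noteq> 0 \<longrightarrow> poly (P x) t = 0 \<longrightarrow> sgn (poly (R x) t) = sgn (p (x, t)))"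
    proof
      fix p assume "p \<in> set ps"
      from real_polynomial_function_split[OF ps[OF this]]
      obtain e Q where Q: "poly_family e Q" "\<And>x t. p (x, t) = poly (Q x) t" by blast
      show "\<exists>R. poly_family d R \<and> (\<forall>x t. a x \<noteq> 0 \<longrightarrow> poly (P x) t = 0 \<longrightarrow> sgn (poly (R x) t) = sgn (p (x, t)))"
        using poly_family_reduce[OF Suc.prems(1) Q(1)] by (simp add: a_def Q(2))
    qed
    from bchoice[OF this] obtain r where r: "\<And>p. p \<in> set ps \<Longrightarrow> poly_family d (r p)"
      "\<And>p x t. p \<in> set ps \<Longrightarrow> a x \<noteq> 0 \<Longrightarrow> poly (P x) t = 0 \<Longrightarrow> sgn (poly (r p x) t) = sgn (p (x, t))" by blast
    define Rs where "Rs = (\<lambda>x. pderiv (P x)) # map r ps"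
    \<comment> \<open>p' heads the list so that its zeros cut the line as well; \<open>tl\<close>
      keeps its sign out of the condition for \<open>A\<close>.\<close>
    define \<psi> where "\<psi> = (\<lambda>l. \<phi> (tl l))"
    have Rs: "poly_family d R" if "R \<in> set Rs" for R
      using that r poly_family_pderiv[OF Suc.prems(1)] by (auto simp: Rs_def)
    have A': "(x, t) \<in> A \<longleftrightarrow> \<psi> (map (\<lambda>R. sgn (poly (R x) t)) Rs)" if "a x \<noteq> 0" "poly (P x) t = 0" for x t
    proof -
      have "map (\<lambda>p. sgn (p (x, t))) ps = map (\<lambda>p. sgn (poly (r p x) t)) ps"
        using r(2)[OF _ that] by simp
      then have "(x, t) \<in> A \<longleftrightarrow> \<phi> (map (\<lambda>p. sgn (poly (r p x) t)) ps)"
        by (simp only: A mem_Collect_eq)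
      then show ?thesis by (simp add: \<psi>_def Rs_def comp_def)
    qed
    define E where "E = (\<lambda>x. {t::real. \<exists>R\<in>set Rs. R x \<noteq> 0 \<and> poly (R x) t = 0})"
    have card_E: "sa_simple (\<lambda>x. card {t. t \<in> E x \<and> (x, t) \<in> C})" if "semialgebraic C" for C
      using sa_simple_card_zero_set[OF Suc.IH Rs that] by (simp add: E_def)
    define L where "L = {z. \<psi> (map (\<lambda>R. lgerm d (R (fst z)) (snd z)) Rs) \<and> lgerm d (pderiv (P (fst z))) (snd z) * poly (P (fst z)) (snd z) \<le> 0}"
    define G where "G = {z. \<psi> (map (\<lambda>R. rgerm d (R (fst z)) (snd z)) Rs) \<and> rgerm d (pderiv (P (fst z))) (snd z) * poly (P (fst z)) (snd z) < 0}"
    define Z where "Z = {z. poly (P (fst z)) (snd z) = 0 \<and> z \<in> A}"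
    have sP: "sa_simple (\<lambda>z. sgn (poly (P (fst z)) (snd z)))"
      by (rule sa_simple_sgn_poly_family[OF Suc.prems(1)])
    have P': "poly_family d (\<lambda>x. pderiv (P x))" by (rule poly_family_pderiv[OF Suc.prems(1)])
    have "semialgebraic L"
    proof -
      have 1: "sa_simple (\<lambda>z. map (\<lambda>R. lgerm d (R (fst z)) (snd z)) Rs)"
        by (intro sa_simple_map sa_simple_lgerm[OF Rs])
      have 2: "sa_simple (\<lambda>z. lgerm d (pderiv (P (fst z))) (snd z) * sgn (poly (P (fst z)) (snd z)))"
        by (rule sa_simple_comp2[OF sa_simple_lgerm[OF P'] sP])
      have "sa_simple (\<lambda>z. \<psi> (map (\<lambda>R. lgerm d (R (fst z)) (snd z)) Rs) \<and> lgerm d (pderiv (P (fst z))) (snd z) * sgn (poly (P (fst z)) (snd z)) \<le> 0)"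
        by (rule sa_simple_comp2[OF 1 2, of "\<lambda>u v. \<psi> u \<and> v \<le> 0"])
      moreover have "a * sgn b \<le> 0 \<longleftrightarrow> a * b \<le> 0" for a b :: real
        by (auto simp: sgn_if mult_le_0_iff)
      ultimately show ?thesis by (simp add: sa_simple_bool L_def)
    qed
    note cL = card_E[OF this]
    have "semialgebraic G"
    proof -
      have 1: "sa_simple (\<lambda>z. map (\<lambda>R. rgerm d (R (fst z)) (snd z)) Rs)"
        by (intro sa_simple_map sa_simple_rgerm[OF Rs])
      have 2: "sa_simple (\<lambda>z. rgerm d (pderiv (P (fst z))) (snd z) * sgn (poly (P (fst z)) (snd z)))"
        by (rule sa_simple_comp2[OF sa_simple_rgerm[OF P'] sP])
      have "sa_simple (\<lambda>z. \<psi> (map (\<lambda>R. rgerm d (R (fst z)) (snd z)) Rs) \<and> rgerm d (pderiv (P (fst z))) (snd z) * sgn (poly (P (fst z)) (snd z)) < 0)"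
        by (rule sa_simple_comp2[OF 1 2, of "\<lambda>u v. \<psi> u \<and> v < 0"])
      moreover have "a * sgn b < 0 \<longleftrightarrow> a * b < 0" for a b :: real
        by (auto simp: sgn_if mult_less_0_iff)
      ultimately show ?thesis by (simp add: sa_simple_bool G_def)
    qed
    note cG = card_E[OF this]
    have "semialgebraic Z"
    proof -
      have "sa_simple (\<lambda>z. sgn (poly (P (fst z)) (snd z)) = 0 \<and> z \<in> A)"
        by (rule sa_simple_comp2[OF sP sa_simple_mem[THEN iffD2, OF Suc.prems(2)], of "\<lambda>u v. u = 0 \<and> v"])
      then show ?thesis by (simp add: sa_simple_bool Z_def sgn_eq_0_iff)
    qed
    note cZ = card_E[OF this]
    have "sa_simple (\<lambda>x. map (\<lambda>R. bgerm (R x)) Rs)" by (intro sa_simple_map sa_simple_bgerm[OF Rs])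
    then have cB: "sa_simple (\<lambda>x. if \<psi> (map (\<lambda>R. bgerm (R x)) Rs) then 1 else 0 :: nat)"
      by (rule sa_simple_comp[of _ "\<lambda>l. if \<psi> l then 1 else 0"])
    \<comment> \<open>The subtraction of naturals loses nothing, as the identity in
      \<open>card_roots_off\<close> bounds the subtrahend by the minuend.\<close>
    define c where "c = (\<lambda>x. card {t. t \<in> E x \<and> (x, t) \<in> Z} + ((card {t. t \<in> E x \<and> (x, t) \<in> G} +
      (if \<psi> (map (\<lambda>R. bgerm (R x)) Rs) then 1 else 0)) - card {t. t \<in> E x \<and> (x, t) \<in> L}))"
    have "sa_simple c" unfolding c_def
      by (rule sa_simple_comp2[OF cZ sa_simple_comp2[OF sa_simple_comp2[OF cG cB] cL]])
    moreover have "c x = ?cnt x" if ax: "a x \<noteq> 0" for x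
    proof -
      have dP: "degree (P x) = d" using ax le_degree poly_family_degree_less[OF Suc.prems(1)] le_antisym unfolding a_def by blast
      then have nz: "pderiv (P x) \<noteq> 0" using False pderiv_eq_0_iff[of "P x"] by simp
      have Ex: "E x = {t. \<exists>R\<in>set (map (\<lambda>R. R x) Rs). R \<noteq> 0 \<and> poly R t = 0}" by (auto simp: E_def)
      have "card {t. t \<notin> E x \<and> poly (P x) t = 0 \<and> \<psi> (map (\<lambda>R. sgn (poly R t)) (map (\<lambda>R. R x) Rs))} +
        card {b\<in>E x. \<psi> (map (\<lambda>R. lgerm d R b) (map (\<lambda>R. R x) Rs)) \<and> lgerm d (pderiv (P x)) b * poly (P x) b \<le> 0} =
        card {a\<in>E x. \<psi> (map (\<lambda>R. rgerm d R a) (map (\<lambda>R. R x) Rs)) \<and> rgerm d (pderiv (P x)) a * poly (P x) a < 0} +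
        (if \<psi> (map bgerm (map (\<lambda>R. R x) Rs)) then 1 else 0)"
        unfolding Ex
        by (rule card_roots_off) (use Rs poly_family_degree nz in \<open>auto simp: Rs_def\<close>)
      then have off: "card {t. t \<notin> E x \<and> poly (P x) t = 0 \<and> \<psi> (map (\<lambda>R. sgn (poly (R x) t)) Rs)} =
          (card {t. t \<in> E x \<and> (x, t) \<in> G} + (if \<psi> (map (\<lambda>R. bgerm (R x)) Rs) then 1 else 0)) - card {t. t \<in> E x \<and> (x, t) \<in> L}"
        by (simp add: L_def G_def comp_def)
      have fin: "finite {t. poly (P x) t = 0}" using ax by (intro poly_roots_finite) (auto simp: a_def)
      have "{t. poly (P x) t = 0 \<and> (x, t) \<in> A} = {t. t \<in> E x \<and> (x, t) \<in> Z} \<union> {t. t \<notin> E x \<and> poly (P x) t = 0 \<and> \<psi> (map (\<lambda>R. sgn (poly (R x) t)) Rs)}"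
        using A'[OF ax] by (auto simp: Z_def)
      moreover have "card ({t. t \<in> E x \<and> (x, t) \<in> Z} \<union> {t. t \<notin> E x \<and> poly (P x) t = 0 \<and> \<psi> (map (\<lambda>R. sgn (poly (R x) t)) Rs)}) =
        card {t. t \<in> E x \<and> (x, t) \<in> Z} + card {t. t \<notin> E x \<and> poly (P x) t = 0 \<and> \<psi> (map (\<lambda>R. sgn (poly (R x) t)) Rs)}"
        by (rule card_Un_disjoint) (auto simp: Z_def intro: finite_subset[OF _ fin])
      ultimately show ?thesis by (simp add: c_def off)
    qed
    ultimately show ?thesis by blast
  qed
  then obtain c where c: "sa_simple c" "\<And>x. a x \<noteq> 0 \<Longrightarrow> c x = ?cnt x" by blast
  let ?Q = "\<lambda>x. P x + monom (- 1 * coeff (P x) d) d * 1"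
  have Q: "sa_simple (\<lambda>x. if ?Q x = 0 then 0 else card {t. poly (?Q x) t = 0 \<and> (x, t) \<in> A})"
    by (rule Suc.IH[OF poly_family_truncate(1)[OF Suc.prems(1)] Suc.prems(2)])
  have "sa_simple (\<lambda>x. if a x = 0 then (if ?Q x = 0 then 0 else card {t. poly (?Q x) t = 0 \<and> (x, t) \<in> A}) else c x)"
    unfolding a_def by (rule sa_simple_if[OF sa_simple_coeff_zero[OF Suc.prems(1)] Q c(1)])
  moreover have "(if a x = 0 then (if ?Q x = 0 then 0 else card {t. poly (?Q x) t = 0 \<and> (x, t) \<in> A}) else c x)
    = (if P x = 0 then 0 else ?cnt x)" for x
    using c(2)[of x] poly_family_truncate(2)[OF Suc.prems(1), of x] by (cases "a x = 0") (auto simp: a_def)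
  ultimately show ?case by simp
qed

section \<open>The Tarski--Seidenberg theorem\<close>

text \<open>All signs are constant between consecutive points of \<open>E x\<close>. A fibre is
  therefore nonempty iff it contains a point of \<open>E x\<close>, or the sign condition holds just
  to the right of such a point or near -infinity. Each alternative concerns a root count or the
  germs at -infinity.\<close>

lemma semialgebraic_proj_real:
  assumes "semialgebraic A"
  shows "semialgebraic {x::'a::euclidean_space. \<exists>t::real. (x, t) \<in> A}"
proof -
  obtain ps \<phi> where ps: "\<And>p. p \<in> set ps \<Longrightarrow> real_polynomial_function p"
    and A: "A = {x. \<phi> (map (\<lambda>p. sgn (p x)) ps)}"
    using semialgebraic_signsE[OF assms] by blast
  have "\<forall>p\<in>set ps. \<exists>R. \<exists>d. poly_family d R \<and> (\<forall>x t. p (x, t) = poly (R x) t)"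
    using ps real_polynomial_function_split by metis
  from bchoice[OF this] obtain r where r: "\<And>p. p \<in> set ps \<Longrightarrow> \<exists>d. poly_family d (r p)"
    "\<And>p x t. p \<in> set ps \<Longrightarrow> p (x, t) = poly (r p x) t" by blast
  from r(1) obtain dd where dd: "\<And>p. p \<in> set ps \<Longrightarrow> poly_family (dd p) (r p)" by metis
  define Rs where "Rs = map r ps"
  define d where "d = Max (insert 0 (dd ` set ps))"
  have Rs: "poly_family d R" if "R \<in> set Rs" for R
  proof -
    obtain p where p: "p \<in> set ps" "R = r p" using \<open>R \<in> set Rs\<close> by (auto simp: Rs_def)
    then have "dd p \<le> d" unfolding d_def by (intro Max_ge) auto
    then show ?thesis using poly_family_mono[OF dd[OF p(1)]] p(2) by simp
  qed
  have A': "(x, t) \<in> A \<longleftrightarrow> \<phi> (map (\<lambda>R. sgn (poly (R x) t)) Rs)" for x t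
  proof -
    have "map (\<lambda>p. sgn (p (x, t))) ps = map (\<lambda>p. sgn (poly (r p x) t)) ps" using r(2) by simp
    then have "(x, t) \<in> A \<longleftrightarrow> \<phi> (map (\<lambda>p. sgn (poly (r p x) t)) ps)"
      by (simp only: A mem_Collect_eq)
    then show ?thesis by (simp add: Rs_def comp_def)
  qed
  define E where "E = (\<lambda>x. {t::real. \<exists>R\<in>set Rs. R x \<noteq> 0 \<and> poly (R x) t = 0})"
  have finE: "finite (E x)" for x
  proof -
    have "E x = (\<Union>R\<in>{R\<in>set Rs. R x \<noteq> 0}. {t. poly (R x) t = 0})" by (auto simp: E_def)
    then show ?thesis by (simp add: poly_roots_finite)
  qed
  define G where "G = {z. \<phi> (map (\<lambda>R. rgerm d (R (fst z)) (snd z)) Rs)}"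
  have "semialgebraic G"
    using sa_simple_comp[OF sa_simple_map[of Rs "\<lambda>R z. rgerm d (R (fst z)) (snd z)"], of \<phi>]
      sa_simple_rgerm[OF Rs] by (simp add: sa_simple_bool G_def)
  have card_E: "sa_simple (\<lambda>x. card {t. t \<in> E x \<and> (x, t) \<in> C})" if "semialgebraic C" for C
    using sa_simple_card_zero_set[OF sa_simple_card_roots Rs that] by (simp add: E_def)
  have sB: "sa_simple (\<lambda>x. \<phi> (map (\<lambda>R. bgerm (R x)) Rs))"
    using sa_simple_comp[OF sa_simple_map[of Rs "\<lambda>R x. bgerm (R x)"], of \<phi>]
      sa_simple_bgerm[OF Rs] by simp
  have ex: "(\<exists>t. (x, t) \<in> A) \<longleftrightarrow> ((\<exists>t\<in>E x. (x, t) \<in> A) \<or> (\<exists>t\<in>E x. (x, t) \<in> G)) \<or> \<phi> (map (\<lambda>R. bgerm (R x)) Rs)" for x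
  proof
    assume "\<exists>t. (x, t) \<in> A"
    then obtain t where t: "(x, t) \<in> A" by blast
    show "((\<exists>t\<in>E x. (x, t) \<in> A) \<or> (\<exists>t\<in>E x. (x, t) \<in> G)) \<or> \<phi> (map (\<lambda>R. bgerm (R x)) Rs)"
    proof (cases "t \<in> E x")
      case True then show ?thesis using t by blast
    next
      case tE: False
      show ?thesis
      proof (cases "{e\<in>E x. e < t} = {}")
        case True
        have "map (\<lambda>R. sgn (poly (R x) t)) Rs = map (\<lambda>R. bgerm (R x)) Rs"
        proof (rule map_cong[OF refl])
          fix R assume "R \<in> set Rs"
          then have "R x = 0 \<or> (\<forall>u\<le>t. poly (R x) u \<noteq> 0)"
            using True tE by (auto simp: E_def less_le)
          then show "sgn (poly (R x) t) = bgerm (R x)" by (rule bgerm_interval)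
        qed
        then have "\<phi> (map (\<lambda>R. bgerm (R x)) Rs)" using t unfolding A' by (simp only:)
        then show ?thesis by (rule disjI2)
      next
        case False
        define e where "e = Max {e\<in>E x. e < t}"
        have fin: "finite {e\<in>E x. e < t}" using finE by simp
        have e: "e \<in> E x" "e < t" using Max_in[OF fin False] by (auto simp: e_def)
        have emax: "y \<le> e" if "y \<in> E x" "y < t" for y using Max_ge[OF fin] that by (auto simp: e_def)
        have "map (\<lambda>R. sgn (poly (R x) t)) Rs = map (\<lambda>R. rgerm d (R x) e) Rs"
        proof (rule map_cong[OF refl])
          fix R assume R: "R \<in> set Rs"
          have "y \<notin> E x" if "e < y" "y \<le> t" for y
            using emax[of y] that tE by (cases "y = t") auto
          then have "R x = 0 \<or> (\<forall>y. e < y \<and> y \<le> t \<longrightarrow> poly (R x) y \<noteq> 0)"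
            using R by (auto simp: E_def)
          then show "sgn (poly (R x) t) = rgerm d (R x) e"
            by (rule rgerm_interval[OF poly_family_degree[OF Rs[OF R]] _ e(2)])
        qed
        then have "(x, e) \<in> G" using t unfolding A' by (simp only: G_def mem_Collect_eq fst_conv snd_conv)
        then show ?thesis using e by blast
      qed
    qed
  next
    assume "((\<exists>t\<in>E x. (x, t) \<in> A) \<or> (\<exists>t\<in>E x. (x, t) \<in> G)) \<or> \<phi> (map (\<lambda>R. bgerm (R x)) Rs)"
    then consider "\<exists>t. (x, t) \<in> A" | e where "(x, e) \<in> G" | "\<phi> (map (\<lambda>R. bgerm (R x)) Rs)" by blast
    then show "\<exists>t. (x, t) \<in> A"
    proof cases
      case (2 e)
      have "eventually (\<lambda>u. \<forall>R\<in>set Rs. sgn (poly (R x) u) = rgerm d (R x) e) (at_right e)"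
        using eventually_rgerm[OF poly_family_degree[OF Rs]] by (simp add: eventually_ball_finite)
      then obtain u where "\<forall>R\<in>set Rs. sgn (poly (R x) u) = rgerm d (R x) e"
        using eventually_happens'[of "at_right e"] by (metis (mono_tags, lifting) trivial_limit_at_right_real)
      then have "map (\<lambda>R. sgn (poly (R x) u)) Rs = map (\<lambda>R. rgerm d (R x) e) Rs" by simp
      then have "(x, u) \<in> A" using 2 unfolding A' by (simp only: G_def mem_Collect_eq fst_conv snd_conv)
      then show ?thesis by blast
    next
      case 3
      have "eventually (\<lambda>u. \<forall>R\<in>set Rs. sgn (poly (R x) u) = bgerm (R x)) at_bot"
        using eventually_bgerm by (simp add: eventually_ball_finite)
      then obtain u where "\<forall>R\<in>set Rs. sgn (poly (R x) u) = bgerm (R x)"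
        using eventually_happens'[of "at_bot :: real filter"] by (metis (mono_tags, lifting) trivial_limit_at_bot_linorder)
      then have "map (\<lambda>R. sgn (poly (R x) u)) Rs = map (\<lambda>R. bgerm (R x)) Rs" by simp
      then have "(x, u) \<in> A" using 3 unfolding A' by (simp only:)
      then show ?thesis by blast
    qed
  qed
  have cd: "(\<exists>t\<in>E x. (x, t) \<in> C) \<longleftrightarrow> card {t. t \<in> E x \<and> (x, t) \<in> C} \<noteq> 0" for x C
    using finE[of x] by auto
  have eq: "(\<exists>t. (x, t) \<in> A) \<longleftrightarrow> (card {t. t \<in> E x \<and> (x, t) \<in> A} \<noteq> 0 \<or> card {t. t \<in> E x \<and> (x, t) \<in> G} \<noteq> 0)
    \<or> \<phi> (map (\<lambda>R. bgerm (R x)) Rs)" for x unfolding ex cd by (rule refl)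
  have "sa_simple (\<lambda>x. card {t. t \<in> E x \<and> (x, t) \<in> A} \<noteq> 0 \<or> card {t. t \<in> E x \<and> (x, t) \<in> G} \<noteq> 0)"
    by (rule sa_simple_comp2[OF card_E[OF assms] card_E[OF \<open>semialgebraic G\<close>], of "\<lambda>u v. u \<noteq> 0 \<or> v \<noteq> 0"])
  from sa_simple_comp2[OF this sB, of "(\<or>)"] show ?thesis unfolding sa_simple_bool eq .
qed

lemma semialgebraic_vimage_polynomial:
  assumes f: "polynomial_function f" and A: "semialgebraic A"
  shows "semialgebraic {x. f x \<in> A}"
  using A
proof (induction rule: semialgebraic.induct)
  case (pos p)
  have "real_polynomial_function (\<lambda>x. p (f x))"
    using real_polynomial_function_compose[OF f pos] by (simp add: o_def)
  then have "semialgebraic {x. p (f x) > 0}" by (rule semialgebraic.pos)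
  then show ?case by simp
next
  case (Un A B)
  have "{x. f x \<in> A \<union> B} = {x. f x \<in> A} \<union> {x. f x \<in> B}" by blast
  then show ?case using Un by (simp add: semialgebraic.Un)
next
  case (Int A B)
  have "{x. f x \<in> A \<inter> B} = {x. f x \<in> A} \<inter> {x. f x \<in> B}" by blast
  then show ?case using Int by (simp add: semialgebraic.Int)
next
  case (Compl A)
  have "{x. f x \<in> - A} = - {x. f x \<in> A}" by blast
  then show ?case using Compl by (simp add: semialgebraic.Compl)
qed

lemma semialgebraic_vimage_linear:
  assumes "bounded_linear f" "semialgebraic A"
  shows "semialgebraic {x. f x \<in> A}"
  using assms by (intro semialgebraic_vimage_polynomial polynomial_function_bounded_linear)

lemma semialgebraic_sweep_line:
  fixes v :: "'a::euclidean_space"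
  assumes "semialgebraic A"
  shows "semialgebraic {z. \<exists>t::real. z + t *\<^sub>R v \<in> A}"
proof -
  have "bounded_linear (\<lambda>w :: 'a \<times> real. fst w + snd w *\<^sub>R v)"
    by (intro bounded_linear_intros)
  from semialgebraic_vimage_linear[OF this assms]
  have "semialgebraic {w :: 'a \<times> real. fst w + snd w *\<^sub>R v \<in> A}" .
  from semialgebraic_proj_real[OF this] show ?thesis by simp
qed

text \<open>The dimension of a type cannot decrease step by step, so y is eliminated by saturating
  \<open>A\<close> along one basis vector after the other; at the end the slice y = 0 is
  taken.\<close>

lemma semialgebraic_fst_image:
  fixes A :: "('a::euclidean_space \<times> 'b::euclidean_space) set"
  assumes "semialgebraic A"
  shows "semialgebraic {x. \<exists>y. (x, y) \<in> A}"
proof -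
  have "\<exists>A'. semialgebraic A' \<and> (\<forall>z. z \<in> A' \<longleftrightarrow> (\<exists>c. z + (0, \<Sum>b\<in>B. c b *\<^sub>R b) \<in> A))"
    if "finite B" for B :: "'b set"
    using that
  proof (induction B)
    case empty
    then show ?case using assms by (intro exI[of _ A]) (simp flip: zero_prod_def)
  next
    case (insert b B)
    then obtain A' where A': "semialgebraic A'" "\<And>z. z \<in> A' \<longleftrightarrow> (\<exists>c. z + (0, \<Sum>b\<in>B. c b *\<^sub>R b) \<in> A)" by blast
    have "(\<exists>t. z + t *\<^sub>R (0, b) \<in> A') \<longleftrightarrow> (\<exists>c. z + (0, \<Sum>b\<in>insert b B. c b *\<^sub>R b) \<in> A)" for z
    proof
      assume "\<exists>t. z + t *\<^sub>R (0, b) \<in> A'"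
      then obtain t c where tc: "z + t *\<^sub>R (0, b) + (0, \<Sum>b\<in>B. c b *\<^sub>R b) \<in> A" using A' by blast
      have "(\<Sum>x\<in>B. (c(b := t)) x *\<^sub>R x) = (\<Sum>x\<in>B. c x *\<^sub>R x)"
        using insert.hyps by (intro sum.cong) auto
      then have "z + (0, \<Sum>x\<in>insert b B. (c(b := t)) x *\<^sub>R x) = z + t *\<^sub>R (0, b) + (0, \<Sum>b\<in>B. c b *\<^sub>R b)"
        using insert.hyps by (simp add: add.assoc)
      then show "\<exists>c. z + (0, \<Sum>b\<in>insert b B. c b *\<^sub>R b) \<in> A" using tc by metis
    next
      assume "\<exists>c. z + (0, \<Sum>b\<in>insert b B. c b *\<^sub>R b) \<in> A"
      then obtain c where c: "z + (0, \<Sum>b\<in>insert b B. c b *\<^sub>R b) \<in> A" by blast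
      have "z + c b *\<^sub>R (0, b) + (0, \<Sum>b\<in>B. c b *\<^sub>R b) = z + (0, \<Sum>b\<in>insert b B. c b *\<^sub>R b)"
        using insert.hyps by (simp add: add.assoc)
      then show "\<exists>t. z + t *\<^sub>R (0, b) \<in> A'" using c A' by metis
    qed
    then show ?case using semialgebraic_sweep_line[OF A'(1), of "(0, b)"]
      by (intro exI[of _ "{z. \<exists>t. z + t *\<^sub>R (0, b) \<in> A'}"]) simp
  qed
  from this[OF finite_Basis] obtain A' where A': "semialgebraic A'"
    "\<And>z. z \<in> A' \<longleftrightarrow> (\<exists>c. z + (0, \<Sum>b\<in>Basis. c b *\<^sub>R b) \<in> A)" by blast
  have "(\<exists>y. (x, y) \<in> A) \<longleftrightarrow> (x, 0) \<in> A'" for x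
  proof -
    have "(x, 0) \<in> A' \<longleftrightarrow> (\<exists>c. (x, \<Sum>b\<in>Basis. c b *\<^sub>R b) \<in> A)" by (simp add: A')
    also have "\<dots> \<longleftrightarrow> (\<exists>y. (x, y) \<in> A)" by (metis euclidean_representation)
    finally show ?thesis by blast
  qed
  moreover have "bounded_linear (\<lambda>x::'a. (x, 0::'b))" by (intro bounded_linear_intros)
  from semialgebraic_vimage_linear[OF this A'(1)] have "semialgebraic {x. (x, 0) \<in> A'}" .
  ultimately show ?thesis by simp
qed

section \<open>Semialgebraic functions\<close>

lemma sa_conj: "semialgebraic {x. P x} \<Longrightarrow> semialgebraic {x. Q x} \<Longrightarrow> semialgebraic {x. P x \<and> Q x}"
  using semialgebraic.Int[of "{x. P x}" "{x. Q x}"] by (simp add: Collect_conj_eq)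

lemma sa_disj: "semialgebraic {x. P x} \<Longrightarrow> semialgebraic {x. Q x} \<Longrightarrow> semialgebraic {x. P x \<or> Q x}"
  using semialgebraic.Un[of "{x. P x}" "{x. Q x}"] by (simp add: Collect_disj_eq)

lemma sa_not: "semialgebraic {x. P x} \<Longrightarrow> semialgebraic {x. \<not> P x}"
  using semialgebraic.Compl[of "{x. P x}"] by (simp add: Collect_neg_eq)

lemma sa_imp: "semialgebraic {x. P x} \<Longrightarrow> semialgebraic {x. Q x} \<Longrightarrow> semialgebraic {x. P x \<longrightarrow> Q x}"
  unfolding imp_conv_disj by (intro sa_disj sa_not)

lemma sa_const: "semialgebraic {x. c}"
  by (cases c) (auto simp: semialgebraic_UNIV semialgebraic_empty)

lemma sa_ball:
  assumes "finite I" "\<And>i. i \<in> I \<Longrightarrow> semialgebraic {x. P i x}"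
  shows "semialgebraic {x. \<forall>i\<in>I. P i x}"
  using assms by (induction I rule: finite_induct) (auto simp: semialgebraic_UNIV intro: sa_conj)

text \<open>With the rules for connectives this turns first-order formulas over semialgebraic
  functions into semialgebraic sets by introduction rules alone. The bound variable becomes the last
  component of the argument.\<close>

lemma sa_ex:
  assumes "semialgebraic {z. P (fst z) (snd z)}"
  shows "semialgebraic {x. \<exists>y. P x y}"
  using semialgebraic_fst_image[OF assms] by simp

lemma sa_all:
  assumes "semialgebraic {z. P (fst z) (snd z)}"
  shows "semialgebraic {x. \<forall>y. P x y}"
  using sa_not[OF sa_ex[OF sa_not[OF assms]]] by simp

abbreviation sa_fun :: "('a::euclidean_space \<Rightarrow> 'b::euclidean_space) \<Rightarrow> bool" where
  "sa_fun f \<equiv> semialgebraic_map UNIV f"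

lemma sa_fun_graph: "sa_fun f \<longleftrightarrow> semialgebraic {z. snd z = f (fst z)}"
proof -
  have "{(x, f x) |x. x \<in> UNIV} = {z. snd z = f (fst z)}" by (auto simp: prod_eq_iff)
  then show ?thesis by (simp add: semialgebraic_map_def)
qed

lemma sa_vimage_linear: "bounded_linear f \<Longrightarrow> semialgebraic {y. Q y} \<Longrightarrow> semialgebraic {x. Q (f x)}"
  using semialgebraic_vimage_linear[of f "{y. Q y}"] by simp

lemma sa_subst:
  assumes "sa_fun f" "semialgebraic {y. Q y}"
  shows "semialgebraic {x. Q (f x)}"
proof -
  have "semialgebraic {x. \<exists>y. y = f x \<and> Q y}"
    by (rule sa_ex, rule sa_conj)
       (use assms in \<open>auto simp: sa_fun_graph intro: sa_vimage_linear bounded_linear_snd\<close>)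
  then show ?thesis by simp
qed

lemma sa_fun_polynomial:
  assumes "polynomial_function (f :: 'a::euclidean_space \<Rightarrow> 'b::euclidean_space)"
  shows "sa_fun f"
proof -
  have eq: "snd z = f (fst z) \<longleftrightarrow> (\<forall>b\<in>Basis. sgn ((snd z - f (fst z)) \<bullet> b) = 0)" for z
    by (auto simp: sgn_eq_0_iff euclidean_all_zero_iff)
  show ?thesis unfolding sa_fun_graph eq
  proof (rule sa_ball)
    fix b :: 'b assume b: "b \<in> Basis"
    have "real_polynomial_function (\<lambda>x. f x \<bullet> b)"
      using assms b polynomial_function_iff_Basis_inner by blast
    then have "real_polynomial_function (\<lambda>z::'a\<times>'b. f (fst z) \<bullet> b)"
      by (rule real_polynomial_function_comp_linear[OF _ bounded_linear_fst])
    moreover have "bounded_linear (\<lambda>z::'a\<times>'b. snd z \<bullet> b)"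
      by (intro bounded_linear_intros)
    ultimately have "real_polynomial_function (\<lambda>z. (snd z - f (fst z)) \<bullet> b)"
      unfolding inner_diff_left using real_polynomial_function_diff rpf_linear by blast
    then show "semialgebraic {z. sgn ((snd z - f (fst z)) \<bullet> b) = 0}"
      by (rule semialgebraic_sgn_eq)
  qed simp
qed

lemma sa_fun_linear: "bounded_linear f \<Longrightarrow> sa_fun f"
  by (intro sa_fun_polynomial polynomial_function_bounded_linear)

lemma sa_fun_real_polynomial: "real_polynomial_function f \<Longrightarrow> sa_fun f"
  by (simp add: sa_fun_polynomial flip: real_polynomial_function_eq)

lemma sa_fun_const: "sa_fun (\<lambda>x. c)"
  by (intro sa_fun_polynomial) simp

lemma sa_fun_id: "sa_fun (\<lambda>x. x)"
  by (intro sa_fun_linear bounded_linear_ident)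

lemma sa_fun_comp:
  fixes f :: "'b::euclidean_space \<Rightarrow> 'c::euclidean_space" and g :: "'a::euclidean_space \<Rightarrow> 'b"
  assumes f: "sa_fun f" and g: "sa_fun g"
  shows "sa_fun (\<lambda>x. f (g x))"
proof -
  have "semialgebraic {z. \<exists>y. y = g (fst z) \<and> snd z = f y}"
  proof (rule sa_ex, rule sa_conj)
    have "bounded_linear (\<lambda>w :: ('a \<times> 'c) \<times> 'b. (fst (fst w), snd w))"
      by (intro bounded_linear_intros)
    from sa_vimage_linear[OF this] g
    show "semialgebraic {w :: ('a \<times> 'c) \<times> 'b. snd w = g (fst (fst w))}"
      unfolding sa_fun_graph by fastforce
    have "bounded_linear (\<lambda>w :: ('a \<times> 'c) \<times> 'b. (snd w, snd (fst w)))"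
      by (intro bounded_linear_intros)
    from sa_vimage_linear[OF this] f
    show "semialgebraic {w :: ('a \<times> 'c) \<times> 'b. snd (fst w) = f (snd w)}"
      unfolding sa_fun_graph by fastforce
  qed
  then show ?thesis by (simp add: sa_fun_graph)
qed

lemma sa_fun_Pair:
  fixes f :: "'a::euclidean_space \<Rightarrow> 'b::euclidean_space" and g :: "'a \<Rightarrow> 'c::euclidean_space"
  assumes f: "sa_fun f" and g: "sa_fun g"
  shows "sa_fun (\<lambda>x. (f x, g x))"
proof -
  have "semialgebraic {z. fst (snd z) = f (fst z) \<and> snd (snd z) = g (fst z)}"
  proof (rule sa_conj)
    have "bounded_linear (\<lambda>w :: 'a \<times> ('b \<times> 'c). (fst w, fst (snd w)))"
      by (intro bounded_linear_intros)
    from sa_vimage_linear[OF this] f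
    show "semialgebraic {w :: 'a \<times> ('b \<times> 'c). fst (snd w) = f (fst w)}"
      unfolding sa_fun_graph by fastforce
    have "bounded_linear (\<lambda>w :: 'a \<times> ('b \<times> 'c). (fst w, snd (snd w)))"
      by (intro bounded_linear_intros)
    from sa_vimage_linear[OF this] g
    show "semialgebraic {w :: 'a \<times> ('b \<times> 'c). snd (snd w) = g (fst w)}"
      unfolding sa_fun_graph by fastforce
  qed
  then show ?thesis by (simp add: sa_fun_graph prod_eq_iff)
qed

lemma sa_fun_fst: "sa_fun f \<Longrightarrow> sa_fun (\<lambda>x. fst (f x))"
  by (rule sa_fun_comp[OF sa_fun_linear[OF bounded_linear_fst]])

lemma sa_fun_snd: "sa_fun f \<Longrightarrow> sa_fun (\<lambda>x. snd (f x))"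
  by (rule sa_fun_comp[OF sa_fun_linear[OF bounded_linear_snd]])

lemma sa_fun_add: "sa_fun f \<Longrightarrow> sa_fun g \<Longrightarrow> sa_fun (\<lambda>x. f x + g x)"
  using sa_fun_comp[OF sa_fun_linear[of "\<lambda>z. fst z + snd z"] sa_fun_Pair[of f g]]
  by (simp add: bounded_linear_add bounded_linear_fst bounded_linear_snd)

lemma sa_fun_diff: "sa_fun f \<Longrightarrow> sa_fun g \<Longrightarrow> sa_fun (\<lambda>x. f x - g x)"
  using sa_fun_comp[OF sa_fun_linear[of "\<lambda>z. fst z - snd z"] sa_fun_Pair[of f g]]
  by (simp add: bounded_linear_sub bounded_linear_fst bounded_linear_snd)

lemma sa_fun_mult:
  fixes f g :: "'a::euclidean_space \<Rightarrow> real"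
  assumes "sa_fun f" "sa_fun g" shows "sa_fun (\<lambda>x. f x * g x)"
proof -
  have "real_polynomial_function (\<lambda>z::real\<times>real. fst z * snd z)"
    by (intro rpf_mult rpf_linear bounded_linear_fst bounded_linear_snd)
  from sa_fun_comp[OF sa_fun_real_polynomial[OF this] sa_fun_Pair[OF assms]] show ?thesis by simp
qed

lemma sa_fun_scaleR:
  fixes f :: "'a::euclidean_space \<Rightarrow> real" and g :: "'a \<Rightarrow> 'b::euclidean_space"
  assumes "sa_fun f" "sa_fun g" shows "sa_fun (\<lambda>x. f x *\<^sub>R g x)"
proof -
  have "polynomial_function (\<lambda>z::real\<times>'b. fst z *\<^sub>R snd z)"
    unfolding polynomial_function_iff_Basis_inner inner_scaleR_left
    by (intro ballI rpf_mult rpf_linear bounded_linear_intros)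
  from sa_fun_comp[OF sa_fun_polynomial[OF this] sa_fun_Pair[OF assms]] show ?thesis by simp
qed

lemma sa_fun_inner:
  fixes f g :: "'a::euclidean_space \<Rightarrow> 'b::euclidean_space"
  assumes "sa_fun f" "sa_fun g" shows "sa_fun (\<lambda>x. f x \<bullet> g x)"
proof -
  have eq: "fst z \<bullet> snd z = (\<Sum>b\<in>Basis. (fst z \<bullet> b) * (snd z \<bullet> b))" for z :: "'b \<times> 'b"
    by (rule euclidean_inner)
  have "real_polynomial_function (\<lambda>z::'b\<times>'b. fst z \<bullet> snd z)"
    unfolding eq by (intro real_polynomial_function_sum rpf_mult rpf_linear bounded_linear_intros) simp
  from sa_fun_comp[OF sa_fun_real_polynomial[OF this] sa_fun_Pair[OF assms]] show ?thesis by simp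
qed

lemma sa_real_less:
  fixes f g :: "'a::euclidean_space \<Rightarrow> real"
  assumes "sa_fun f" "sa_fun g" shows "semialgebraic {x. f x < g x}"
proof -
  have "real_polynomial_function (\<lambda>t::real. t)" by (intro rpf_linear bounded_linear_ident)
  then have "semialgebraic {t::real. t > 0}" by (rule semialgebraic.pos)
  from sa_subst[OF sa_fun_diff[OF assms(2,1)] this] show ?thesis by simp
qed

lemma sa_real_le:
  fixes f g :: "'a::euclidean_space \<Rightarrow> real"
  assumes "sa_fun f" "sa_fun g" shows "semialgebraic {x. f x \<le> g x}"
  using sa_not[OF sa_real_less[OF assms(2,1)]] by (simp add: not_less)

lemma sa_eq:
  assumes "sa_fun f" "sa_fun g" shows "semialgebraic {x. f x = g x}"
proof -
  have "semialgebraic {x. (f x - g x) \<bullet> (f x - g x) \<le> 0}"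
    by (intro sa_real_le sa_fun_inner sa_fun_diff assms sa_fun_const)
  moreover have "(f x - g x) \<bullet> (f x - g x) \<le> 0 \<longleftrightarrow> f x = g x" for x
    using inner_ge_zero[of "f x - g x"] inner_eq_zero_iff[of "f x - g x"] by (simp only: order.eq_iff[of _ "0::real"]) auto
  ultimately show ?thesis by simp
qed

lemma sa_mem: "sa_fun f \<Longrightarrow> semialgebraic A \<Longrightarrow> semialgebraic {x. f x \<in> A}"
  using sa_subst[of f "\<lambda>x. x \<in> A"] by simp

lemma sa_fun_norm:
  fixes f :: "'a::euclidean_space \<Rightarrow> 'b::euclidean_space"
  assumes "sa_fun f" shows "sa_fun (\<lambda>x. norm (f x))"
proof -
  have f: "sa_fun (\<lambda>z::'a\<times>real. f (fst z))" by (intro sa_fun_comp[OF assms] sa_fun_fst sa_fun_id)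
  have "semialgebraic {z::'a\<times>real. 0 \<le> snd z \<and> snd z * snd z = f (fst z) \<bullet> f (fst z)}"
    by (intro sa_conj sa_real_le sa_eq sa_fun_mult sa_fun_inner f sa_fun_snd sa_fun_id sa_fun_const)
  moreover have "0 \<le> t \<and> t * t = v \<bullet> v \<longleftrightarrow> t = norm v" for t and v :: 'b
  proof
    assume *: "0 \<le> t \<and> t * t = v \<bullet> v"
    then have "t\<^sup>2 = (norm v)\<^sup>2" by (simp add: power2_eq_square dot_square_norm)
    then show "t = norm v" using * by (simp add: power2_eq_iff_nonneg)
  qed (simp add: dot_square_norm power2_eq_square)
  ultimately show ?thesis by (simp add: sa_fun_graph)
qed

text \<open>Maps on \<open>X\<close> are replaced by total ones, because composition and the other
  closure rules are stated for total functions. The constant default 0 keeps the graph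
  semialgebraic.\<close>

lemma sa_fun_restrict:
  assumes f: "semialgebraic_map X f" and X: "semialgebraic X"
  shows "sa_fun (\<lambda>x. if x \<in> X then f x else 0)"
proof -
  have X': "semialgebraic {z::'a\<times>'b. fst z \<in> X}"
    using sa_vimage_linear[OF bounded_linear_fst, of "\<lambda>x. x \<in> X"] X by simp
  have f': "semialgebraic {z. z \<in> {(x, f x) |x. x \<in> X}}" using f by (simp add: semialgebraic_map_def)
  have "semialgebraic {z. (z \<in> {(x, f x) |x. x \<in> X}) \<or> (\<not> fst z \<in> X \<and> snd z = (0::'b))}"
    by (intro sa_disj sa_conj sa_not f' X' sa_eq sa_fun_snd sa_fun_id sa_fun_const)
  moreover have "{z. (z \<in> {(x, f x) |x. x \<in> X}) \<or> (\<not> fst z \<in> X \<and> snd z = (0::'b))} =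
    {z. snd z = (if fst z \<in> X then f (fst z) else 0)}" by auto
  ultimately show ?thesis by (simp only: sa_fun_graph)
qed

lemma sa_fun_imp_map:
  assumes "sa_fun f" "semialgebraic X" shows "semialgebraic_map X f"
proof -
  have "semialgebraic {z. fst z \<in> X \<and> snd z = f (fst z)}"
    using assms by (intro sa_conj sa_mem sa_fun_fst sa_fun_id) (simp_all add: sa_fun_graph)
  moreover have "{z. fst z \<in> X \<and> snd z = f (fst z)} = {(x, f x) |x. x \<in> X}" by auto
  ultimately show ?thesis by (simp add: semialgebraic_map_def)
qed

lemmas sa_fun_base_intros = sa_fun_id sa_fun_const sa_fun_fst sa_fun_snd sa_fun_Pair sa_fun_add sa_fun_diff sa_fun_mult sa_fun_scaleR
  sa_fun_inner sa_fun_norm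
lemmas sa_intros = sa_conj sa_disj sa_not sa_imp sa_real_less sa_real_le sa_eq sa_mem

section \<open>Zero sets of polynomials\<close>

lemma rpf_continuous: "real_polynomial_function p \<Longrightarrow> continuous_on S p"
  by (simp add: continuous_on_polymonial_function real_polynomial_function_eq)

text \<open>On the line through a and x the polynomial becomes one in a single variable that has an
  interval of roots.\<close>

lemma real_polynomial_zero_on_ball:
  fixes p :: "'a::euclidean_space \<Rightarrow> real"
  assumes p: "real_polynomial_function p" and r: "r > 0" and z: "\<And>y. y \<in> ball a r \<Longrightarrow> p y = 0"
  shows "p x = 0"
proof (cases "x = a")
  case True then show ?thesis using z r by simp
next
  case False
  define v where "v = x - a"
  have v: "norm v > 0" using False by (simp add: v_def)
  have "polynomial_function (\<lambda>t::real. a + t *\<^sub>R v)"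
    by (intro polynomial_function_add polynomial_function_const polynomial_function_bounded_linear bounded_linear_scaleR_left)
  from real_polynomial_function_compose[OF this p]
  have "real_polynomial_function (\<lambda>t::real. p (a + t *\<^sub>R v))" by (simp add: o_def)
  then obtain c n where c: "(\<lambda>t. p (a + t *\<^sub>R v)) = (\<lambda>t. \<Sum>i\<le>n. c i * t ^ i)"
    using real_polynomial_function_iff_sum by blast
  define q where "q = (\<Sum>i\<le>n. monom (c i) i)"
  have q: "poly q t = p (a + t *\<^sub>R v)" for t
    using fun_cong[OF c, of t] by (simp add: q_def poly_sum poly_monom)
  have "{0<..<r / norm v} \<subseteq> {t. poly q t = 0}"
  proof
    fix t assume t: "t \<in> {0<..<r / norm v}"
    then have "norm (t *\<^sub>R v) < r" using v by (simp add: pos_less_divide_eq)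
    then have "a + t *\<^sub>R v \<in> ball a r" by (simp add: dist_norm)
    then show "t \<in> {t. poly q t = 0}" using z q by simp
  qed
  moreover have "infinite {0<..<r / norm v}" using v r by (simp add: infinite_Ioo)
  ultimately have "infinite {t. poly q t = 0}" by (rule infinite_super)
  then have "q = 0" using poly_roots_finite by blast
  then have "p (a + 1 *\<^sub>R v) = 0" using q[of 1] by simp
  then show ?thesis by (simp add: v_def)
qed

lemma interior_nonemptyE:
  assumes "interior S \<noteq> {}"
  obtains a r where "r > 0" "ball a r \<subseteq> S"
  using assms by (metis ex_in_conv mem_interior)

lemma interior_polynomial_zeros:
  fixes p :: "'a::euclidean_space \<Rightarrow> real"
  assumes "real_polynomial_function p" "p x \<noteq> 0"
  shows "interior {x. p x = 0} = {}"
proof (rule ccontr)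
  assume "interior {x. p x = 0} \<noteq> {}"
  then obtain a r where r: "r > 0" "ball a r \<subseteq> {x. p x = 0}" by (rule interior_nonemptyE)
  have "p x = 0" by (rule real_polynomial_zero_on_ball[OF assms(1) r(1)]) (use r(2) in blast)
  then show False using assms by simp
qed

lemma closed_polynomial_zeros: "real_polynomial_function p \<Longrightarrow> closed {x. p x = 0}"
  by (intro closed_Collect_eq rpf_continuous continuous_on_const)

text \<open>The complement of the zeros of one factor is open and nonempty, hence not contained in
  the zeros of another factor, which have empty interior.\<close>

lemma prod_polynomials_nonzero:
  assumes "\<And>p. p \<in> set ps \<Longrightarrow> real_polynomial_function p \<and> (\<exists>x. p x \<noteq> 0)"
  shows "real_polynomial_function (\<lambda>x::'a::euclidean_space. \<Prod>p\<leftarrow>ps. p x) \<and> (\<exists>x. (\<Prod>p\<leftarrow>ps. p x) \<noteq> 0)"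
  using assms
proof (induction ps)
  case Nil then show ?case by (simp add: rpf_const)
next
  case (Cons p ps)
  let ?q = "\<lambda>x. \<Prod>p\<leftarrow>ps. p x"
  have p: "real_polynomial_function p" "\<exists>x. p x \<noteq> 0" using Cons.prems by auto
  have IH: "real_polynomial_function ?q" "\<exists>x. ?q x \<noteq> 0" using Cons by auto
  then obtain x where x: "?q x \<noteq> 0" by blast
  have "open (- {x. ?q x = 0})" using closed_polynomial_zeros[OF IH(1)] by (simp add: open_Compl)
  then have "x \<in> interior (- {x. ?q x = 0})" using x by (simp add: interior_open)
  moreover have "interior {x. p x = 0} = {}" using p(2) interior_polynomial_zeros[OF p(1)] by auto
  ultimately have "\<not> - {x. ?q x = 0} \<subseteq> {x. p x = 0}"
    using interior_mono[of "- {x. ?q x = 0}" "{x. p x = 0}"] by auto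
  then have "\<exists>x. p x * ?q x \<noteq> 0" by auto
  moreover have "real_polynomial_function (\<lambda>x. p x * ?q x)" by (rule rpf_mult[OF p(1) IH(1)])
  ultimately show ?case by simp
qed

text \<open>Where the product of the defining polynomials is nonzero, all their signs are locally
  constant, so a point of \<open>A\<close> there would be interior. Polynomials that vanish
  identically are left out of the product; their signs are constant anyway.\<close>

lemma semialgebraic_empty_interior:
  fixes A :: "'a::euclidean_space set"
  assumes A: "semialgebraic A" and int: "interior A = {}"
  obtains p x where "real_polynomial_function p" "p x \<noteq> 0" "A \<subseteq> {x. p x = 0}"
proof -
  obtain ps \<phi> where ps: "\<And>p. p \<in> set ps \<Longrightarrow> real_polynomial_function p"
    and A: "A = {x. \<phi> (map (\<lambda>p. sgn (p x)) ps)}"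
    using semialgebraic_signsE[OF A] by blast
  define qs where "qs = filter (\<lambda>p. \<exists>x. p x \<noteq> 0) ps"
  let ?q = "\<lambda>x. \<Prod>p\<leftarrow>qs. p x"
  have q: "real_polynomial_function ?q \<and> (\<exists>x. ?q x \<noteq> 0)"
    by (rule prod_polynomials_nonzero) (use ps in \<open>auto simp: qs_def\<close>)
  have "?q x = 0" if x: "x \<in> A" for x
  proof (rule ccontr)
    assume "?q x \<noteq> 0"
    then have nz: "p x \<noteq> 0" if "p \<in> set qs" for p
      using that by (auto simp: prod_list_zero_iff)
    have "eventually (\<lambda>y. \<forall>p\<in>set qs. sgn (p y) = sgn (p x)) (nhds x)"
    proof (rule eventually_ball_finite, simp, intro ballI)
      fix p assume p: "p \<in> set qs"
      then have "isCont p x" using ps rpf_continuous[of p UNIV]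
        by (auto simp: qs_def continuous_on_eq_continuous_at)
      then have "(p \<longlongrightarrow> p x) (nhds x)" by (simp add: continuous_at tendsto_nhds_iff)
      then show "eventually (\<lambda>y. sgn (p y) = sgn (p x)) (nhds x)"
        using nz[OF p] order_tendstoD[of p "p x" "nhds x" 0]
        by (cases "p x > 0") (auto elim!: eventually_mono simp: sgn_if)
    qed
    then obtain S where S: "open S" "x \<in> S" "\<And>y. y \<in> S \<Longrightarrow> \<forall>p\<in>set qs. sgn (p y) = sgn (p x)"
      by (auto simp: eventually_nhds)
    have "S \<subseteq> A"
    proof
      fix y assume y: "y \<in> S"
      have "map (\<lambda>p. sgn (p y)) ps = map (\<lambda>p. sgn (p x)) ps"
      proof (rule map_cong[OF refl])
        fix p assume "p \<in> set ps"
        then show "sgn (p y) = sgn (p x)" using S(3)[OF y] by (cases "\<exists>x. p x \<noteq> 0") (auto simp: qs_def)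
      qed
      then show "y \<in> A" using x unfolding A by (simp only: mem_Collect_eq)
    qed
    then have "x \<in> interior A" using S by (meson interiorI)
    then show False using int by simp
  qed
  then show ?thesis using that[of ?q] q by blast
qed

text \<open>False for general sets such as the rationals; here \<open>A\<close> lies in the closed
  zero set of a nonzero polynomial.\<close>

lemma semialgebraic_interior_closure:
  assumes "semialgebraic A" "interior A = {}"
  shows "interior (closure A) = {}"
proof -
  obtain p x where p: "real_polynomial_function p" "p x \<noteq> 0" "A \<subseteq> {x. p x = 0}"
    using semialgebraic_empty_interior[OF assms] by metis
  have "closure A \<subseteq> {x. p x = 0}"
    using p closed_polynomial_zeros closure_minimal by blast
  then show ?thesis using interior_polynomial_zeros[OF p(1,2)] interior_mono by blast
qed

section \<open>Continuous semialgebraic sections\<close>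

lemma Baire_nat:
  fixes V :: "'a::euclidean_space set"
  assumes V: "open V" "V \<noteq> {}" "V \<subseteq> (\<Union>n::nat. D n)"
  obtains n W where "open W" "W \<noteq> {}" "W \<subseteq> V" "W \<subseteq> closure (D n \<inter> V)"
proof (cases "\<exists>n. interior (closure (D n \<inter> V)) \<noteq> {}")
  case True
  then obtain n where n: "interior (closure (D n \<inter> V)) \<noteq> {}" by blast
  let ?W = "interior (closure (D n \<inter> V)) \<inter> V"
  have "interior (closure (D n \<inter> V)) \<inter> (D n \<inter> V) \<noteq> {}"
    using n open_Int_closure_eq_empty[of "interior (closure (D n \<inter> V))" "D n \<inter> V"] interior_subset by blast
  then show ?thesis using V(1) that[of ?W n] interior_subset[of "closure (D n \<inter> V)"] by blast
next
  case False
  define G where "G = range (\<lambda>n. - closure (D n \<inter> V))"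
  have "UNIV \<subseteq> closure (\<Inter>G)"
  proof (rule Baire)
    fix T assume "T \<in> G"
    then obtain n where "T = - closure (D n \<inter> V)" by (auto simp: G_def)
    then show "openin (top_of_set UNIV) T \<and> UNIV \<subseteq> closure T"
      using False by (simp add: closure_complement open_Compl)
  qed (auto simp: G_def)
  then have "V \<inter> \<Inter>G \<noteq> {}" using V open_Int_closure_eq_empty[of V "\<Inter>G"] by blast
  then obtain x where x: "x \<in> V" "\<And>n. x \<notin> closure (D n \<inter> V)" by (auto simp: G_def)
  then obtain n where "x \<in> D n" using V(3) by blast
  then show ?thesis using x closure_subset by blast
qed

text \<open>The set \<open>C\<close> of continuity points is semialgebraic. If it contains no ball,
  then by \<open>semialgebraic_interior_closure\<close> some open set has no continuity point at
  all. Lower semicontinuity turns every discontinuity there into upward jumps of some size 1/(n +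
  1), and Baire's theorem gives one size that occurs densely in an open set W. A jump of this size
  next to a point where m almost attains its supremum over W exceeds the supremum.\<close>

lemma generic_continuity:
  fixes m :: "'a::euclidean_space \<Rightarrow> real"
  assumes m: "sa_fun m" and r: "r > 0"
    and lsc: "\<And>u c. u \<in> ball a r \<Longrightarrow> c < m u \<Longrightarrow> \<exists>d>0. \<forall>w. dist w u < d \<longrightarrow> c < m w"
    and bd: "\<And>u. u \<in> ball a r \<Longrightarrow> m u \<le> M"
  obtains b s where "s > 0" "ball b s \<subseteq> ball a r" "continuous_on (ball b s) m"
proof -
  define C where "C = {u. \<forall>e. e > 0 \<longrightarrow> (\<exists>d. d > 0 \<and> (\<forall>w. norm (w - u) < d \<longrightarrow> norm (m w - m u) < e))}"
  have "semialgebraic {u. \<forall>e. 0 < e \<longrightarrow> (\<exists>d. 0 < d \<and> (\<forall>w. norm (w - u) < d \<longrightarrow> norm (m w - m u) < e))}"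
    by (intro sa_all sa_ex sa_intros sa_fun_base_intros sa_fun_comp[OF m])
  then have C: "semialgebraic C" by (simp add: C_def)
  have "semialgebraic {u. norm (u - a) < r}" by (intro sa_intros sa_fun_base_intros)
  moreover have "{u. norm (u - a) < r} = ball a r" by (auto simp: dist_norm norm_minus_commute)
  ultimately have sb: "semialgebraic (ball a r)" by simp
  have cont: "isCont m u" if "u \<in> C" for u
    using that by (auto simp: C_def continuous_at_eps_delta dist_norm)
  show ?thesis
  proof (cases "interior (C \<inter> ball a r) = {}")
    case False
    then obtain b s where "s > 0" "ball b s \<subseteq> C \<inter> ball a r" by (rule interior_nonemptyE)
    then show ?thesis using that[of s b] cont continuous_at_imp_continuous_on by (meson IntD1 IntD2 subset_iff)
  next
    case True
    define V where "V = ball a r - closure (C \<inter> ball a r)"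
    have "interior (closure (C \<inter> ball a r)) = {}"
      by (rule semialgebraic_interior_closure[OF semialgebraic.Int[OF C sb] True])
    then have "\<not> ball a r \<subseteq> closure (C \<inter> ball a r)"
      using r by (metis ball_eq_empty empty_iff interior_maximal open_ball subset_empty not_le)
    then have V: "open V" "V \<noteq> {}" by (auto simp: V_def)
    define D where "D = (\<lambda>n::nat. {u. \<forall>d>0. \<exists>w. dist w u < d \<and> m u + 1 / Suc n \<le> m w})"
    have "V \<subseteq> (\<Union>n. D n)"
    proof
      fix u assume u: "u \<in> V"
      then have "u \<in> ball a r" "u \<notin> C" using closure_subset[of "C \<inter> ball a r"] unfolding V_def by blast+
      then obtain e where e: "e > 0" "\<And>d. d > 0 \<Longrightarrow> \<exists>w. norm (w - u) < d \<and> \<not> norm (m w - m u) < e"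
        by (auto simp: C_def)
      obtain d0 where d0: "d0 > 0" "\<And>w. dist w u < d0 \<Longrightarrow> m u - e < m w"
        using lsc[OF \<open>u \<in> ball a r\<close>, of "m u - e"] e by auto
      obtain n where n: "1 / Suc n < e" using e(1) nat_approx_posE by blast
      have "u \<in> D n" unfolding D_def
      proof (intro CollectI allI impI)
        fix d :: real assume "d > 0"
        then have "min d d0 > 0" using d0 by simp
        from e(2)[OF this] obtain w where w: "norm (w - u) < min d d0" "\<not> norm (m w - m u) < e" by blast
        then have "m u - e < m w" using d0 by (simp add: dist_norm)
        then have "m u + e \<le> m w" using w(2) by (simp add: abs_if split: if_splits)
        then show "\<exists>w. dist w u < d \<and> m u + 1 / Suc n \<le> m w"
          using w n by (intro exI[of _ w]) (simp add: dist_norm)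
      qed
      then show "u \<in> (\<Union>n. D n)" by blast
    qed
    from Baire_nat[OF V this] obtain n W where W: "open W" "W \<noteq> {}" "W \<subseteq> V" "W \<subseteq> closure (D n \<inter> V)"
      by metis
    define e where "e = 1 / real (Suc n)"
    have e: "e > 0" by (simp add: e_def)
    have WU: "W \<subseteq> ball a r" using W by (auto simp: V_def)
    have bdd: "bdd_above (m ` W)" using bd WU by (intro bdd_aboveI[of _ M]) auto
    have "Sup (m ` W) - e / 2 < Sup (m ` W)" using e by simp
    then obtain u where u: "u \<in> W" "Sup (m ` W) - e / 2 < m u"
      using less_cSup_iff[of "m ` W"] bdd W by blast
    obtain d where d: "d > 0" "\<And>w. dist w u < d \<Longrightarrow> Sup (m ` W) - e / 2 < m w"
      using lsc[OF _ u(2)] u WU by blast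
    have "u \<in> W \<inter> ball u d" using u d by simp
    then have "W \<inter> ball u d \<inter> (D n \<inter> V) \<noteq> {}"
      using open_Int_closure_eq_empty[of "W \<inter> ball u d" "D n \<inter> V"] W by blast
    then obtain u' where u': "u' \<in> W" "dist u u' < d" "u' \<in> D n" by auto
    obtain d' where d': "d' > 0" "ball u' d' \<subseteq> W" using u' W open_contains_ball by blast
    obtain w where w: "dist w u' < d'" "m u' + e \<le> m w" using u'(3) d' by (auto simp: D_def e_def)
    then have "w \<in> W" using d' by (auto simp: dist_commute)
    then have "m w \<le> Sup (m ` W)" using bdd by (intro cSup_upper) auto
    moreover have "Sup (m ` W) - e / 2 < m u'" using d u' by (simp add: dist_commute)
    ultimately show ?thesis using w e by simp
  qed
qed

lemma semialgebraic_ball: "semialgebraic (ball a r)"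
proof -
  have "semialgebraic {u. norm (u - a) < r}" by (intro sa_intros sa_fun_base_intros)
  moreover have "{u. norm (u - a) < r} = ball a r" by (auto simp: dist_norm norm_minus_commute)
  ultimately show ?thesis by simp
qed

text \<open>A minimum over compact fibres is lower semicontinuous if limits of fibre points stay in
  the fibres. This closedness \<open>cl\<close> is required over the open ball only, because in the
  application earlier coordinates are fixed to functions known to be continuous just there.\<close>

lemma min_section:
  fixes K :: "('a::euclidean_space \<times> 'b::euclidean_space) set"
  assumes K: "semialgebraic K" and r: "r > 0"
    and ne: "\<And>u. u \<in> ball a r \<Longrightarrow> \<exists>z. (u, z) \<in> K"
    and bd: "\<And>u z. (u, z) \<in> K \<Longrightarrow> norm z \<le> N"
    and cl: "\<And>f g u z. (\<And>n::nat. f n \<in> ball a r \<and> (f n, g n) \<in> K) \<Longrightarrow> f \<longlonglongrightarrow> u \<Longrightarrow> g \<longlonglongrightarrow> z \<Longrightarrow>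
      u \<in> ball a r \<Longrightarrow> (u, z) \<in> K"
  obtains a' r' s where "r' > 0" "ball a' r' \<subseteq> ball a r" "sa_fun s" "continuous_on (ball a' r') s"
    "\<And>u. u \<in> ball a' r' \<Longrightarrow> \<exists>z. (u, z) \<in> K \<and> z \<bullet> b = s u"
proof -
  define Q where "Q = (\<lambda>u t. (\<exists>z. (u, z) \<in> K \<and> z \<bullet> b = t) \<and> (\<forall>z. (u, z) \<in> K \<longrightarrow> t \<le> z \<bullet> b))"
  have "\<exists>t. Q u t" if u: "u \<in> ball a r" for u
  proof -
    have "closed {z. (u, z) \<in> K}"
      unfolding closed_sequential_limits
    proof (intro allI impI, elim conjE)
      fix g z assume "\<forall>n. g n \<in> {z. (u, z) \<in> K}" "g \<longlonglongrightarrow> z"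
      then show "z \<in> {z. (u, z) \<in> K}" using cl[of "\<lambda>n. u" g u z] u by simp
    qed
    moreover have "bounded {z. (u, z) \<in> K}" using bd by (auto simp: bounded_iff)
    ultimately have "compact {z. (u, z) \<in> K}" by (simp add: compact_eq_bounded_closed)
    moreover have "{z. (u, z) \<in> K} \<noteq> {}" using ne[OF u] by blast
    moreover have "continuous_on {z. (u, z) \<in> K} (\<lambda>z. z \<bullet> b)" by (intro continuous_intros)
    ultimately obtain z where "(u, z) \<in> K" "\<forall>y\<in>{z. (u, z) \<in> K}. z \<bullet> b \<le> y \<bullet> b"
      using continuous_attains_inf[of "{z. (u, z) \<in> K}" "\<lambda>z. z \<bullet> b"] by auto
    then show ?thesis unfolding Q_def by blast
  qed
  then obtain s0 where s0: "\<And>u. u \<in> ball a r \<Longrightarrow> Q u (s0 u)" by metis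
  define s where "s = (\<lambda>u. if u \<in> ball a r then s0 u else 0)"
  have sQ: "Q u (s u)" if "u \<in> ball a r" for u using s0 that by (simp add: s_def)
  have Qu: "t = t'" if Q: "Q u t" "Q u t'" for u t t'
  proof (rule order.antisym)
    obtain z z' where "(u, z) \<in> K" "z \<bullet> b = t" "(u, z') \<in> K" "z' \<bullet> b = t'" using Q unfolding Q_def by blast
    then show "t \<le> t'" "t' \<le> t" using Q unfolding Q_def by blast+
  qed
  have "semialgebraic {w. (fst w \<in> ball a r \<and> ((\<exists>z. (fst w, z) \<in> K \<and> z \<bullet> b = snd w) \<and> (\<forall>z. (fst w, z) \<in> K \<longrightarrow> snd w \<le> z \<bullet> b)))
     \<or> (\<not> fst w \<in> ball a r \<and> snd w = 0)}"
    by (intro sa_intros sa_ex sa_all sa_fun_base_intros K semialgebraic_ball)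
  moreover have "(fst w \<in> ball a r \<and> ((\<exists>z. (fst w, z) \<in> K \<and> z \<bullet> b = snd w) \<and> (\<forall>z. (fst w, z) \<in> K \<longrightarrow> snd w \<le> z \<bullet> b)))
     \<or> (\<not> fst w \<in> ball a r \<and> snd w = 0) \<longleftrightarrow> snd w = s (fst w)" for w
  proof (cases "fst w \<in> ball a r")
    case True
    then have "Q (fst w) (snd w) \<longleftrightarrow> snd w = s (fst w)" using sQ Qu by metis
    then show ?thesis using True by (simp only: Q_def) simp
  qed (simp add: s_def)
  ultimately have sa_fun: "sa_fun s" unfolding sa_fun_graph by simp
  have lsc: "\<exists>d>0. \<forall>w. dist w u < d \<longrightarrow> c < s w" if u: "u \<in> ball a r" and c: "c < s u" for u c
  proof (rule ccontr)
    assume neg: "\<not> (\<exists>d>0. \<forall>w. dist w u < d \<longrightarrow> c < s w)"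
    obtain d0 where d0: "d0 > 0" "ball u d0 \<subseteq> ball a r" using u open_ball open_contains_ball by blast
    \<comment> \<open>Minimisers over points w n tending to u are bounded, so a subsequence
      converges to a point of the fibre over u whose inner product with b is at most c.\<close>
    have "\<exists>w. dist w u < min d0 (1 / Suc n) \<and> s w \<le> c" for n :: nat
      using neg d0 by (metis min_less_iff_conj not_less of_nat_0_less_iff zero_less_Suc zero_less_divide_1_iff)
    then obtain w where w: "\<And>n. dist (w n) u < min d0 (1 / Suc n)" "\<And>n. s (w n) \<le> c" by metis
    have wb: "w n \<in> ball a r" for n using w(1)[of n] d0 by (auto simp: dist_commute)
    have "\<exists>z. (w n, z) \<in> K \<and> z \<bullet> b = s (w n)" for n using sQ[OF wb[of n]] by (auto simp: Q_def)
    then obtain z where z: "\<And>n. (w n, z n) \<in> K" "\<And>n. z n \<bullet> b = s (w n)" by metis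
    have "bounded (range z)" using bd z(1) by (auto simp: bounded_iff)
    then obtain l \<rho> where l: "strict_mono \<rho>" "(z \<circ> \<rho>) \<longlonglongrightarrow> l" using bounded_imp_convergent_subsequence by blast
    have "w \<longlonglongrightarrow> u"
    proof (rule metric_tendsto_imp_tendsto[OF LIMSEQ_inverse_real_of_nat])
      show "\<forall>\<^sub>F n in sequentially. dist (w n) u \<le> dist (inverse (real (Suc n))) 0"
        using w(1) by (intro always_eventually allI) (simp add: inverse_eq_divide less_imp_le)
    qed
    then have "(w \<circ> \<rho>) \<longlonglongrightarrow> u" using l(1) by (rule LIMSEQ_subseq_LIMSEQ)
    then have "(u, l) \<in> K" using cl[of "w \<circ> \<rho>" "z \<circ> \<rho>" u l] wb z l u by simp
    then have "s u \<le> l \<bullet> b" using sQ[OF u] by (auto simp: Q_def)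
    moreover have "l \<bullet> b \<le> c"
    proof (rule LIMSEQ_le_const2)
      show "(\<lambda>n. (z \<circ> \<rho>) n \<bullet> b) \<longlonglongrightarrow> l \<bullet> b" using l(2) by (intro tendsto_intros)
      show "\<exists>N. \<forall>n\<ge>N. (z \<circ> \<rho>) n \<bullet> b \<le> c" using w(2) z(2) by simp
    qed
    ultimately show False using c by simp
  qed
  have sN: "s u \<le> N * norm b" if u: "u \<in> ball a r" for u
  proof -
    obtain z where z: "(u, z) \<in> K" "z \<bullet> b = s u" using sQ[OF u] unfolding Q_def by blast
    have "z \<bullet> b \<le> norm z * norm b" by (rule norm_cauchy_schwarz)
    also have "\<dots> \<le> N * norm b" by (intro mult_right_mono bd[OF z(1)]) simp
    finally show ?thesis using z by simp
  qed
  from generic_continuity[OF sa_fun r lsc sN] obtain a' r' where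
    ar: "r' > 0" "ball a' r' \<subseteq> ball a r" "continuous_on (ball a' r') s" by metis
  have "\<exists>z. (u, z) \<in> K \<and> z \<bullet> b = s u" if "u \<in> ball a' r'" for u
    using sQ[of u] ar that by (auto simp: Q_def)
  then show ?thesis using that ar sa_fun by blast
qed

text \<open>In each step one more coordinate is fixed to its minimum on the remaining part of the
  fibre, over a smaller ball on which this minimum is continuous. \<open>B\<close> is the set of
  coordinates fixed so far.\<close>

lemma semialgebraic_section_bounded:
  fixes K :: "('a::euclidean_space \<times> 'b::euclidean_space) set"
  assumes K: "semialgebraic K" "closed K" and r: "r > 0"
    and ne: "\<And>u. u \<in> ball a r \<Longrightarrow> \<exists>z. (u, z) \<in> K"
    and bd: "\<And>u z. (u, z) \<in> K \<Longrightarrow> norm z \<le> N"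
  obtains a' r' s where "r' > 0" "ball a' r' \<subseteq> ball a r" "sa_fun s" "continuous_on (ball a' r') s"
    "\<And>u. u \<in> ball a' r' \<Longrightarrow> (u, s u) \<in> K"
proof -
  have "\<exists>a' r' (s :: 'a \<Rightarrow> 'b). r' > 0 \<and> ball a' r' \<subseteq> ball a r \<and> sa_fun s \<and> continuous_on (ball a' r') s \<and>
    (\<forall>u\<in>ball a' r'. \<exists>z. (u, z) \<in> K \<and> (\<forall>b\<in>B. z \<bullet> b = s u \<bullet> b))" if "B \<subseteq> Basis" "finite B" for B
    using that(2,1)
  proof (induction B rule: finite_induct)
    case empty
    show ?case using r ne by (intro exI[of _ a] exI[of _ r] exI[of _ "\<lambda>u. 0"]) (auto simp: sa_fun_const)
  next
    case (insert b B)
    then obtain a1 r1 and s :: "'a \<Rightarrow> 'b" where s: "r1 > 0" "ball a1 r1 \<subseteq> ball a r" "sa_fun s" "continuous_on (ball a1 r1) s"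
      "\<And>u. u \<in> ball a1 r1 \<Longrightarrow> \<exists>z. (u, z) \<in> K \<and> (\<forall>b\<in>B. z \<bullet> b = s u \<bullet> b)" by auto
    define K' where "K' = {w. w \<in> K \<and> (\<forall>b\<in>B. snd w \<bullet> b = s (fst w) \<bullet> b)}"
    have K': "semialgebraic K'" unfolding K'_def
      by (intro sa_intros sa_ball insert.hyps K sa_fun_base_intros sa_fun_comp[OF s(3)])
    obtain a2 r2 s1 where s1: "r2 > 0" "ball a2 r2 \<subseteq> ball a1 r1" "sa_fun s1" "continuous_on (ball a2 r2) s1"
      "\<And>u. u \<in> ball a2 r2 \<Longrightarrow> \<exists>z. (u, z) \<in> K' \<and> z \<bullet> b = s1 u"
    proof (rule min_section[OF K' s(1), where b = b and N = N])
      show "\<exists>z. (u, z) \<in> K'" if "u \<in> ball a1 r1" for u using s(5)[OF that] by (auto simp: K'_def)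
      show "norm z \<le> N" if "(u, z) \<in> K'" for u z using that bd by (auto simp: K'_def)
      fix f g u z assume fg: "\<And>n::nat. f n \<in> ball a1 r1 \<and> (f n, g n) \<in> K'" "f \<longlonglongrightarrow> u" "g \<longlonglongrightarrow> z" "u \<in> ball a1 r1"
      have "(\<lambda>n. (f n, g n)) \<longlonglongrightarrow> (u, z)" using fg by (intro tendsto_intros)
      then have "(u, z) \<in> K" using closed_sequentially[OF K(2), of "\<lambda>n. (f n, g n)"] fg(1) by (auto simp: K'_def)
      moreover have "z \<bullet> c = s u \<bullet> c" if c: "c \<in> B" for c
      proof -
        have "(\<lambda>n. s (f n)) \<longlonglongrightarrow> s u"
          using continuous_on_tendsto_compose[OF s(4) fg(2,4)] fg(1) by simp
        then have 1: "(\<lambda>n. s (f n) \<bullet> c) \<longlonglongrightarrow> s u \<bullet> c" by (intro tendsto_intros)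
        have "(\<lambda>n. g n \<bullet> c) \<longlonglongrightarrow> z \<bullet> c" using fg(3) by (intro tendsto_intros)
        moreover have "(\<lambda>n. g n \<bullet> c) = (\<lambda>n. s (f n) \<bullet> c)" using fg(1) c by (auto simp: K'_def)
        ultimately show ?thesis using LIMSEQ_unique[OF _ 1] by simp
      qed
      ultimately show "(u, z) \<in> K'" by (auto simp: K'_def)
    qed metis
    define s2 where "s2 = (\<lambda>u. s u + (s1 u - s u \<bullet> b) *\<^sub>R b)"
    have "sa_fun s2" unfolding s2_def by (intro sa_fun_base_intros s s1)
    moreover have "continuous_on (ball a2 r2) s2"
      unfolding s2_def using continuous_on_subset[OF s(4) s1(2)] by (intro continuous_intros s1) auto
    moreover have "\<exists>z. (u, z) \<in> K \<and> (\<forall>c\<in>insert b B. z \<bullet> c = s2 u \<bullet> c)" if u: "u \<in> ball a2 r2" for u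
    proof -
      obtain z where z: "(u, z) \<in> K" "\<forall>b\<in>B. z \<bullet> b = s u \<bullet> b" "z \<bullet> b = s1 u"
        using s1(5)[OF u] unfolding K'_def by auto
      have "b \<in> Basis" "B \<subseteq> Basis" using insert.prems by auto
      then have "s2 u \<bullet> b = s1 u" by (simp add: s2_def inner_add_left)
      moreover have "s2 u \<bullet> c = s u \<bullet> c" if "c \<in> B" for c
      proof -
        have "c \<in> Basis" "b \<noteq> c" using that insert.hyps \<open>B \<subseteq> Basis\<close> by auto
        then show ?thesis using \<open>b \<in> Basis\<close> by (simp add: s2_def inner_add_left inner_not_same_Basis)
      qed
      ultimately show ?thesis using z by auto
    qed
    ultimately show ?case using s1 s by (intro exI[of _ a2] exI[of _ r2] exI[of _ s2]) auto
  qed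
  from this[of Basis] obtain a' r' and s :: "'a \<Rightarrow> 'b" where s: "r' > 0" "ball a' r' \<subseteq> ball a r" "sa_fun s" "continuous_on (ball a' r') s"
    "\<And>u. u \<in> ball a' r' \<Longrightarrow> \<exists>z. (u, z) \<in> K \<and> (\<forall>b\<in>Basis. z \<bullet> b = s u \<bullet> b)" by auto
  have "(u, s u) \<in> K" if "u \<in> ball a' r'" for u
    using s(5)[OF that] euclidean_eqI by metis
  then show ?thesis using that s by blast
qed

text \<open>Baire's theorem yields a ball over which every fibre contains a point of norm at most n;
  passing from a dense set of such base points to all of them uses that \<open>K\<close> is
  closed.\<close>

lemma semialgebraic_section:
  fixes K :: "('a::euclidean_space \<times> 'b::euclidean_space) set"
  assumes K: "semialgebraic K" "closed K" and r: "r > 0"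
    and ne: "\<And>u. u \<in> ball a r \<Longrightarrow> \<exists>z. (u, z) \<in> K"
  obtains a' r' s where "r' > 0" "sa_fun s" "continuous_on (ball a' r') s"
    "\<And>u. u \<in> ball a' r' \<Longrightarrow> (u, s u) \<in> K"
proof -
  define D where "D = (\<lambda>n::nat. {u. \<exists>z. (u, z) \<in> K \<and> norm z \<le> real n})"
  have "ball a r \<subseteq> (\<Union>n. D n)"
  proof
    fix u assume "u \<in> ball a r"
    then obtain z where "(u, z) \<in> K" using ne by blast
    moreover obtain n :: nat where "norm z \<le> real n" using real_arch_simple by blast
    ultimately show "u \<in> (\<Union>n. D n)" by (auto simp: D_def)
  qed
  then obtain n W where W: "open W" "W \<noteq> {}" "W \<subseteq> ball a r" "W \<subseteq> closure (D n \<inter> ball a r)"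
    using Baire_nat[of "ball a r" D] r by (metis open_ball ball_eq_empty not_le)
  have "W \<subseteq> D n"
  proof
    fix u assume "u \<in> W"
    then have "u \<in> closure (D n \<inter> ball a r)" using W(4) by blast
    then obtain f where f: "\<And>k. f k \<in> D n \<inter> ball a r" "f \<longlonglongrightarrow> u" unfolding closure_sequential by blast
    have "\<exists>z. (f k, z) \<in> K \<and> norm z \<le> real n" for k using f(1)[of k] by (simp add: D_def)
    then obtain z where z: "\<And>k. (f k, z k) \<in> K" "\<And>k. norm (z k) \<le> real n" by metis
    have "bounded (range z)" using z(2) by (auto simp: bounded_iff)
    then obtain l \<rho> where l: "strict_mono \<rho>" "(z \<circ> \<rho>) \<longlonglongrightarrow> l" using bounded_imp_convergent_subsequence by blast
    have "(f \<circ> \<rho>) \<longlonglongrightarrow> u" using f(2) l(1) by (rule LIMSEQ_subseq_LIMSEQ)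
    with l(2) have "(\<lambda>k. ((f \<circ> \<rho>) k, (z \<circ> \<rho>) k)) \<longlonglongrightarrow> (u, l)" by (intro tendsto_intros)
    then have "(u, l) \<in> K" using closed_sequentially[OF K(2), of "\<lambda>k. ((f \<circ> \<rho>) k, (z \<circ> \<rho>) k)"] z by simp
    moreover have "norm l \<le> real n"
      by (rule LIMSEQ_le_const2[OF tendsto_norm[OF l(2)]]) (use z in simp)
    ultimately show "u \<in> D n" by (auto simp: D_def)
  qed
  obtain a1 r1 where a1: "r1 > 0" "ball a1 r1 \<subseteq> W" using W(1,2) by (metis ex_in_conv open_contains_ball)
  define K' where "K' = {w. w \<in> K \<and> norm (snd w) \<le> real n}"
  have sK': "semialgebraic K'" unfolding K'_def by (intro sa_intros sa_fun_base_intros K)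
  have cK': "closed K'"
  proof -
    have "K' = K \<inter> {w. norm (snd w) \<le> real n}" by (auto simp: K'_def)
    moreover have "closed {w :: 'a \<times> 'b. norm (snd w) \<le> real n}"
      by (intro closed_Collect_le continuous_intros)
    ultimately show ?thesis using K(2) by (simp add: closed_Int)
  qed
  have neK': "\<exists>z. (u, z) \<in> K'" if "u \<in> ball a1 r1" for u
    using that a1(2) \<open>W \<subseteq> D n\<close> by (auto simp: K'_def D_def)
  have bdK': "norm z \<le> real n" if "(u, z) \<in> K'" for u z using that by (simp add: K'_def)
  obtain a' r' s where s: "r' > 0" "sa_fun s" "continuous_on (ball a' r') s"
    "\<And>u. u \<in> ball a' r' \<Longrightarrow> (u, s u) \<in> K'"
  proof (rule semialgebraic_section_bounded[OF sK' cK' a1(1), where a = a1 and N = "real n"])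
    show "\<exists>z. (u, z) \<in> K'" if "u \<in> ball a1 r1" for u by (rule neK'[OF that])
    show "norm z \<le> real n" if "(u, z) \<in> K'" for u z by (rule bdK'[OF that])
  qed blast
  have "(u, s u) \<in> K" if "u \<in> ball a' r'" for u using s(4)[OF that] by (simp add: K'_def)
  then show ?thesis using that[OF s(1-3)] by blast
qed

section \<open>Dimension and coordinate projections\<close>

definition contains_cube :: "'a::euclidean_space set \<Rightarrow> nat \<Rightarrow> bool" where
  "contains_cube X d \<longleftrightarrow> (\<exists>B\<subseteq>(Basis :: 'a set). card B = d \<and> (\<exists>S h g. S \<subseteq> X \<and>
     homeomorphism (open_cube B) S h g \<and> semialgebraic_map (open_cube B) h))"

lemma semialgebraic_dim_eq: "semialgebraic_dim X = Max (insert (- 1) (int ` {d. contains_cube X d}))"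
proof -
  have "{int (card B) |B. B \<subseteq> (Basis :: 'a set) \<and> (\<exists>S h g. S \<subseteq> X \<and> homeomorphism (open_cube B) S h g \<and>
                semialgebraic_map (open_cube B) h)} = int ` {d. contains_cube X d}"
    unfolding contains_cube_def by blast
  then show ?thesis by (simp add: semialgebraic_dim_def)
qed

lemma finite_contains_cube: "finite {d. contains_cube (X :: 'a::euclidean_space set) d}"
proof -
  have "{d. contains_cube X d} \<subseteq> {..DIM('a)}"
    by (auto simp: contains_cube_def intro: card_mono)
  then show ?thesis by (rule finite_subset) simp
qed

lemma contains_cube_dim: "contains_cube X d \<Longrightarrow> int d \<le> semialgebraic_dim X"
  unfolding semialgebraic_dim_eq using finite_contains_cube by (intro Max_ge) auto

lemma open_cube_empty: "open_cube {} = {0}"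
  by (auto simp: open_cube_def euclidean_all_zero_iff)

lemma semialgebraic_open_cube: "semialgebraic (open_cube B)"
proof -
  have "semialgebraic {x. \<forall>b\<in>Basis. (b \<in> B \<longrightarrow> 0 < x \<bullet> b \<and> x \<bullet> b < 1) \<and> (b \<notin> B \<longrightarrow> x \<bullet> b = 0)}"
    by (intro sa_ball sa_intros sa_const sa_fun_base_intros) simp
  then show ?thesis unfolding open_cube_def by (simp add: if_bool_eq_conj)
qed

text \<open>Ensures that a nonempty set has dimension at least 0.\<close>

lemma contains_cube_0:
  assumes "x \<in> X" shows "contains_cube X 0"
  unfolding contains_cube_def
proof (intro exI conjI)
  show "homeomorphism (open_cube {}) {x} (\<lambda>_. x) (\<lambda>_. 0)"
    by (auto simp: homeomorphism_def open_cube_empty)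
  show "semialgebraic_map (open_cube {}) (\<lambda>_. x)"
    by (rule sa_fun_imp_map[OF sa_fun_const semialgebraic_open_cube])
qed (use assms in auto)

text \<open>Semialgebraicity is assumed of \<open>g\<close>, not of its inverse; the graph of g'
  after h is described through \<open>g\<close> by the conditions y \<in> X and g y = h x.\<close>

lemma contains_cube_embedding:
  fixes X :: "'a::euclidean_space set" and g :: "'a \<Rightarrow> 'a"
  assumes cube: "contains_cube (g ` X) d" and X: "semialgebraic X" and g: "sa_fun g"
    and hom: "homeomorphism X (g ` X) g g'"
  shows "contains_cube X d"
proof -
  obtain B :: "'a set" and S h k where B: "B \<subseteq> Basis" "card B = d" and S: "S \<subseteq> g ` X"
    "homeomorphism (open_cube B) S h k" "semialgebraic_map (open_cube B) h"
    using cube unfolding contains_cube_def by (elim exE conjE)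
  have "homeomorphism S (g' ` S) g' g"
    using homeomorphism_of_subsets[OF homeomorphism_symD[OF hom] S(1)] by blast
  from homeomorphism_compose[OF S(2) this]
  have "homeomorphism (open_cube B) (g' ` S) (g' \<circ> h) (k \<circ> g)" .
  moreover have "g' ` S \<subseteq> X" using S(1) hom by (auto simp: homeomorphism_def)
  moreover have "semialgebraic_map (open_cube B) (g' \<circ> h)"
  proof -
    define h0 where "h0 = (\<lambda>x. if x \<in> open_cube B then h x else 0)"
    have "sa_fun h0" unfolding h0_def by (rule sa_fun_restrict[OF S(3) semialgebraic_open_cube])
    then have "semialgebraic {z. fst z \<in> open_cube B \<and> (snd z \<in> X \<and> g (snd z) = h0 (fst z))}"
      by (intro sa_intros sa_fun_base_intros sa_fun_comp[OF g] sa_fun_comp[OF \<open>sa_fun h0\<close>] semialgebraic_open_cube X)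
    moreover have "{z. fst z \<in> open_cube B \<and> (snd z \<in> X \<and> g (snd z) = h0 (fst z))} =
      {(x, (g' \<circ> h) x) |x. x \<in> open_cube B}" (is "?L = ?R")
    proof (intro set_eqI iffI)
      fix z assume z: "z \<in> ?L"
      then have "g' (g (snd z)) = snd z" using homeomorphism_apply1[OF hom] by blast
      then have "snd z = (g' \<circ> h) (fst z)" using z by (simp add: h0_def)
      then have "z = (fst z, (g' \<circ> h) (fst z))" by (simp add: prod_eq_iff)
      then show "z \<in> ?R" using z by blast
    next
      fix z assume "z \<in> ?R"
      then obtain x where x: "x \<in> open_cube B" "z = (x, g' (h x))" by auto
      have "h x \<in> g ` X" using S x homeomorphism_image1[OF S(2)] by blast
      then have "g' (h x) \<in> X" "g (g' (h x)) = h x"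
        using homeomorphism_image2[OF hom] homeomorphism_apply2[OF hom] by blast+
      then show "z \<in> ?L" using x by (simp add: h0_def)
    qed
    ultimately show ?thesis by (simp add: semialgebraic_map_def)
  qed
  ultimately show ?thesis using B unfolding contains_cube_def by blast
qed

lemma sa_fun_component:
  fixes f :: "'a::euclidean_space \<Rightarrow> real^'n"
  assumes "sa_fun f" shows "sa_fun (\<lambda>x. f x $ i)"
proof -
  have "f x $ i = f x \<bullet> axis i 1" for x by (simp add: inner_axis)
  then show ?thesis using sa_fun_inner[OF assms sa_fun_const] by simp
qed

text \<open>Coordinates outside of \<open>I\<close> are irrelevant for the cylinder over a coordinate projection,
  so this avoids a type for \<open>\<real>\<^sup>I\<close>.\<close>

definition cylinder :: "'n set \<Rightarrow> (real^'n) set \<Rightarrow> (real^'n) set" where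
  "cylinder I X = {u. \<exists>z\<in>X. \<forall>i\<in>I. z $ i = u $ i}"

lemma semialgebraic_cylinder:
  assumes X: "semialgebraic (X :: (real^'n) set)" shows "semialgebraic (cylinder I X)"
proof -
  have "semialgebraic {u. \<exists>z. z \<in> X \<and> (\<forall>i\<in>I. z $ i = u $ i)}"
    by (intro sa_ex sa_ball sa_intros sa_fun_base_intros sa_fun_component X) simp
  then show ?thesis unfolding cylinder_def Bex_def .
qed

text \<open>A continuous section s of the projection to the I-coordinates, restricted to a small
  cube in these coordinates, is a homeomorphism onto its image because the I-coordinates of s u are
  those of u.\<close>

lemma contains_cube_cylinder:
  fixes X :: "(real^'n) set"
  assumes X: "semialgebraic X" "closed X" and int: "interior (cylinder I X) \<noteq> {}"
  shows "contains_cube X (card I)"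
proof -
  obtain a r where ar: "r > 0" "ball a r \<subseteq> cylinder I X" using interior_nonemptyE[OF int] by metis
  define K :: "((real^'n) \<times> (real^'n)) set" where "K = {w. snd w \<in> X \<and> (\<forall>i\<in>I. snd w $ i = fst w $ i)}"
  have sK: "semialgebraic K" unfolding K_def
    by (intro sa_ball sa_intros sa_fun_base_intros sa_fun_component X) simp
  have cK: "closed K"
  proof -
    have "K = snd -` X \<inter> (\<Inter>i\<in>I. {w. snd w $ i = fst w $ i})" by (auto simp: K_def)
    moreover have "closed (snd -` X :: ((real^'n) \<times> (real^'n)) set)" by (rule closed_vimage_snd[OF X(2)])
    moreover have "closed {w :: (real^'n) \<times> (real^'n). snd w $ i = fst w $ i}" for i
      by (intro closed_Collect_eq continuous_intros)
    ultimately show ?thesis by (simp add: closed_INT closed_Int)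
  qed
  obtain b \<rho> s where s: "\<rho> > 0" "sa_fun s" "continuous_on (ball b \<rho>) s" "\<And>u. u \<in> ball b \<rho> \<Longrightarrow> (u, s u) \<in> K"
  proof (rule semialgebraic_section[OF sK cK ar(1), where a = a])
    show "\<exists>z. (u, z) \<in> K" if "u \<in> ball a r" for u
      using that ar(2) by (auto simp: K_def cylinder_def)
  qed blast
  \<comment> \<open>The norm of a point of the cube is at most the sum of its n coordinates, each in
    [0, 1], so this scale fits the cube into the ball.\<close>
  define \<sigma> where "\<sigma> = \<rho> / (real CARD('n) + 1)"
  have \<sigma>: "\<sigma> > 0" using s(1) by (simp add: \<sigma>_def)
  define B :: "(real^'n) set" where "B = (\<lambda>i. axis i 1) ` I"
  have cB: "card B = card I" unfolding B_def by (intro card_image) (auto simp: inj_on_def axis_eq_axis)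
  have B: "B \<subseteq> Basis" by (auto simp: B_def axis_in_Basis_iff)
  have axB: "axis i (1::real) \<in> B \<longleftrightarrow> i \<in> I" for i by (auto simp: B_def axis_eq_axis)
  have cube: "(i \<in> I \<longrightarrow> 0 < v $ i \<and> v $ i < 1) \<and> (i \<notin> I \<longrightarrow> v $ i = 0)" if "v \<in> open_cube B" for v i
  proof -
    have "axis i 1 \<in> (Basis :: (real^'n) set)" by (simp add: axis_in_Basis_iff)
    then have "if axis i 1 \<in> B then 0 < v \<bullet> axis i 1 \<and> v \<bullet> axis i 1 < 1 else v \<bullet> axis i 1 = 0"
      using that by (auto simp: open_cube_def)
    then show ?thesis by (auto simp: axB inner_axis)
  qed
  define \<phi> where "\<phi> = (\<lambda>v. b + \<sigma> *\<^sub>R v)"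
  have \<phi>: "\<phi> v \<in> ball b \<rho>" if "v \<in> open_cube B" for v
  proof -
    have "\<bar>v $ i\<bar> \<le> 1" for i using cube[OF that, of i] by (cases "i \<in> I") auto
    then have "(\<Sum>i\<in>UNIV. \<bar>v $ i\<bar>) \<le> (\<Sum>i\<in>(UNIV :: 'n set). 1)" by (intro sum_mono)
    then have "norm v \<le> real CARD('n)" using norm_le_l1_cart[of v] by simp
    then have "\<sigma> * norm v \<le> \<sigma> * real CARD('n)" using \<sigma> by (intro mult_left_mono) auto
    also have "\<dots> < \<sigma> * (real CARD('n) + 1)" using \<sigma> by simp
    also have "\<dots> = \<rho>" by (simp add: \<sigma>_def)
    finally show ?thesis using \<sigma> by (simp add: \<phi>_def dist_norm)
  qed
  define h where "h = (\<lambda>v. s (\<phi> v))"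
  define g where "g = (\<lambda>z::real^'n. \<chi> i. if i \<in> I then (z $ i - b $ i) / \<sigma> else 0)"
  have gh: "g (h v) = v" if v: "v \<in> open_cube B" for v
  proof -
    have "h v $ i = b $ i + \<sigma> * v $ i" if "i \<in> I" for i
      using s(4)[OF \<phi>[OF v]] that by (simp add: K_def h_def \<phi>_def)
    then show ?thesis using cube[OF v] \<sigma> by (simp add: g_def vec_eq_iff)
  qed
  have "homeomorphism (open_cube B) (h ` open_cube B) h g"
  proof (rule homeomorphismI)
    show "continuous_on (open_cube B) h" unfolding h_def
      by (rule continuous_on_compose2[OF s(3)]) (use \<phi> in \<open>auto simp: \<phi>_def intro!: continuous_intros\<close>)
    show "continuous_on (h ` open_cube B) g" unfolding g_def
    proof (rule continuous_on_vec_lambda)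
      fix i show "continuous_on (h ` open_cube B) (\<lambda>z. if i \<in> I then (z $ i - b $ i) / \<sigma> else 0)"
        using \<sigma> by (cases "i \<in> I") (auto intro!: continuous_intros)
    qed
  qed (use gh in auto)
  moreover have "h ` open_cube B \<subseteq> X" using s(4) \<phi> by (auto simp: K_def h_def)
  moreover have "semialgebraic_map (open_cube B) h"
  proof (rule sa_fun_imp_map[OF _ semialgebraic_open_cube])
    show "sa_fun h" unfolding h_def \<phi>_def by (intro sa_fun_comp[OF s(2)] sa_fun_base_intros)
  qed
  ultimately show ?thesis using B cB unfolding contains_cube_def by blast
qed

text \<open>Gaussian elimination with pivot m a0 j: the unknown a0 is eliminated from the other
  equations and recovered from equation j at the end.\<close>

lemma underdetermined_system:
  fixes m :: "'a \<Rightarrow> 'b \<Rightarrow> real"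
  assumes "finite J" "finite A" "card J < card A"
  shows "\<exists>w. (\<exists>a\<in>A. w a \<noteq> 0) \<and> (\<forall>j\<in>J. (\<Sum>a\<in>A. w a * m a j) = 0)"
  using assms
proof (induction J arbitrary: A m rule: finite_induct)
  case empty
  then have "A \<noteq> {}" by auto
  then show ?case by (intro exI[of _ "\<lambda>a. 1"]) auto
next
  case (insert j J)
  show ?case
  proof (cases "\<forall>a\<in>A. m a j = 0")
    case True
    have "card J < card A" using insert by simp
    from insert.IH[OF insert.prems(1) this, of m] show ?thesis using True by auto
  next
    case False
    then obtain a0 where a0: "a0 \<in> A" "m a0 j \<noteq> 0" by blast
    define A' where "A' = A - {a0}"
    have fA': "finite A'" using insert.prems by (simp add: A'_def)
    have "card A = Suc (card A')" unfolding A'_def using insert.prems a0 by (metis card.remove)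
    then have "card J < card A'" using insert by simp
    from insert.IH[OF fA' this, of "\<lambda>a i. m a i - m a j / m a0 j * m a0 i"]
    obtain w' where l: "\<exists>a\<in>A'. w' a \<noteq> 0" "\<And>i. i \<in> J \<Longrightarrow> (\<Sum>a\<in>A'. w' a * (m a i - m a j / m a0 j * m a0 i)) = 0"
      by blast
    define w where "w = w'(a0 := - (\<Sum>a\<in>A'. w' a * m a j) / m a0 j)"
    have sum: "(\<Sum>a\<in>A. w a * m a i) = w a0 * m a0 i + (\<Sum>a\<in>A'. w' a * m a i)" for i
    proof -
      have "(\<Sum>a\<in>A. w a * m a i) = w a0 * m a0 i + (\<Sum>a\<in>A'. w a * m a i)"
        unfolding A'_def by (rule sum.remove) (use insert.prems a0 in auto)
      also have "(\<Sum>a\<in>A'. w a * m a i) = (\<Sum>a\<in>A'. w' a * m a i)"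
        by (rule sum.cong) (auto simp: w_def A'_def)
      finally show ?thesis .
    qed
    have "(\<Sum>a\<in>A. w a * m a j) = 0" unfolding sum using a0 by (simp add: w_def)
    moreover have "(\<Sum>a\<in>A. w a * m a i) = 0" if "i \<in> J" for i
    proof -
      have "0 = (\<Sum>a\<in>A'. w' a * (m a i - m a j / m a0 j * m a0 i))" using l(2)[OF that] by simp
      also have "\<dots> = (\<Sum>a\<in>A'. w' a * m a i) - (\<Sum>a\<in>A'. w' a * m a j) / m a0 j * m a0 i"
        by (simp add: sum_subtractf algebra_simps sum_distrib_left sum_divide_distrib)
      also have "\<dots> = (\<Sum>a\<in>A. w a * m a i)" unfolding sum by (simp add: w_def)
      finally show ?thesis by simp
    qed
    moreover have "\<exists>a\<in>A. w a \<noteq> 0" using l(1) by (auto simp: w_def A'_def)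
    ultimately show ?thesis by auto
  qed
qed

section \<open>Monomials\<close>

definition xpow :: "('n::finite \<Rightarrow> nat) \<Rightarrow> real^'n \<Rightarrow> real" where
  "xpow \<alpha> x = (\<Prod>i\<in>UNIV. x $ i ^ \<alpha> i)"

lemma xpow_add: "xpow (\<lambda>i. \<alpha> i + \<beta> i) x = xpow \<alpha> x * xpow \<beta> x"
  by (simp add: xpow_def power_add prod.distrib)

lemma xpow_0: "xpow (\<lambda>i. 0) x = 1"
  by (simp add: xpow_def)

lemma xpow_single: "xpow (\<lambda>j. if j = i then 1 else 0) x = x $ i"
proof -
  have "xpow (\<lambda>j. if j = i then 1 else 0) x = (\<Prod>j\<in>UNIV. if i = j then x $ j else 1)"
    unfolding xpow_def by (intro prod.cong) auto
  then show ?thesis by simp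
qed

lemma real_polynomial_function_xpow: "real_polynomial_function (xpow \<alpha>)"
proof -
  have v: "real_polynomial_function (\<lambda>x::real^'a. x $ i)" for i
    by (intro rpf_linear bounded_linear_vec_nth)
  have "real_polynomial_function (\<lambda>x::real^'a. \<Prod>i\<in>I. x $ i ^ \<alpha> i)" if "finite I" for I
    using that by (induction I rule: finite_induct)
      (auto intro!: rpf_const rpf_mult real_polynomial_function_power v)
  then show ?thesis unfolding xpow_def by simp
qed

text \<open>Serves products and substitutions, where different terms may acquire the same
  exponent.\<close>

lemma xpow_regroup:
  assumes "finite S"
  shows "(\<Sum>\<alpha>\<in>S. c \<alpha> * xpow (r \<alpha>) x) = (\<Sum>\<beta>\<in>r ` S. (\<Sum>\<alpha>\<in>{\<alpha>\<in>S. r \<alpha> = \<beta>}. c \<alpha>) * xpow \<beta> x)"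
proof -
  have "(\<Sum>\<alpha>\<in>S. c \<alpha> * xpow (r \<alpha>) x) = (\<Sum>\<beta>\<in>r ` S. \<Sum>\<alpha>\<in>{\<alpha>\<in>S. r \<alpha> = \<beta>}. c \<alpha> * xpow (r \<alpha>) x)"
    using assms by (rule sum.image_gen)
  also have "\<dots> = (\<Sum>\<beta>\<in>r ` S. (\<Sum>\<alpha>\<in>{\<alpha>\<in>S. r \<alpha> = \<beta>}. c \<alpha>) * xpow \<beta> x)"
    by (intro sum.cong refl) (simp add: sum_distrib_right)
  finally show ?thesis .
qed

lemma real_polynomial_function_xpowE:
  fixes p :: "real^'n \<Rightarrow> real"
  assumes "real_polynomial_function p"
  obtains S c where "finite S" "\<And>x. p x = (\<Sum>\<alpha>\<in>S. c \<alpha> * xpow \<alpha> x)"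
proof -
  have "\<exists>S c. finite S \<and> (\<forall>x. p x = (\<Sum>\<alpha>\<in>S. c \<alpha> * xpow \<alpha> x))"
    using assms
  proof (induction rule: real_polynomial_function.induct)
    case (linear f)
    let ?d = "\<lambda>i j. if j = i then 1 else 0 :: nat"
    have "f x = (\<Sum>i\<in>UNIV. f (axis i 1) * xpow (?d i) x)" for x
    proof -
      have "f x = f (\<Sum>i\<in>UNIV. x $ i *\<^sub>R axis i 1)" by (simp add: basis_expansion flip: scalar_mult_eq_scaleR)
      also have "\<dots> = (\<Sum>i\<in>UNIV. x $ i * f (axis i 1))"
        using linear by (simp add: linear_sum bounded_linear.linear linear_cmul)
      finally show ?thesis by (simp add: xpow_single mult.commute)
    qed
    then show ?case unfolding xpow_regroup[OF finite_class.finite_UNIV] by (meson finite_imageI finite_class.finite_UNIV)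
  next
    case (const c)
    show ?case by (intro exI[of _ "{\<lambda>i. 0}"] exI[of _ "\<lambda>_. c"]) (simp add: xpow_0)
  next
    case (add f g)
    from add.IH(1) obtain S c where f: "finite S" "\<And>x. f x = (\<Sum>\<alpha>\<in>S. c \<alpha> * xpow \<alpha> x)" by blast
    from add.IH(2) obtain T d where g: "finite T" "\<And>x. g x = (\<Sum>\<alpha>\<in>T. d \<alpha> * xpow \<alpha> x)" by blast
    note * = f g
    have "f x + g x = (\<Sum>\<alpha>\<in>S \<union> T. ((if \<alpha> \<in> S then c \<alpha> else 0) + (if \<alpha> \<in> T then d \<alpha> else 0)) * xpow \<alpha> x)" for x
    proof -
      have "(\<Sum>\<alpha>\<in>S \<union> T. (if \<alpha> \<in> S then c \<alpha> else 0) * xpow \<alpha> x) = f x"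
        unfolding *(2) by (rule sum.mono_neutral_cong_right) (use * in auto)
      moreover have "(\<Sum>\<alpha>\<in>S \<union> T. (if \<alpha> \<in> T then d \<alpha> else 0) * xpow \<alpha> x) = g x"
        unfolding *(4) by (rule sum.mono_neutral_cong_right) (use * in auto)
      ultimately show ?thesis by (simp add: distrib_right sum.distrib)
    qed
    from finite_UnI[OF *(1,3)] this show ?case by (intro exI conjI allI)
  next
    case (mult f g)
    from mult.IH(1) obtain S c where f: "finite S" "\<And>x. f x = (\<Sum>\<alpha>\<in>S. c \<alpha> * xpow \<alpha> x)" by blast
    from mult.IH(2) obtain T d where g: "finite T" "\<And>x. g x = (\<Sum>\<alpha>\<in>T. d \<alpha> * xpow \<alpha> x)" by blast
    note * = f g
    let ?r = "\<lambda>z i. fst z i + snd z i :: nat"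
    have "f x * g x = (\<Sum>z\<in>S \<times> T. (c (fst z) * d (snd z)) * xpow (?r z) x)" for x
      unfolding * sum_product sum.cartesian_product xpow_add
      by (intro sum.cong) (auto simp: algebra_simps)
    note this[unfolded xpow_regroup[OF finite_cartesian_product[OF *(1,3)]]]
    from finite_imageI[OF finite_cartesian_product[OF *(1,3)]] this show ?case
      by (intro exI conjI allI)
  qed
  then show ?thesis using that by metis
qed

lemma cylinder_relation:
  fixes X :: "(real^'n) set"
  assumes X: "semialgebraic X" and int: "interior (cylinder I X) = {}"
  obtains S c where "finite S" "\<And>\<alpha> i. \<alpha> \<in> S \<Longrightarrow> i \<notin> I \<Longrightarrow> \<alpha> i = 0" "\<exists>\<alpha>\<in>S. c \<alpha> \<noteq> 0"
    "\<And>x. x \<in> X \<Longrightarrow> (\<Sum>\<alpha>\<in>S. c \<alpha> * xpow \<alpha> x) = 0"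
proof -
  obtain p z where p: "real_polynomial_function p" "p z \<noteq> 0" "cylinder I X \<subseteq> {x. p x = 0}"
    using semialgebraic_empty_interior[OF semialgebraic_cylinder[OF X] int] by metis
  obtain S c where S: "finite S" "\<And>x. p x = (\<Sum>\<alpha>\<in>S. c \<alpha> * xpow \<alpha> x)"
    using real_polynomial_function_xpowE[OF p(1)] by metis
  define m where "m = (\<lambda>x::real^'n. \<chi> i. if i \<in> I then x $ i else z $ i)"
  define r where "r = (\<lambda>(\<alpha>::'n \<Rightarrow> nat) i. if i \<in> I then \<alpha> i else 0)"
  define b where "b = (\<lambda>\<alpha>. c \<alpha> * (\<Prod>i\<in>- I. z $ i ^ \<alpha> i))"
  have mm: "xpow \<alpha> (m x) = (\<Prod>i\<in>- I. z $ i ^ \<alpha> i) * xpow (r \<alpha>) x" for \<alpha> x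
  proof -
    have "xpow \<alpha> (m x) = (\<Prod>i\<in>UNIV. (if i \<in> - I then z $ i ^ \<alpha> i else 1) * x $ i ^ r \<alpha> i)"
      unfolding xpow_def by (intro prod.cong) (auto simp: m_def r_def)
    also have "\<dots> = (\<Prod>i\<in>UNIV. (if i \<in> - I then z $ i ^ \<alpha> i else 1)) * xpow (r \<alpha>) x"
      by (simp add: prod.distrib xpow_def)
    also have "(\<Prod>i\<in>UNIV. (if i \<in> - I then z $ i ^ \<alpha> i else 1)) = (\<Prod>i\<in>- I. z $ i ^ \<alpha> i)"
      by (rule prod.mono_neutral_cong_right) auto
    finally show ?thesis .
  qed
  define d where "d = (\<lambda>\<beta>. \<Sum>\<alpha>\<in>{\<alpha>\<in>S. r \<alpha> = \<beta>}. b \<alpha>)"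
  have pm: "p (m x) = (\<Sum>\<beta>\<in>r ` S. d \<beta> * xpow \<beta> x)" for x
    unfolding S(2) mm d_def xpow_regroup[OF S(1), symmetric] b_def by (simp add: mult.assoc)
  show ?thesis
  proof (rule that[of "r ` S" d])
    show "finite (r ` S)" using S by simp
    show "\<alpha> i = 0" if "\<alpha> \<in> r ` S" "i \<notin> I" for \<alpha> i using that by (auto simp: r_def)
    have "m z = z" by (simp add: m_def vec_eq_iff)
    then have "(\<Sum>\<beta>\<in>r ` S. d \<beta> * xpow \<beta> z) \<noteq> 0" using p(2) pm[of z] by simp
    then show "\<exists>\<beta>\<in>r ` S. d \<beta> \<noteq> 0" by (metis (no_types, lifting) mult_zero_left sum.neutral)
    fix x assume "x \<in> X"
    then have "m x \<in> cylinder I X" unfolding cylinder_def by (auto simp: m_def)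
    then show "(\<Sum>\<beta>\<in>r ` S. d \<beta> * xpow \<beta> x) = 0" using p(3) pm by auto
  qed
qed

section \<open>Weights\<close>

lemma digits_unique:
  fixes a b :: "nat \<Rightarrow> nat"
  assumes "\<And>j. j < n \<Longrightarrow> a j < M" "\<And>j. j < n \<Longrightarrow> b j < M"
    and "(\<Sum>j<n. a j * M ^ j) = (\<Sum>j<n. b j * M ^ j)" and "j < n"
  shows "a j = b j"
  using assms
proof (induction n arbitrary: j)
  case (Suc n)
  have lt: "(\<Sum>j<m. a j * M ^ j) < M ^ m" if "\<And>j. j < m \<Longrightarrow> a j < M" for a :: "nat \<Rightarrow> nat" and m
    using that
  proof (induction m)
    case (Suc m)
    have "(\<Sum>j<Suc m. a j * M ^ j) < M ^ m + a m * M ^ m" using Suc by simp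
    also have "\<dots> = Suc (a m) * M ^ m" by simp
    also have "\<dots> \<le> M * M ^ m" using Suc.prems[of m] by (intro mult_right_mono) auto
    finally show ?case by simp
  qed simp
  let ?a = "\<Sum>j<n. a j * M ^ j" and ?b = "\<Sum>j<n. b j * M ^ j"
  have la: "?a < M ^ n" and lb: "?b < M ^ n" using lt Suc.prems by auto
  have "M \<noteq> 0" using Suc.prems(1)[of n] by simp
  have eq: "?a + a n * M ^ n = ?b + b n * M ^ n" using Suc.prems(3) by simp
  have "a n = (?a + a n * M ^ n) div M ^ n"
    using la \<open>M \<noteq> 0\<close> by (subst div_mult_self1) auto
  also have "\<dots> = b n" unfolding eq using lb \<open>M \<noteq> 0\<close> by (subst div_mult_self1) auto
  finally have n: "a n = b n" .
  then have "?a = ?b" using eq by simp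
  then show ?case using Suc.IH[of j] Suc.prems n by (cases "j = n") auto
qed simp

definition enum_idx :: "'n::finite \<Rightarrow> nat" where
  "enum_idx = (SOME e. bij_betw e UNIV {..<CARD('n)})"

lemma enum_idx: "bij_betw (enum_idx :: 'n::finite \<Rightarrow> nat) UNIV {..<CARD('n)}"
proof -
  have "\<exists>e. bij_betw e (UNIV :: 'n set) {..<CARD('n)}"
    using ex_bij_betw_finite_nat[of "UNIV :: 'n set"] by (simp add: atLeast0LessThan)
  then show ?thesis unfolding enum_idx_def by (rule someI_ex)
qed

text \<open>The number whose digits in base M are the exponents. It is additive, so it orders
  exponents like a monomial order, and it is injective on exponents below M.\<close>

definition weight :: "nat \<Rightarrow> ('n::finite \<Rightarrow> nat) \<Rightarrow> nat" where
  "weight M \<alpha> = (\<Sum>i\<in>UNIV. \<alpha> i * M ^ enum_idx i)"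

lemma weight_inj:
  fixes \<alpha> \<beta> :: "'n::finite \<Rightarrow> nat"
  assumes "\<And>i. \<alpha> i < M" "\<And>i. \<beta> i < M" "weight M \<alpha> = weight M \<beta>"
  shows "\<alpha> = \<beta>"
proof
  fix i :: 'n
  let ?g = "inv_into UNIV (enum_idx :: 'n \<Rightarrow> nat)"
  have inv: "?g (enum_idx j) = j" for j :: 'n
    by (rule bij_betw_inv_into_left[OF enum_idx]) simp
  have re: "weight M \<gamma> = (\<Sum>j<CARD('n). \<gamma> (?g j) * M ^ j)" for \<gamma> :: "'n \<Rightarrow> nat"
  proof -
    have "weight M \<gamma> = (\<Sum>i\<in>(UNIV :: 'n set). \<gamma> (?g (enum_idx i)) * M ^ enum_idx i)"
      unfolding weight_def using inv by simp
    also have "\<dots> = (\<Sum>j<CARD('n). \<gamma> (?g j) * M ^ j)"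
      by (rule sum.reindex_bij_betw[OF enum_idx])
    finally show ?thesis .
  qed
  have "\<alpha> (?g (enum_idx i)) = \<beta> (?g (enum_idx i))"
  proof (rule digits_unique[where n = "CARD('n)" and M = M and a = "\<lambda>j. \<alpha> (?g j)" and b = "\<lambda>j. \<beta> (?g j)"])
    show "enum_idx i < CARD('n)" using bij_betwE[OF enum_idx] by blast
    show "(\<Sum>j<CARD('n). \<alpha> (?g j) * M ^ j) = (\<Sum>j<CARD('n). \<beta> (?g j) * M ^ j)"
      using assms(3) unfolding re .
  qed (use assms in auto)
  then show "\<alpha> i = \<beta> i" by (simp add: inv)
qed

lemma weight_add: "weight M (\<lambda>i. \<alpha> i + \<beta> i) = weight M \<alpha> + weight M \<beta>"
  by (simp add: weight_def sum.distrib add_mult_distrib)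

lemma weight_mono: "(\<And>i. \<alpha> i \<le> \<beta> i) \<Longrightarrow> weight M \<alpha> \<le> weight M \<beta>"
  unfolding weight_def by (intro sum_mono mult_right_mono) auto

lemma le_weight: "M \<ge> 1 \<Longrightarrow> \<alpha> i \<le> weight M \<alpha>"
proof -
  assume "M \<ge> 1"
  then have "\<alpha> i \<le> \<alpha> i * M ^ enum_idx i" by simp
  also have "\<dots> \<le> weight M \<alpha>" unfolding weight_def by (rule member_le_sum) auto
  finally show ?thesis .
qed

text \<open>Kronecker substitution: on the curve \<open>s \<mapsto> (s ^ M ^ i)\<^sub>i\<close> distinct monomials with small
  exponents restrict to distinct powers of \<open>s\<close>.\<close>

lemma xpow_independent:
  fixes A :: "('n::finite \<Rightarrow> nat) set"
  assumes A: "finite A" and a: "\<alpha> \<in> A" "w \<alpha> \<noteq> 0"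
  shows "\<exists>u. (\<Sum>\<alpha>\<in>A. w \<alpha> * xpow \<alpha> u) \<noteq> 0"
proof (rule ccontr)
  assume neg: "\<not> (\<exists>u. (\<Sum>\<alpha>\<in>A. w \<alpha> * xpow \<alpha> u) \<noteq> 0)"
  define M where "M = Suc (Max ((\<lambda>(\<alpha>, i). \<alpha> i) ` (A \<times> UNIV)))"
  have M: "\<alpha> i < M" if "\<alpha> \<in> A" for \<alpha> i
    unfolding M_def less_Suc_eq_le by (rule Max_ge) (use A that in auto)
  define q where "q = (\<Sum>\<alpha>\<in>A. monom (w \<alpha>) (weight M \<alpha>))"
  have "poly q s = 0" for s
  proof -
    have "xpow \<alpha> (\<chi> i. s ^ (M ^ enum_idx i)) = s ^ weight M \<alpha>" for \<alpha> :: "'n \<Rightarrow> nat"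
      by (simp add: xpow_def weight_def power_sum mult.commute flip: power_mult)
    then have "(\<Sum>\<alpha>\<in>A. w \<alpha> * xpow \<alpha> (\<chi> i. s ^ (M ^ enum_idx i))) = poly q s"
      by (simp add: q_def poly_sum poly_monom)
    then show ?thesis using neg by metis
  qed
  then have "q = 0" using poly_all_0_iff_0 by blast
  have inj: "weight M \<beta> = weight M \<alpha> \<longleftrightarrow> \<beta> = \<alpha>" if "\<beta> \<in> A" for \<beta>
    using weight_inj[of \<beta> M \<alpha>] M[OF that] M[OF a(1)] by blast
  have "coeff q (weight M \<alpha>) = (\<Sum>\<beta>\<in>A. if \<beta> = \<alpha> then w \<beta> else 0)"
    unfolding q_def coeff_sum coeff_monom
    by (rule sum.cong) (simp_all add: inj)
  also have "\<dots> = w \<alpha>" using A a by simp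
  finally show False using \<open>q = 0\<close> a by simp
qed

section \<open>Polynomials on a set of secants\<close>

text \<open>The monomials that survive the division below. At most k exponents are large, so for
  fixed E their number grows like W^k.\<close>

definition standard :: "nat \<Rightarrow> nat \<Rightarrow> nat \<Rightarrow> nat \<Rightarrow> ('n::finite \<Rightarrow> nat) set" where
  "standard M E k W = {\<beta>. weight M \<beta> \<le> W \<and> card {i. \<beta> i \<ge> E} \<le> k}"

definition spanned :: "nat \<Rightarrow> nat \<Rightarrow> nat \<Rightarrow> nat \<Rightarrow> (real^'n) set \<Rightarrow> (real^'n \<Rightarrow> real) \<Rightarrow> bool" where
  "spanned M E k W X f \<longleftrightarrow> (\<exists>d. \<forall>x\<in>X. f x = (\<Sum>\<beta>\<in>standard M E k W. d \<beta> * xpow \<beta> x))"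

lemma finite_standard:
  assumes "M \<ge> 1" shows "finite (standard M E k W :: ('n::finite \<Rightarrow> nat) set)"
proof -
  have "standard M E k W \<subseteq> PiE UNIV (\<lambda>i::'n. {..W})"
    using le_weight[OF assms] by (auto simp: standard_def PiE_UNIV_domain intro: order.trans)
  moreover have "finite (PiE UNIV (\<lambda>i::'n. {..W}))" by (intro finite_PiE) auto
  ultimately show ?thesis by (rule finite_subset)
qed

lemma spanned_mono:
  assumes "M \<ge> 1" "spanned M E k W X f" "W \<le> W'"
  shows "spanned M E k W' X f"
proof -
  obtain d where d: "\<forall>x\<in>X. f x = (\<Sum>\<beta>\<in>standard M E k W. d \<beta> * xpow \<beta> x)"
    using assms(2) by (auto simp: spanned_def)
  have "standard M E k W \<subseteq> (standard M E k W' :: ('a \<Rightarrow> nat) set)"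
    using assms(3) by (auto simp: standard_def)
  then have "(\<Sum>\<beta>\<in>standard M E k W. d \<beta> * xpow \<beta> x) =
      (\<Sum>\<beta>\<in>standard M E k W'. (if \<beta> \<in> standard M E k W then d \<beta> else 0) * xpow \<beta> x)" for x
    by (intro sum.mono_neutral_cong_left finite_standard[OF assms(1)]) auto
  then show ?thesis unfolding spanned_def using d by (intro exI[of _ "\<lambda>\<beta>. if \<beta> \<in> standard M E k W then d \<beta> else 0"]) simp
qed

lemma spanned_sum:
  assumes "\<And>i. i \<in> I \<Longrightarrow> spanned M E k W X (f i)"
  shows "spanned M E k W X (\<lambda>x. \<Sum>i\<in>I. c i * f i x)"
proof -
  from assms obtain d where d: "\<And>i x. i \<in> I \<Longrightarrow> x \<in> X \<Longrightarrow> f i x = (\<Sum>\<beta>\<in>standard M E k W. d i \<beta> * xpow \<beta> x)"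
    unfolding spanned_def by metis
  have "(\<Sum>i\<in>I. c i * f i x) = (\<Sum>\<beta>\<in>standard M E k W. (\<Sum>i\<in>I. c i * d i \<beta>) * xpow \<beta> x)" if "x \<in> X" for x
  proof -
    have "(\<Sum>i\<in>I. c i * f i x) = (\<Sum>i\<in>I. \<Sum>\<beta>\<in>standard M E k W. c i * d i \<beta> * xpow \<beta> x)"
      by (intro sum.cong refl) (simp add: d that sum_distrib_left mult.assoc)
    also have "\<dots> = (\<Sum>\<beta>\<in>standard M E k W. \<Sum>i\<in>I. c i * d i \<beta> * xpow \<beta> x)" by (rule sum.swap)
    finally show ?thesis by (simp add: sum_distrib_right)
  qed
  then show ?thesis unfolding spanned_def by (intro exI ballI)
qed

lemma spanned_cong: "(\<And>x. x \<in> X \<Longrightarrow> f x = g x) \<Longrightarrow> spanned M E k W X f \<Longrightarrow> spanned M E k W X g"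
  by (auto simp: spanned_def)

text \<open>Division with remainder: a monomial with more than \<open>k\<close> large exponents is divisible by the
  leading monomial of one of the relations.\<close>

lemma xpow_spanned:
  fixes X :: "(real^'n) set"
  assumes M: "M \<ge> 1"
    and rel: "\<And>I. card I = Suc k \<Longrightarrow> finite (S I) \<and> (\<exists>\<alpha>\<in>S I. c I \<alpha> \<noteq> 0) \<and>
      (\<forall>\<alpha>\<in>S I. (\<forall>i. i \<notin> I \<longrightarrow> \<alpha> i = 0) \<and> (\<forall>i. \<alpha> i < M \<and> \<alpha> i < E)) \<and>
      (\<forall>x\<in>X. (\<Sum>\<alpha>\<in>S I. c I \<alpha> * xpow \<alpha> x) = 0)"
  shows "spanned M E k (weight M \<alpha>) X (xpow \<alpha>)"
proof (induction "weight M \<alpha>" arbitrary: \<alpha> rule: less_induct)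
  case less
  show ?case
  proof (cases "card {i. \<alpha> i \<ge> E} \<le> k")
    case True
    then have "\<alpha> \<in> standard M E k (weight M \<alpha>)" by (simp add: standard_def)
    then have "xpow \<alpha> x = (\<Sum>\<beta>\<in>standard M E k (weight M \<alpha>). (if \<beta> = \<alpha> then 1 else 0) * xpow \<beta> x)" for x
      by (simp add: finite_standard[OF M] if_distrib[of "\<lambda>t. t * _"] cong: if_cong)
    then show ?thesis unfolding spanned_def by (intro exI[of _ "\<lambda>\<beta>. if \<beta> = \<alpha> then 1 else 0"] ballI)
  next
    case False
    then have "Suc k \<le> card {i. \<alpha> i \<ge> E}" by simp
    then obtain I where I: "I \<subseteq> {i. \<alpha> i \<ge> E}" "card I = Suc k" by (metis obtain_subset_with_card_n)
    define T where "T = {\<beta>\<in>S I. c I \<beta> \<noteq> 0}"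
    have T: "finite T" "T \<noteq> {}" using rel[OF I(2)] by (auto simp: T_def)
    have TI: "\<beta> i = 0" if "\<beta> \<in> T" "i \<notin> I" for \<beta> i using rel[OF I(2)] that by (auto simp: T_def)
    have TE: "\<beta> i < M" "\<beta> i < E" if "\<beta> \<in> T" for \<beta> i using rel[OF I(2)] that by (auto simp: T_def)
    have rT: "(\<Sum>\<beta>\<in>T. c I \<beta> * xpow \<beta> x) = 0" if "x \<in> X" for x
    proof -
      have "(\<Sum>\<beta>\<in>T. c I \<beta> * xpow \<beta> x) = (\<Sum>\<beta>\<in>S I. c I \<beta> * xpow \<beta> x)"
        using rel[OF I(2)] by (intro sum.mono_neutral_left) (auto simp: T_def)
      then show ?thesis using rel[OF I(2)] that by simp
    qed
    \<comment> \<open>Weights separate the exponents in \<open>T\<close>, as these are below M, so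
      the relation has a unique leading monomial.\<close>
    define m where "m = Max (weight M ` T)"
    have "m \<in> weight M ` T" unfolding m_def using T by (intro Max_in) auto
    then obtain \<mu> where \<mu>: "\<mu> \<in> T" "weight M \<mu> = m" by blast
    have low: "weight M \<beta> < weight M \<mu>" if "\<beta> \<in> T - {\<mu>}" for \<beta>
    proof -
      have "weight M \<beta> \<le> weight M \<mu>" unfolding \<mu>(2) m_def using T that by (intro Max_ge) auto
      moreover have "weight M \<beta> \<noteq> weight M \<mu>"
        using weight_inj[of \<beta> M \<mu>] TE(1)[of \<beta>] TE(1)[OF \<mu>(1)] that by blast
      ultimately show ?thesis by simp
    qed
    \<comment> \<open>The exponents of \<open>\<mu>\<close> are below E on I and 0 elsewhere, while
      those of \<open>\<alpha>\<close> are at least E on I.\<close>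
    have le: "\<mu> i \<le> \<alpha> i" for i
    proof (cases "i \<in> I")
      case True
      then show ?thesis using I(1) TE(2)[OF \<mu>(1), of i] by force
    next
      case False then show ?thesis using TI[OF \<mu>(1)] by simp
    qed
    define \<delta> where "\<delta> = (\<lambda>i. \<alpha> i - \<mu> i)"
    have \<alpha>: "\<alpha> = (\<lambda>i. \<delta> i + \<mu> i)" using le by (simp add: \<delta>_def fun_eq_iff)
    have "xpow \<alpha> x = (\<Sum>\<beta>\<in>T - {\<mu>}. (- c I \<beta> / c I \<mu>) * xpow (\<lambda>i. \<delta> i + \<beta> i) x)" if "x \<in> X" for x
    proof -
      have cm: "c I \<mu> \<noteq> 0" using \<mu> by (simp add: T_def)
      have "c I \<mu> * xpow \<mu> x + (\<Sum>\<beta>\<in>T - {\<mu>}. c I \<beta> * xpow \<beta> x) = 0"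
        using rT[OF that] sum.remove[OF T(1) \<mu>(1), of "\<lambda>\<beta>. c I \<beta> * xpow \<beta> x"] by simp
      then have "xpow \<mu> x = - (\<Sum>\<beta>\<in>T - {\<mu>}. c I \<beta> * xpow \<beta> x) / c I \<mu>"
        using cm by (simp add: field_simps)
      also have "\<dots> = (\<Sum>\<beta>\<in>T - {\<mu>}. (- c I \<beta> / c I \<mu>) * xpow \<beta> x)"
        by (simp add: sum_divide_distrib sum_negf)
      finally have "xpow \<mu> x = (\<Sum>\<beta>\<in>T - {\<mu>}. (- c I \<beta> / c I \<mu>) * xpow \<beta> x)" .
      then have "xpow \<alpha> x = xpow \<delta> x * (\<Sum>\<beta>\<in>T - {\<mu>}. (- c I \<beta> / c I \<mu>) * xpow \<beta> x)"
        by (simp add: \<alpha> xpow_add)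
      then show ?thesis by (simp add: xpow_add sum_distrib_left algebra_simps)
    qed
    moreover have "spanned M E k (weight M \<alpha>) X (\<lambda>x. \<Sum>\<beta>\<in>T - {\<mu>}. (- c I \<beta> / c I \<mu>) * xpow (\<lambda>i. \<delta> i + \<beta> i) x)"
    proof (rule spanned_sum)
      fix \<beta> assume "\<beta> \<in> T - {\<mu>}"
      then have lt: "weight M (\<lambda>i. \<delta> i + \<beta> i) < weight M \<alpha>" using low by (simp add: weight_add \<alpha>)
      from spanned_mono[OF M less[OF this]] lt
      show "spanned M E k (weight M \<alpha>) X (\<lambda>x. xpow (\<lambda>i. \<delta> i + \<beta> i) x)" by simp
    qed
    ultimately show ?thesis using spanned_cong by (metis (no_types, lifting))
  qed
qed

lemma xpow_diff:
  "xpow \<alpha> (x - y) = (\<Sum>\<beta>\<in>PiE UNIV (\<lambda>i. {..\<alpha> i}).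
    (\<Prod>i\<in>UNIV. real (\<alpha> i choose \<beta> i) * (- 1) ^ (\<alpha> i - \<beta> i)) * (xpow \<beta> x * xpow (\<lambda>i. \<alpha> i - \<beta> i) y))"
proof -
  have "xpow \<alpha> (x - y) = (\<Prod>i\<in>UNIV. \<Sum>j\<in>{..\<alpha> i}. real (\<alpha> i choose j) * x $ i ^ j * (- y $ i) ^ (\<alpha> i - j))"
    unfolding xpow_def
  proof (rule prod.cong)
    fix i
    show "(x - y) $ i ^ \<alpha> i = (\<Sum>j\<in>{..\<alpha> i}. real (\<alpha> i choose j) * x $ i ^ j * (- y $ i) ^ (\<alpha> i - j))"
      using binomial_ring[of "x $ i" "- y $ i" "\<alpha> i"] by simp
  qed simp
  also have "\<dots> = (\<Sum>\<beta>\<in>PiE UNIV (\<lambda>i. {..\<alpha> i}). \<Prod>i\<in>UNIV. real (\<alpha> i choose \<beta> i) * x $ i ^ \<beta> i * (- y $ i) ^ (\<alpha> i - \<beta> i))"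
    by (rule prod_sum_PiE) auto
  also have "\<dots> = (\<Sum>\<beta>\<in>PiE UNIV (\<lambda>i. {..\<alpha> i}).
    (\<Prod>i\<in>UNIV. real (\<alpha> i choose \<beta> i) * (- 1) ^ (\<alpha> i - \<beta> i)) * (xpow \<beta> x * xpow (\<lambda>i. \<alpha> i - \<beta> i) y))"
  proof (rule sum.cong[OF refl])
    fix \<beta>
    have "(- y $ i) ^ m = (- 1) ^ m * y $ i ^ m" for i m
      by (metis mult_minus1 power_mult_distrib)
    then show "(\<Prod>i\<in>UNIV. real (\<alpha> i choose \<beta> i) * x $ i ^ \<beta> i * (- y $ i) ^ (\<alpha> i - \<beta> i)) =
      (\<Prod>i\<in>UNIV. real (\<alpha> i choose \<beta> i) * (- 1) ^ (\<alpha> i - \<beta> i)) * (xpow \<beta> x * xpow (\<lambda>i. \<alpha> i - \<beta> i) y)"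
      unfolding xpow_def by (simp add: mult_ac flip: prod.distrib)
  qed
  finally show ?thesis .
qed

lemma xpow_scaleR: "xpow \<alpha> (t *\<^sub>R x) = t ^ sum \<alpha> UNIV * xpow \<alpha> x"
  by (simp add: xpow_def power_mult_distrib prod.distrib power_sum)

text \<open>In the binomial expansion neither factor of a term has larger weight than
  \<open>\<alpha>\<close>, so both reduce to standard monomials within the same bound W.\<close>

lemma xpow_diff_bispanned:
  fixes X :: "(real^'n) set"
  assumes M: "M \<ge> 1" and sp: "\<And>\<alpha>. spanned M E k (weight M \<alpha>) X (xpow \<alpha>)" and W: "weight M \<alpha> \<le> W"
  shows "\<exists>d. \<forall>x\<in>X. \<forall>y\<in>X. xpow \<alpha> (x - y) =
    (\<Sum>p\<in>standard M E k W \<times> standard M E k W. d p * (xpow (fst p) x * xpow (snd p) y))"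
proof -
  let ?P = "PiE UNIV (\<lambda>i. {..\<alpha> i})"
  let ?c = "\<lambda>\<beta>. (\<Prod>i\<in>UNIV. real (\<alpha> i choose \<beta> i) * (- 1) ^ (\<alpha> i - \<beta> i))"
  have s: "spanned M E k W X (xpow \<beta>)" if "\<And>i. \<beta> i \<le> \<alpha> i" for \<beta>
    using spanned_mono[OF M sp[of \<beta>], of W] weight_mono[of \<beta> \<alpha> M] that W by simp
  have "\<forall>\<beta>. \<exists>d. (\<forall>i. \<beta> i \<le> \<alpha> i) \<longrightarrow> (\<forall>x\<in>X. xpow \<beta> x = (\<Sum>\<gamma>\<in>standard M E k W. d \<gamma> * xpow \<gamma> x))"
    using s unfolding spanned_def by meson
  from choice[OF this] obtain d where d: "\<And>\<beta> x. (\<And>i. \<beta> i \<le> \<alpha> i) \<Longrightarrow> x \<in> X \<Longrightarrow>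
      xpow \<beta> x = (\<Sum>\<gamma>\<in>standard M E k W. d \<beta> \<gamma> * xpow \<gamma> x)" by blast
  let ?St = "standard M E k W :: ('n \<Rightarrow> nat) set"
  have "xpow \<alpha> (x - y) = (\<Sum>p\<in>?St \<times> ?St. (\<Sum>\<beta>\<in>?P. ?c \<beta> * (d \<beta> (fst p) * d (\<lambda>i. \<alpha> i - \<beta> i) (snd p))) * (xpow (fst p) x * xpow (snd p) y))"
    if xy: "x \<in> X" "y \<in> X" for x y
  proof -
    have "xpow \<alpha> (x - y) = (\<Sum>\<beta>\<in>?P. \<Sum>p\<in>?St \<times> ?St. ?c \<beta> * (d \<beta> (fst p) * d (\<lambda>i. \<alpha> i - \<beta> i) (snd p)) * (xpow (fst p) x * xpow (snd p) y))"
      unfolding xpow_diff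
    proof (rule sum.cong[OF refl])
      fix \<beta> assume "\<beta> \<in> ?P"
      then have le: "\<And>i. \<beta> i \<le> \<alpha> i" by (auto simp: PiE_UNIV_domain)
      have 1: "xpow \<beta> x = (\<Sum>\<gamma>\<in>?St. d \<beta> \<gamma> * xpow \<gamma> x)"
        using d[of \<beta> x] le xy(1) by blast
      have 2: "xpow (\<lambda>i. \<alpha> i - \<beta> i) y = (\<Sum>\<gamma>\<in>?St. d (\<lambda>i. \<alpha> i - \<beta> i) \<gamma> * xpow \<gamma> y)"
        using d[of "\<lambda>i. \<alpha> i - \<beta> i" y] xy(2) by simp
      have "xpow \<beta> x * xpow (\<lambda>i. \<alpha> i - \<beta> i) y =
        (\<Sum>p\<in>?St \<times> ?St. (d \<beta> (fst p) * xpow (fst p) x) * (d (\<lambda>i. \<alpha> i - \<beta> i) (snd p) * xpow (snd p) y))"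
        unfolding 1 2 by (simp add: sum_product sum.cartesian_product case_prod_unfold)
      then show "?c \<beta> * (xpow \<beta> x * xpow (\<lambda>i. \<alpha> i - \<beta> i) y) =
        (\<Sum>p\<in>?St \<times> ?St. ?c \<beta> * (d \<beta> (fst p) * d (\<lambda>i. \<alpha> i - \<beta> i) (snd p)) * (xpow (fst p) x * xpow (snd p) y))"
        by (simp only: sum_distrib_left) (intro sum.cong refl, simp add: mult_ac)
    qed
    also have "\<dots> = (\<Sum>p\<in>?St \<times> ?St. \<Sum>\<beta>\<in>?P. ?c \<beta> * (d \<beta> (fst p) * d (\<lambda>i. \<alpha> i - \<beta> i) (snd p)) * (xpow (fst p) x * xpow (snd p) y))"
      by (rule sum.swap)
    finally show ?thesis by (simp only: sum_distrib_right)
  qed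
  then show ?thesis by (intro exI[of _ "\<lambda>p. \<Sum>\<beta>\<in>?P. ?c \<beta> * (d \<beta> (fst p) * d (\<lambda>i. \<alpha> i - \<beta> i) (snd p))"]) blast
qed

text \<open>There are at most 2^n choices for the set of large exponents; each of its at most k
  members has at most W + 1 values and every other exponent has at most E.\<close>

lemma card_standard:
  assumes M: "M \<ge> 1" and E: "E \<ge> 1"
  shows "card (standard M E k W :: ('n::finite \<Rightarrow> nat) set) \<le> 2 ^ CARD('n) * (E ^ CARD('n) * (W + 1) ^ k)"
proof -
  define B where "B = (\<lambda>J::'n set. PiE UNIV (\<lambda>i. if i \<in> J then {..W} else {..<E}))"
  let ?Js = "{J::'n set. card J \<le> k}"
  have "standard M E k W \<subseteq> (\<Union>J\<in>?Js. B J)"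
  proof
    fix \<beta> :: "'n \<Rightarrow> nat" assume b: "\<beta> \<in> standard M E k W"
    have "\<beta> i \<le> W" for i using b le_weight[OF M, of \<beta> i] by (simp add: standard_def)
    then have "\<beta> \<in> B {i. \<beta> i \<ge> E}" by (auto simp: B_def PiE_UNIV_domain)
    then show "\<beta> \<in> (\<Union>J\<in>?Js. B J)" using b by (auto simp: standard_def)
  qed
  moreover have "finite (\<Union>J\<in>?Js. B J)" by (auto simp: B_def intro!: finite_PiE)
  ultimately have "card (standard M E k W :: ('n \<Rightarrow> nat) set) \<le> card (\<Union>J\<in>?Js. B J)" by (rule card_mono[rotated])
  also have "\<dots> \<le> (\<Sum>J\<in>?Js. card (B J))" by (rule card_UN_le) simp
  also have "\<dots> \<le> (\<Sum>J\<in>?Js. E ^ CARD('n) * (W + 1) ^ k)"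
  proof (rule sum_mono)
    fix J assume J: "J \<in> ?Js"
    have w: "W + 1 \<le> E * (W + 1)" using E mult_le_mono1[of 1 E "W + 1"] by simp
    have "card (B J) = (\<Prod>i\<in>UNIV. if i \<in> J then W + 1 else E)"
      unfolding B_def by (subst card_PiE) (auto intro: prod.cong)
    also have "\<dots> \<le> (\<Prod>i\<in>UNIV. E * (if i \<in> J then W + 1 else 1))"
      using E w by (intro prod_mono) auto
    also have "\<dots> = E ^ CARD('n) * (W + 1) ^ card J"
      by (simp add: prod.distrib prod.If_cases)
    also have "\<dots> \<le> E ^ CARD('n) * (W + 1) ^ k"
      using J by (intro mult_left_mono power_increasing) auto
    finally show "card (B J) \<le> E ^ CARD('n) * (W + 1) ^ k" .
  qed
  also have "\<dots> = card ?Js * (E ^ CARD('n) * (W + 1) ^ k)" by simp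
  also have "\<dots> \<le> 2 ^ CARD('n) * (E ^ CARD('n) * (W + 1) ^ k)"
  proof (rule mult_right_mono)
    have "card ?Js \<le> card (Pow (UNIV :: 'n set))" by (rule card_mono) auto
    then show "card ?Js \<le> 2 ^ CARD('n)" by (simp add: card_Pow)
  qed simp
  finally show ?thesis .
qed

text \<open>Polynomials of degree at most \<open>q\<close> in each of the \<open>n\<close> coordinates of \<open>t(x - y)\<close> form a space of
  dimension \<open>(q + 1) ^ n\<close>, but restricted to \<open>X\<close> they lie in a space of dimension \<open>O(q ^ (2 k + 1))\<close>.\<close>

lemma secant_polynomial:
  fixes X :: "(real^'n) set"
  assumes rel: "\<And>I. card I = Suc k \<Longrightarrow> \<exists>S c. finite S \<and> (\<forall>\<alpha>\<in>S. \<forall>i. i \<notin> I \<longrightarrow> \<alpha> i = 0) \<and>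
      (\<exists>\<alpha>\<in>S. c \<alpha> \<noteq> 0) \<and> (\<forall>x\<in>X. (\<Sum>\<alpha>\<in>S. c \<alpha> * xpow \<alpha> x) = 0)"
    and n: "2 * k + 2 \<le> CARD('n)"
  obtains Q u where "real_polynomial_function Q" "Q u \<noteq> 0"
    "\<And>x y t. x \<in> X \<Longrightarrow> y \<in> X \<Longrightarrow> Q (t *\<^sub>R (x - y)) = 0"
proof -
  let ?Is = "{I :: 'n set. card I = Suc k}"
  define R where "R = (\<lambda>(I::'n set) S c. finite S \<and> (\<forall>\<alpha>\<in>S. \<forall>i. i \<notin> I \<longrightarrow> \<alpha> i = 0) \<and>
      (\<exists>\<alpha>\<in>S. c \<alpha> \<noteq> (0::real)) \<and> (\<forall>x\<in>X. (\<Sum>\<alpha>\<in>S. c \<alpha> * xpow \<alpha> x) = 0))"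
  have "\<exists>S c. R I S c" if "card I = Suc k" for I unfolding R_def by (rule rel[OF that])
  then obtain S c where SR: "\<And>I. card I = Suc k \<Longrightarrow> R I (S I) (c I)" by metis
  note Sc = SR[unfolded R_def]
  \<comment> \<open>A crude strict bound on all exponents in the chosen relations. It serves both as
    the base of the weight and as the threshold for large exponents.\<close>
  define E where "E = Suc (\<Sum>I\<in>?Is. \<Sum>\<alpha>\<in>S I. \<Sum>i\<in>UNIV. \<alpha> i)"
  have E: "\<alpha> i < E" if "card I = Suc k" "\<alpha> \<in> S I" for I \<alpha> i
  proof -
    have "\<alpha> i \<le> (\<Sum>i\<in>UNIV. \<alpha> i)" by (rule member_le_sum) auto
    also have "\<dots> \<le> (\<Sum>\<alpha>\<in>S I. \<Sum>i\<in>UNIV. \<alpha> i)" using Sc that by (intro member_le_sum) auto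
    also have "\<dots> \<le> (\<Sum>I\<in>?Is. \<Sum>\<alpha>\<in>S I. \<Sum>i\<in>UNIV. \<alpha> i)"
      using that by (intro member_le_sum[where f = "\<lambda>I. \<Sum>\<alpha>\<in>S I. \<Sum>i\<in>UNIV. \<alpha> i"]) auto
    finally show ?thesis by (simp add: E_def)
  qed
  have E1: "E \<ge> 1" by (simp add: E_def)
  have sp: "spanned E E k (weight E \<alpha>) X (xpow \<alpha>)" for \<alpha>
    by (rule xpow_spanned[OF E1, where S = S and c = c]) (use Sc E in simp)
  define w0 where "w0 = weight E (\<lambda>_::'n. 1)"
  have w0: "w0 \<ge> 1" using le_weight[OF E1, of "\<lambda>_::'n. 1"] by (simp add: w0_def)
  define C where "C = 2 ^ CARD('n) * (E ^ CARD('n) * w0 ^ k)"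
  \<comment> \<open>The number of equations is at most n (q + 1) (C (q + 1)^k)^2 = n C^2 (q + 1)^(2
    k + 1). With this q it is less than (q + 1)^(2 k + 2), hence less than the number (q + 1)^n of
    unknowns.\<close>
  define q where "q = CARD('n) * C\<^sup>2"
  define W where "W = q * w0"
  let ?St = "standard E E k W :: ('n \<Rightarrow> nat) set"
  have cSt: "card ?St \<le> C * (q + 1) ^ k"
  proof -
    have "W + 1 \<le> w0 * (q + 1)" using w0 by (simp add: W_def mult.commute)
    then have "(W + 1) ^ k \<le> (w0 * (q + 1)) ^ k" by (rule power_mono) simp
    then have "2 ^ CARD('n) * (E ^ CARD('n) * (W + 1) ^ k) \<le> 2 ^ CARD('n) * (E ^ CARD('n) * (w0 * (q + 1)) ^ k)"
      by (intro mult_left_mono) auto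
    also have "\<dots> = C * (q + 1) ^ k" unfolding C_def power_mult_distrib by (simp only: mult.assoc)
    finally show ?thesis using card_standard[OF E1 E1, of k W] by (meson order.trans)
  qed
  define A where "A = PiE (UNIV :: 'n set) (\<lambda>_. {..q})"
  have fA: "finite A" unfolding A_def by (intro finite_PiE) auto
  have Aq: "\<alpha> i \<le> q" if "\<alpha> \<in> A" for \<alpha> i using that by (auto simp: A_def PiE_UNIV_domain)
  have cA: "card A = (q + 1) ^ CARD('n)" unfolding A_def by (subst card_PiE) auto
  \<comment> \<open>One equation for every product of a power of t with a standard monomial in x and
    a standard monomial in y.\<close>
  define J where "J = {..CARD('n) * q} \<times> (?St \<times> ?St)"
  have fJ: "finite J" unfolding J_def by (intro finite_cartesian_product finite_standard[OF E1] finite_atMost)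
  have "card J = (CARD('n) * q + 1) * (card ?St * card ?St)"
    unfolding J_def by (simp add: card_cartesian_product)
  also have "\<dots> \<le> (CARD('n) * (q + 1)) * ((C * (q + 1) ^ k) * (C * (q + 1) ^ k))"
    using cSt by (intro mult_mono) auto
  also have "\<dots> = q * (q + 1) ^ (2 * k + 1)"
  proof -
    have "(N * r) * ((C * r ^ k) * (C * r ^ k)) = N * C\<^sup>2 * r ^ (2 * k + 1)" for N r :: nat
    proof -
      have "r ^ (2 * k + 1) = r * (r ^ k * r ^ k)" by (simp add: mult_2 power_add)
      then show ?thesis by (simp only: power2_eq_square mult_ac)
    qed
    then show ?thesis unfolding q_def by blast
  qed
  also have "\<dots> < (q + 1) * (q + 1) ^ (2 * k + 1)" by (intro mult_strict_right_mono) auto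
  also have "\<dots> = (q + 1) ^ (2 * k + 2)" by simp
  also have "\<dots> \<le> card A" unfolding cA using n by (intro power_increasing) auto
  finally have cJA: "card J < card A" .
  have "\<forall>\<alpha>\<in>A. \<exists>d. \<forall>x\<in>X. \<forall>y\<in>X. xpow \<alpha> (x - y) = (\<Sum>p\<in>?St \<times> ?St. d p * (xpow (fst p) x * xpow (snd p) y))"
  proof
    fix \<alpha> assume a: "\<alpha> \<in> A"
    have "weight E \<alpha> \<le> (\<Sum>i\<in>(UNIV :: 'n set). q * E ^ enum_idx i)"
      unfolding weight_def by (intro sum_mono mult_right_mono) (simp_all add: Aq[OF a])
    also have "\<dots> = W" by (simp add: W_def w0_def weight_def sum_distrib_left)
    finally show "\<exists>d. \<forall>x\<in>X. \<forall>y\<in>X. xpow \<alpha> (x - y) = (\<Sum>p\<in>?St \<times> ?St. d p * (xpow (fst p) x * xpow (snd p) y))"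
      by (rule xpow_diff_bispanned[OF E1 sp])
  qed
  from bchoice[OF this] obtain d where d: "\<And>\<alpha> x y. \<alpha> \<in> A \<Longrightarrow> x \<in> X \<Longrightarrow> y \<in> X \<Longrightarrow>
      xpow \<alpha> (x - y) = (\<Sum>p\<in>?St \<times> ?St. d \<alpha> p * (xpow (fst p) x * xpow (snd p) y))" by blast
  \<comment> \<open>A monomial of total degree j, evaluated at t(x - y), involves the power t^j
    only.\<close>
  define m where "m = (\<lambda>\<alpha> z. if sum \<alpha> UNIV = fst z then d \<alpha> (snd z) else 0)"
  obtain w where w: "\<exists>\<alpha>\<in>A. w \<alpha> \<noteq> 0" "\<And>z. z \<in> J \<Longrightarrow> (\<Sum>\<alpha>\<in>A. w \<alpha> * m \<alpha> z) = 0"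
    using underdetermined_system[OF fJ fA cJA, of m] by blast
  define Q where "Q = (\<lambda>u. \<Sum>\<alpha>\<in>A. w \<alpha> * xpow \<alpha> u)"
  have "real_polynomial_function Q" unfolding Q_def
    by (intro real_polynomial_function_sum fA rpf_mult rpf_const real_polynomial_function_xpow)
  moreover obtain u where "Q u \<noteq> 0" using w(1) xpow_independent[OF fA] unfolding Q_def by blast
  moreover have "Q (t *\<^sub>R (x - y)) = 0" if xy: "x \<in> X" "y \<in> X" for x y t
  proof -
    let ?F = "\<lambda>z. t ^ fst z * (xpow (fst (snd z)) x * xpow (snd (snd z)) y)"
    have "w \<alpha> * xpow \<alpha> (t *\<^sub>R (x - y)) = (\<Sum>z\<in>J. w \<alpha> * m \<alpha> z * ?F z)" if a: "\<alpha> \<in> A" for \<alpha>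
    proof -
      let ?s = "sum \<alpha> UNIV"
      have "?s \<le> (\<Sum>i\<in>(UNIV :: 'n set). q)" by (intro sum_mono) (simp add: Aq[OF a])
      then have s: "?s \<in> {..CARD('n) * q}" by simp
      have "(\<Sum>z\<in>J. w \<alpha> * m \<alpha> z * ?F z) =
        (\<Sum>j\<in>{..CARD('n) * q}. \<Sum>p\<in>?St \<times> ?St. w \<alpha> * m \<alpha> (j, p) * ?F (j, p))"
        unfolding J_def by (simp add: sum.cartesian_product case_prod_unfold)
      also have "\<dots> = (\<Sum>j\<in>{..CARD('n) * q}. if j = ?s then (\<Sum>p\<in>?St \<times> ?St. w \<alpha> * d \<alpha> p * ?F (?s, p)) else 0)"
        by (intro sum.cong refl) (auto simp: m_def)
      also have "\<dots> = (\<Sum>p\<in>?St \<times> ?St. w \<alpha> * d \<alpha> p * ?F (?s, p))"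
        using s by (simp add: sum.delta)
      also have "\<dots> = w \<alpha> * (t ^ ?s * (\<Sum>p\<in>?St \<times> ?St. d \<alpha> p * (xpow (fst p) x * xpow (snd p) y)))"
        unfolding sum_distrib_left by (intro sum.cong refl) (simp add: mult_ac)
      also have "\<dots> = w \<alpha> * xpow \<alpha> (t *\<^sub>R (x - y))" by (simp add: xpow_scaleR d[OF a xy])
      finally show ?thesis by simp
    qed
    then have "Q (t *\<^sub>R (x - y)) = (\<Sum>\<alpha>\<in>A. \<Sum>z\<in>J. w \<alpha> * m \<alpha> z * ?F z)" unfolding Q_def by (intro sum.cong refl)
    also have "\<dots> = (\<Sum>z\<in>J. (\<Sum>\<alpha>\<in>A. w \<alpha> * m \<alpha> z) * ?F z)"
      by (subst sum.swap) (simp only: sum_distrib_right)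
    also have "\<dots> = 0" using w(2) by simp
    finally show ?thesis .
  qed
  ultimately show ?thesis using that by blast
qed

section \<open>Directions transversal to all secants\<close>

definition embeds :: "'a::euclidean_space set \<Rightarrow> ('a \<Rightarrow> 'b::euclidean_space) \<Rightarrow> bool" where
  "embeds X g \<longleftrightarrow> sa_fun g \<and> (\<exists>L. L-lipschitz_on X g) \<and>
     (\<exists>c>0. \<forall>x\<in>X. \<forall>y\<in>X. c * norm (x - y) \<le> norm (g x - g y))"

text \<open>The distance of g x - g y from the line through v is compared with x - y rather than
  with g x - g y. This makes the condition stable under perturbations of \<open>g\<close> with a
  small Lipschitz constant.\<close>

definition transversal :: "'a::euclidean_space set \<Rightarrow> ('a \<Rightarrow> 'b::euclidean_space) \<Rightarrow> 'b \<Rightarrow> bool" where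
  "transversal X g v \<longleftrightarrow> (\<exists>c>0. \<forall>x\<in>X. \<forall>y\<in>X. \<forall>s. c * norm (x - y) \<le> norm (g x - g y - s *\<^sub>R v))"

lemma embeds_homeomorphism:
  assumes g: "embeds X g" and X: "closed X"
  shows "homeomorphism X (g ` X) g (inv_into X g)" and "closed (g ` X)"
proof -
  obtain L where L: "L-lipschitz_on X g" using g by (auto simp: embeds_def)
  obtain c where c: "c > 0" "\<And>x y. x \<in> X \<Longrightarrow> y \<in> X \<Longrightarrow> c * norm (x - y) \<le> norm (g x - g y)"
    using g by (auto simp: embeds_def)
  have inj: "inj_on g X"
  proof (rule inj_onI)
    fix x y assume "x \<in> X" "y \<in> X" "g x = g y"
    then have "c * norm (x - y) \<le> 0" using c(2)[of x y] by simp
    then show "x = y" using c(1) by (simp add: mult_le_0_iff)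
  qed
  have "(1 / c)-lipschitz_on (g ` X) (inv_into X g)"
  proof (rule lipschitz_onI)
    fix a b assume "a \<in> g ` X" "b \<in> g ` X"
    then obtain x y where "x \<in> X" "y \<in> X" "a = g x" "b = g y" by blast
    then show "dist (inv_into X g a) (inv_into X g b) \<le> 1 / c * dist a b"
      using c(2)[of x y] c(1) inj by (simp add: dist_norm field_simps)
  qed (use c in simp)
  then have ci: "continuous_on (g ` X) (inv_into X g)" by (rule lipschitz_on_continuous_on)
  have cg: "continuous_on X g" using L by (rule lipschitz_on_continuous_on)
  show "homeomorphism X (g ` X) g (inv_into X g)"
    by (rule homeomorphismI[OF cg ci]) (use inj in \<open>auto simp: inv_into_into f_inv_into_f\<close>)
  show "closed (g ` X)"
    unfolding closed_sequential_limits
  proof (intro allI impI, elim conjE)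
    fix y l assume y: "\<forall>n. y n \<in> g ` X" and l: "y \<longlonglongrightarrow> l"
    define x where "x = (\<lambda>n. inv_into X g (y n))"
    have x: "x n \<in> X" "g (x n) = y n" for n using y by (auto simp: x_def inv_into_into f_inv_into_f)
    have "Cauchy x"
    proof (rule metric_CauchyI)
      fix e :: real assume "e > 0"
      then have "c * e > 0" using c by simp
      moreover have "Cauchy y" using l by (rule LIMSEQ_imp_Cauchy)
      ultimately obtain M where M: "\<And>m n. m \<ge> M \<Longrightarrow> n \<ge> M \<Longrightarrow> dist (y m) (y n) < c * e"
        using metric_CauchyD by blast
      have "dist (x m) (x n) < e" if "m \<ge> M" "n \<ge> M" for m n
      proof -
        have "c * dist (x m) (x n) < c * e"
          using c(2)[OF x(1) x(1), of m n] M[OF that] by (simp add: x dist_norm)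
        then show ?thesis using c(1) by simp
      qed
      then show "\<exists>M. \<forall>m\<ge>M. \<forall>n\<ge>M. dist (x m) (x n) < e" by blast
    qed
    then obtain z where z: "x \<longlonglongrightarrow> z" by (auto simp: Cauchy_convergent_iff convergent_def)
    then have zX: "z \<in> X" using closed_sequentially[OF X, of x] x by blast
    have "(\<lambda>n. g (x n)) \<longlonglongrightarrow> g z"
      using continuous_on_tendsto_compose[OF cg z zX] x by simp
    then have "l = g z" unfolding x(2) using l LIMSEQ_unique by blast
    then show "l \<in> g ` X" using zX by blast
  qed
qed

lemma transversal_dense:
  fixes X :: "(real^'n) set" and g :: "real^'n \<Rightarrow> real^'n"
  assumes X: "closed X" "semialgebraic X" "X \<noteq> {}" and dim: "semialgebraic_dim X = int k"
    and n: "2 * k + 2 \<le> CARD('n)" and g: "embeds X g" and e: "e > 0"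
  obtains v where "norm (v - v0) < e" "v \<noteq> 0" "transversal X g v"
proof -
  have sg: "sa_fun g" using g by (simp add: embeds_def)
  have sY: "semialgebraic (g ` X)"
  proof -
    have "semialgebraic {y. \<exists>x. x \<in> X \<and> y = g x}"
      by (intro sa_ex sa_intros sa_fun_base_intros sa_fun_comp[OF sg] X)
    moreover have "{y. \<exists>x. x \<in> X \<and> y = g x} = g ` X" by blast
    ultimately show ?thesis by simp
  qed
  have int: "interior (cylinder I (g ` X)) = {}" if I: "card I = Suc k" for I
  proof (rule ccontr)
    assume "interior (cylinder I (g ` X)) \<noteq> {}"
    from contains_cube_cylinder[OF sY embeds_homeomorphism(2)[OF g X(1)] this]
    have "contains_cube (g ` X) (Suc k)" using I by simp
    from contains_cube_embedding[OF this X(2) sg embeds_homeomorphism(1)[OF g X(1)]]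
    have "int (Suc k) \<le> semialgebraic_dim X" by (rule contains_cube_dim)
    then show False using dim by simp
  qed
  obtain Q u where Q: "real_polynomial_function Q" "Q u \<noteq> 0"
    "\<And>x y t. x \<in> g ` X \<Longrightarrow> y \<in> g ` X \<Longrightarrow> Q (t *\<^sub>R (x - y)) = 0"
  proof (rule secant_polynomial[OF _ n, where X = "g ` X"])
    fix I :: "'n set" assume I: "card I = Suc k"
    obtain S c where
      "finite S" "\<And>\<alpha> i. \<alpha> \<in> S \<Longrightarrow> i \<notin> I \<Longrightarrow> \<alpha> i = 0" "\<exists>\<alpha>\<in>S. c \<alpha> \<noteq> 0"
      "\<And>x. x \<in> g ` X \<Longrightarrow> (\<Sum>\<alpha>\<in>S. c \<alpha> * xpow \<alpha> x) = 0"
      by (rule cylinder_relation[OF sY int[OF I]]) (rule that)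
    then show "\<exists>S c. finite S \<and> (\<forall>\<alpha>\<in>S. \<forall>i. i \<notin> I \<longrightarrow> \<alpha> i = 0) \<and> (\<exists>\<alpha>\<in>S. c \<alpha> \<noteq> 0) \<and>
      (\<forall>x\<in>g ` X. (\<Sum>\<alpha>\<in>S. c \<alpha> * xpow \<alpha> x) = 0)" by (intro exI[of _ S] exI[of _ c]) auto
  qed blast
  have "\<not> ball v0 e \<subseteq> {x. Q x = 0}"
    using real_polynomial_zero_on_ball[OF Q(1) e, of v0 u] Q(2) by blast
  then obtain v where v: "v \<in> ball v0 e" "Q v \<noteq> 0" by blast
  have op: "open (- {x. Q x = 0})" using closed_polynomial_zeros[OF Q(1)] by (simp add: open_Compl)
  have vin: "v \<in> - {x. Q x = 0}" using v(2) by simp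
  obtain r where r: "r > 0" "ball v r \<subseteq> - {x. Q x = 0}" by (rule openE[OF op vin])
  have sec: "r \<le> norm (t *\<^sub>R (x - y) - v)" if "x \<in> g ` X" "y \<in> g ` X" for x y t
  proof (rule ccontr)
    assume "\<not> r \<le> norm (t *\<^sub>R (x - y) - v)"
    then have "t *\<^sub>R (x - y) \<in> ball v r" by (simp add: dist_norm norm_minus_commute)
    then show False using Q(3)[OF that, of t] r(2) by blast
  qed
  \<comment> \<open>The degenerate secant from g x0 to itself gives Q 0 = 0.\<close>
  obtain x0 where "x0 \<in> X" using X by blast
  then have "v \<noteq> 0" using Q(3)[of "g x0" "g x0" 0] v(2) by auto
  \<comment> \<open>Two estimates agree at this value: for large |s| the distance r from the cone,
    multiplied by |s|, suffices, for small |s| the triangle inequality does, and they meet at |x -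
    y| = |s| (|v| + r).\<close>
  define a where "a = r / (norm v + r)"
  have den: "norm v + r > 0" using r by (simp add: add_nonneg_pos)
  have a: "a > 0" using r den by (simp add: a_def)
  have key: "a * norm (x - y) \<le> norm (x - y - s *\<^sub>R v)" if xy: "x \<in> g ` X" "y \<in> g ` X" for x y s
  proof (cases "norm (x - y) \<le> \<bar>s\<bar> * (norm v + r)")
    case True
    show ?thesis
    proof (cases "s = 0")
      case True
      then show ?thesis using \<open>norm (x - y) \<le> \<bar>s\<bar> * (norm v + r)\<close> by simp
    next
      case False
      have "a * norm (x - y) \<le> a * (\<bar>s\<bar> * (norm v + r))" using True a by (intro mult_left_mono) auto
      also have "\<dots> = \<bar>s\<bar> * r" using den by (simp add: a_def)
      also have "\<dots> \<le> \<bar>s\<bar> * norm ((1 / s) *\<^sub>R (x - y) - v)" using sec[OF xy] by (intro mult_left_mono) auto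
      also have "\<dots> = norm (s *\<^sub>R ((1 / s) *\<^sub>R (x - y) - v))" by simp
      also have "s *\<^sub>R ((1 / s) *\<^sub>R (x - y) - v) = x - y - s *\<^sub>R v" using False by (simp add: scaleR_diff_right)
      finally show ?thesis .
    qed
  next
    case False
    have "\<bar>s\<bar> \<le> norm (x - y) / (norm v + r)" using False den by (simp add: field_simps)
    then have "\<bar>s\<bar> * norm v \<le> norm (x - y) / (norm v + r) * norm v" by (rule mult_right_mono) simp
    moreover have "norm (x - y) - norm (x - y) / (norm v + r) * norm v = a * norm (x - y)"
      using den by (simp add: a_def field_simps)
    moreover have "norm (x - y) - norm (s *\<^sub>R v) \<le> norm (x - y - s *\<^sub>R v)" by (rule norm_triangle_ineq2)
    ultimately show ?thesis by simp
  qed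
  obtain c where c: "c > 0" "\<And>x y. x \<in> X \<Longrightarrow> y \<in> X \<Longrightarrow> c * norm (x - y) \<le> norm (g x - g y)"
    using g by (auto simp: embeds_def)
  have "transversal X g v" unfolding transversal_def
  proof (intro exI[of _ "a * c"] conjI ballI allI)
    fix x y s assume xy: "x \<in> X" "y \<in> X"
    have "a * c * norm (x - y) \<le> a * norm (g x - g y)" using c(2)[OF xy] a by (simp add: mult.assoc)
    also have "\<dots> \<le> norm (g x - g y - s *\<^sub>R v)" using xy by (intro key) auto
    finally show "a * c * norm (x - y) \<le> norm (g x - g y - s *\<^sub>R v)" .
  qed (use a c in simp)
  then show ?thesis using that v(1) \<open>v \<noteq> 0\<close> by (simp add: dist_norm norm_minus_commute)
qed

section \<open>Extension of Lipschitz functions\<close>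

text \<open>McShane's infimum stays semialgebraic because a greatest lower bound is described by a
  first-order formula. The Lipschitz condition is relative to \<open>\<phi>\<close>, so that h x
  becomes a Lipschitz function of \<phi> x.\<close>

lemma semialgebraic_McShane:
  fixes \<phi> :: "'a::euclidean_space \<Rightarrow> 'b::euclidean_space" and h :: "'a \<Rightarrow> real"
  assumes X: "semialgebraic X" "X \<noteq> {}" and sh: "sa_fun h" and s\<phi>: "sa_fun \<phi>" and K: "K \<ge> 0"
    and hK: "\<And>x y. x \<in> X \<Longrightarrow> y \<in> X \<Longrightarrow> \<bar>h x - h y\<bar> \<le> K * norm (\<phi> x - \<phi> y)"
  obtains P where "sa_fun P" "K-lipschitz_on UNIV P" "\<And>x. x \<in> X \<Longrightarrow> P (\<phi> x) = h x"
proof -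
  define q where "q = (\<lambda>w x. h x + K * norm (w - \<phi> x))"
  define P where "P = (\<lambda>w. Inf (q w ` X))"
  have ne: "q w ` X \<noteq> {}" for w using X by blast
  have bdd: "bdd_below (q w ` X)" for w
  proof -
    obtain x0 where x0: "x0 \<in> X" using X by blast
    have "h x0 - K * norm (w - \<phi> x0) \<le> q w x" if x: "x \<in> X" for x
    proof -
      have "norm (\<phi> x0 - \<phi> x) \<le> norm (w - \<phi> x0) + norm (w - \<phi> x)"
        using norm_triangle_ineq4[of "w - \<phi> x" "w - \<phi> x0"] by (simp add: add.commute)
      then have "K * norm (\<phi> x0 - \<phi> x) \<le> K * (norm (w - \<phi> x0) + norm (w - \<phi> x))"
        using K by (rule mult_left_mono)
      then show ?thesis using hK[OF x0 x] by (simp add: q_def distrib_left abs_le_iff)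
    qed
    then show ?thesis by (auto simp: bdd_below_def)
  qed
  have low: "P w \<le> q w x" if "x \<in> X" for w x unfolding P_def using that bdd by (intro cInf_lower) auto
  have great: "t \<le> P w" if "\<And>x. x \<in> X \<Longrightarrow> t \<le> q w x" for t w
    unfolding P_def using that ne by (intro cInf_greatest) auto
  have lip: "P w \<le> P w' + K * norm (w - w')" for w w'
  proof -
    have "P w - K * norm (w - w') \<le> P w'"
    proof (rule great)
      fix x assume x: "x \<in> X"
      have "norm (w - \<phi> x) \<le> norm (w - w') + norm (w' - \<phi> x)"
        using norm_triangle_ineq[of "w - w'" "w' - \<phi> x"] by simp
      then have "K * norm (w - \<phi> x) \<le> K * (norm (w - w') + norm (w' - \<phi> x))" using K by (rule mult_left_mono)
      then show "P w - K * norm (w - w') \<le> q w' x" using low[OF x, of w] by (simp add: q_def distrib_left)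
    qed
    then show ?thesis by simp
  qed
  have "K-lipschitz_on UNIV P"
  proof (rule lipschitz_onI)
    fix w w' :: 'b
    show "dist (P w) (P w') \<le> K * dist w w'"
      using lip[of w w'] lip[of w' w] by (simp add: dist_norm norm_minus_commute abs_le_iff)
  qed (rule K)
  moreover have "P (\<phi> x) = h x" if x: "x \<in> X" for x
  proof (rule order.antisym)
    show "P (\<phi> x) \<le> h x" using low[OF x, of "\<phi> x"] by (simp add: q_def)
    show "h x \<le> P (\<phi> x)"
    proof (rule great)
      fix y assume "y \<in> X"
      then show "h x \<le> q (\<phi> x) y" using hK[OF x, of y] by (simp add: q_def abs_le_iff)
    qed
  qed
  moreover have "sa_fun P"
  proof -
    have "semialgebraic {z. (\<forall>x. x \<in> X \<longrightarrow> snd z \<le> h x + K * norm (fst z - \<phi> x)) \<and>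
      (\<forall>t. (\<forall>x. x \<in> X \<longrightarrow> t \<le> h x + K * norm (fst z - \<phi> x)) \<longrightarrow> t \<le> snd z)}"
      by (intro sa_intros sa_all sa_fun_base_intros sa_fun_comp[OF sh] sa_fun_comp[OF s\<phi>] X)
    moreover have "(\<forall>x. x \<in> X \<longrightarrow> t \<le> q w x) \<and> (\<forall>t'. (\<forall>x. x \<in> X \<longrightarrow> t' \<le> q w x) \<longrightarrow> t' \<le> t) \<longleftrightarrow> t = P w" for t w
      using low great by (meson order.antisym order.refl)
    ultimately show ?thesis unfolding sa_fun_graph q_def by simp
  qed
  ultimately show ?thesis using that by blast
qed

text \<open>Let \<open>\<rho>\<close> be the orthogonal projection along v. Transversality bounds
  |\<rho> (g x) - \<rho> (g y)| below by c |x - y|, hence h is Lipschitz as a function of \<rho> (g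
  x). It is extended in this form, and composing with \<open>\<rho>\<close> makes it constant along
  v.\<close>

lemma invariant_extension:
  fixes g :: "'a::euclidean_space \<Rightarrow> 'b::euclidean_space" and h :: "'a \<Rightarrow> real"
  assumes X: "semialgebraic X" "X \<noteq> {}" and g: "sa_fun g" and tr: "transversal X g v" and v: "v \<noteq> 0"
    and h: "sa_fun h" "L-lipschitz_on X h"
  obtains p K where "sa_fun p" "K-lipschitz_on UNIV p" "\<And>u s. p (u + s *\<^sub>R v) = p u" "\<And>x. x \<in> X \<Longrightarrow> p (g x) = h x"
proof -
  define \<rho> where "\<rho> = (\<lambda>u. u - ((u \<bullet> v) / (v \<bullet> v)) *\<^sub>R v)"
  have bl: "bounded_linear \<rho>" unfolding \<rho>_def
    by (intro bounded_linear_sub bounded_linear_ident bounded_linear_compose[OF bounded_linear_scaleR_left]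
       bounded_linear_divide[THEN bounded_linear_compose] bounded_linear_inner_left)
  then interpret \<rho>: bounded_linear \<rho> .
  have vv: "v \<bullet> v \<noteq> 0" using v by simp
  have inv: "\<rho> (u + s *\<^sub>R v) = \<rho> u" for u s
    using vv by (simp add: \<rho>_def inner_add_left add_divide_distrib scaleR_add_left)
  obtain c where c: "c > 0" "\<And>x y s. x \<in> X \<Longrightarrow> y \<in> X \<Longrightarrow> c * norm (x - y) \<le> norm (g x - g y - s *\<^sub>R v)"
    using tr by (auto simp: transversal_def)
  have L: "L \<ge> 0" using h(2) by (rule lipschitz_on_nonneg)
  have cr: "c * norm (x - y) \<le> norm (\<rho> (g x) - \<rho> (g y))" if "x \<in> X" "y \<in> X" for x y
    using c(2)[OF that, of "((g x - g y) \<bullet> v) / (v \<bullet> v)"] unfolding \<rho>.diff[symmetric]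
    by (simp only: \<rho>_def)
  obtain P where P: "sa_fun P" "(L / c)-lipschitz_on UNIV P" "\<And>x. x \<in> X \<Longrightarrow> P (\<rho> (g x)) = h x"
  proof (rule semialgebraic_McShane[OF X h(1), where \<phi> = "\<lambda>x. \<rho> (g x)" and K = "L / c"])
    show "sa_fun (\<lambda>x. \<rho> (g x))" by (rule sa_fun_comp[OF sa_fun_linear[OF bl] g])
    show "L / c \<ge> 0" using L c by simp
    fix x y assume xy: "x \<in> X" "y \<in> X"
    have "\<bar>h x - h y\<bar> \<le> L * norm (x - y)" using lipschitz_onD[OF h(2) xy] by (simp add: dist_norm)
    also have "\<dots> = L / c * (c * norm (x - y))" using c by simp
    also have "\<dots> \<le> L / c * norm (\<rho> (g x) - \<rho> (g y))" using cr[OF xy] L c by (intro mult_left_mono) auto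
    finally show "\<bar>h x - h y\<bar> \<le> L / c * norm (\<rho> (g x) - \<rho> (g y))" .
  qed blast
  obtain B where B: "B > 0" "\<And>u. norm (\<rho> u) \<le> norm u * B" using \<rho>.pos_bounded by blast
  have "B-lipschitz_on UNIV \<rho>"
    by (rule lipschitz_onI) (use B in \<open>auto simp: dist_norm mult.commute \<rho>.diff[symmetric]\<close>)
  then have "(L / c * B)-lipschitz_on UNIV (\<lambda>u. P (\<rho> u))"
    using lipschitz_on_compose2[of B UNIV \<rho> "L / c" P] P(2) lipschitz_on_subset by blast
  then show ?thesis using that[of "\<lambda>u. P (\<rho> u)" "L / c * B"] P sa_fun_comp[OF P(1) sa_fun_linear[OF bl]] inv by simp
qed

section \<open>Flows of shears\<close>

lemma bilipschitz_inverse: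
  assumes "\<And>u. F (G u) = u" "\<And>u. G (F u) = u" "L-lipschitz_on UNIV F" "L'-lipschitz_on UNIV G"
  shows "bilipschitz UNIV UNIV F" and "inv_into UNIV F = G"
proof -
  have bij: "bij F" using assms(1,2) by (metis bijI')
  show inv: "inv_into UNIV F = G"
    using assms(1) bij by (metis bij_inv_eq_iff ext)
  show "bilipschitz UNIV UNIV F" unfolding bilipschitz_def inv using bij assms(3,4) by blast
qed

lemma lipschitz_shift:
  fixes q :: "'a::real_normed_vector \<Rightarrow> real"
  assumes "L-lipschitz_on UNIV q"
  shows "(1 + L * norm v)-lipschitz_on UNIV (\<lambda>u. u + q u *\<^sub>R v)"
proof (rule lipschitz_onI)
  have L: "L \<ge> 0" using assms by (rule lipschitz_on_nonneg)
  then show "1 + L * norm v \<ge> 0" by simp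
  fix x y :: 'a
  have "(x + q x *\<^sub>R v) - (y + q y *\<^sub>R v) = (x - y) + (q x - q y) *\<^sub>R v" by (simp add: algebra_simps)
  then have "norm ((x + q x *\<^sub>R v) - (y + q y *\<^sub>R v)) \<le> norm (x - y) + \<bar>q x - q y\<bar> * norm v"
    by (metis norm_scaleR norm_triangle_ineq)
  also have "\<bar>q x - q y\<bar> * norm v \<le> (L * norm (x - y)) * norm v"
    using lipschitz_onD[OF assms, of x y] by (intro mult_right_mono) (auto simp: dist_norm)
  finally show "dist (x + q x *\<^sub>R v) (y + q y *\<^sub>R v) \<le> (1 + L * norm v) * dist x y"
    by (simp add: dist_norm algebra_simps)
qed

lemma lipschitz_cmult:
  fixes q :: "'a::metric_space \<Rightarrow> real"
  assumes "L-lipschitz_on S q" shows "(\<bar>c\<bar> * L)-lipschitz_on S (\<lambda>u. c * q u)"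
proof (rule lipschitz_onI)
  show "\<bar>c\<bar> * L \<ge> 0" using lipschitz_on_nonneg[OF assms] by simp
  fix x y assume "x \<in> S" "y \<in> S"
  then have "\<bar>q x - q y\<bar> \<le> L * dist x y" using lipschitz_onD[OF assms] by (simp add: dist_norm)
  then have "\<bar>c\<bar> * \<bar>q x - q y\<bar> \<le> \<bar>c\<bar> * (L * dist x y)" by (rule mult_left_mono) simp
  then show "dist (c * q x) (c * q y) \<le> \<bar>c\<bar> * L * dist x y"
    by (simp add: dist_norm mult.assoc flip: abs_mult right_diff_distrib)
qed

text \<open>Since q does not change along v, the displacement can be undone with the same value of
  q.\<close>

lemma shift_inverse:
  fixes v :: "'a::real_vector"
  assumes "\<And>u s. q (u + s *\<^sub>R v) = (q u :: real)"
  shows "(u + q u *\<^sub>R v) + (- q (u + q u *\<^sub>R v)) *\<^sub>R v = u"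
    and "(u + (- q u) *\<^sub>R v) + q (u + (- q u) *\<^sub>R v) *\<^sub>R v = u"
  by (simp_all only: assms) simp_all

lemma tame_id: "tame (\<lambda>u. u)"
  using tame.linear[of "\<lambda>u. u"] by (simp add: linear_id matrix_id_mat_1 flip: id_def)

lemma axis_last_decomp:
  fixes x y :: "real^'n::{finite,linorder}"
  assumes "\<And>i. i \<noteq> last_index \<Longrightarrow> x $ i = y $ i"
  shows "x = y + (x $ last_index - y $ last_index) *\<^sub>R axis last_index 1"
  using assms by (auto simp: vec_eq_iff axis_def)

text \<open>A shear in an arbitrary direction is conjugate, by a rotation, to one along the last axis.\<close>

lemma tame_shift:
  fixes q :: "real^'n::{finite,linorder} \<Rightarrow> real"
  assumes n: "2 \<le> CARD('n)" and q: "L-lipschitz_on UNIV q" and inv: "\<And>u s. q (u + s *\<^sub>R v) = q u"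
  shows "tame (\<lambda>u. u + q u *\<^sub>R v)"
proof (cases "v = 0")
  case True then show ?thesis using tame_id by simp
next
  case False
  let ?e = "axis last_index 1 :: real^'n::_"
  have "norm (norm v *\<^sub>R ?e) = norm v" by simp
  from rotation_exists[OF n this] obtain A where A: "orthogonal_transformation A" "det (matrix A) = 1"
    "A (norm v *\<^sub>R ?e) = v" by blast
  define B where "B = inv A"
  have linA: "linear A" using A(1) by (rule orthogonal_transformation_linear)
  have bijA: "bij A" using A(1) by (rule orthogonal_transformation_bij)
  have AB: "A (B u) = u" "B (A u) = u" for u
    using bijA by (simp_all add: B_def bij_is_surj surj_f_inv_f bij_is_inj)
  have oB: "orthogonal_transformation B" unfolding B_def by (rule orthogonal_transformation_inv[OF A(1)])
  have linB: "linear B" using oB by (rule orthogonal_transformation_linear)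
  have "matrix (A \<circ> B) = matrix A ** matrix B" by (rule matrix_compose[OF linB linA])
  moreover have "A \<circ> B = id" using AB by auto
  ultimately have "det (matrix A) * det (matrix B) = 1" by (metis det_I det_mul matrix_id_mat_1)
  then have dB: "det (matrix B) = 1" using A(2) by simp
  \<comment> \<open>The rotation maps |v| times the last unit vector to v, so the factor |v|
    accounts for the length of v.\<close>
  define p where "p = (\<lambda>w. norm v * q (A w))"
  have dep: "depends_on_initial_coords p" unfolding depends_on_initial_coords_def
  proof (intro allI impI)
    fix x y :: "real^'n::_" assume "\<forall>i. i \<noteq> last_index \<longrightarrow> x $ i = y $ i"
    then obtain d where d: "x = y + d *\<^sub>R ?e" using axis_last_decomp by blast
    have "A x = A y + (d / norm v) *\<^sub>R A (norm v *\<^sub>R ?e)"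
      unfolding d using False by (simp add: linear_add[OF linA] linear_cmul[OF linA])
    then show "p x = p y" by (simp add: p_def A(3) inv)
  qed
  have sh: "shear p = (\<lambda>w. w + p w *\<^sub>R ?e)"
    by (auto simp: shear_def fun_eq_iff vec_eq_iff axis_def)
  have pe: "p (w + s *\<^sub>R ?e) = p w" for w s
  proof -
    have "\<forall>i. i \<noteq> last_index \<longrightarrow> (w + s *\<^sub>R ?e) $ i = w $ i" by (simp add: axis_def)
    then show ?thesis using dep unfolding depends_on_initial_coords_def by blast
  qed
  have "1-lipschitz_on UNIV A"
    by (rule lipschitz_onI) (use A(1) in \<open>simp_all add: dist_norm orthogonal_transformation_norm flip: linear_diff[OF linA]\<close>)
  then have "(L * 1)-lipschitz_on UNIV (\<lambda>w. q (A w))"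
    using lipschitz_on_compose2[of 1 UNIV A L q] lipschitz_on_subset[OF q] by blast
  from lipschitz_cmult[OF this, of "norm v"] have lp: "(\<bar>norm v\<bar> * (L * 1))-lipschitz_on UNIV p"
    by (simp add: p_def)
  from lipschitz_cmult[OF lp, of "- 1"] have lp': "(\<bar>- 1\<bar> * (\<bar>norm v\<bar> * (L * 1)))-lipschitz_on UNIV (\<lambda>w. - p w)"
    by simp
  have "bilipschitz UNIV UNIV (shear p)" unfolding sh
    by (rule bilipschitz_inverse(1)[OF _ _ lipschitz_shift[OF lp, of ?e] lipschitz_shift[OF lp', of ?e]])
       (simp_all only: shift_inverse[OF pe])
  with dep have "tame (shear p)" by (rule tame.shear)
  then have "tame (A \<circ> (shear p \<circ> B))"
    using tame.linear[OF linA A(2)] tame.linear[OF linB dB] by (intro tame.comp)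
  moreover have "A \<circ> (shear p \<circ> B) = (\<lambda>u. u + q u *\<^sub>R v)"
  proof
    fix u
    have "(A \<circ> (shear p \<circ> B)) u = A (B u) + q (A (B u)) *\<^sub>R A (norm v *\<^sub>R ?e)"
      unfolding sh o_def linear_add[OF linA] by (simp add: p_def linear_cmul[OF linA] mult.commute)
    then show "(A \<circ> (shear p \<circ> B)) u = u + q u *\<^sub>R v" by (simp only: AB A(3))
  qed
  ultimately show ?thesis by simp
qed

text \<open>Not a one-parameter group: finitely many shears are composed, each with its strength
  multiplied by the common parameter t. The properties required of the family follow by
  induction.\<close>

inductive flow :: "(real \<Rightarrow> 'a::euclidean_space \<Rightarrow> 'a) \<Rightarrow> bool" where
  id: "flow (\<lambda>t u. u)"
| step: "flow F \<Longrightarrow> sa_fun p \<Longrightarrow> L-lipschitz_on UNIV p \<Longrightarrow> (\<And>u s. p (u + s *\<^sub>R v) = p u) \<Longrightarrow>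
    flow (\<lambda>t u. F t u + (t * p (F t u)) *\<^sub>R v)"

lemma flow_comp: "flow G \<Longrightarrow> flow F \<Longrightarrow> flow (\<lambda>t u. G t (F t u))"
proof (induction rule: flow.induct)
  case (step G p L v)
  show ?case by (rule flow.step[OF step.IH[OF step.prems] step.hyps(2,3,4)])
qed simp

lemma flow_0: "flow F \<Longrightarrow> F 0 u = u"
  by (induction rule: flow.induct) simp_all

lemma flow_tame:
  fixes F :: "real \<Rightarrow> real^'n::{finite,linorder} \<Rightarrow> real^'n::_"
  assumes "flow F" "2 \<le> CARD('n)"
  shows "tame (F t)"
  using assms(1)
proof (induction rule: flow.induct)
  case id show ?case by (rule tame_id)
next
  case (step F p L v)
  have "tame (\<lambda>u. u + (t * p u) *\<^sub>R v)"
    by (rule tame_shift[OF assms(2) lipschitz_cmult[OF step.hyps(3)]]) (simp add: step.hyps(4))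
  from tame.comp[OF this step.IH] show ?case by (simp add: o_def)
qed

lemma flow_saf: "flow F \<Longrightarrow> sa_fun (\<lambda>(u, t). F t u)"
proof (induction rule: flow.induct)
  case id then show ?case unfolding case_prod_unfold by (intro sa_fun_base_intros)
next
  case (step F p L v)
  then show ?case unfolding case_prod_unfold by (intro sa_fun_base_intros sa_fun_comp[OF step.hyps(2)])
qed

lemma flow_saf_at: "flow F \<Longrightarrow> sa_fun (F t)"
  using sa_fun_comp[OF flow_saf, of F "\<lambda>u. (u, t)"] by (simp add: sa_fun_base_intros)

lemma flow_continuous: "flow F \<Longrightarrow> continuous_on UNIV (\<lambda>(u, t). F t u)"
proof (induction rule: flow.induct)
  case id then show ?case unfolding case_prod_unfold by (intro continuous_intros)
next
  case (step F p L v)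
  have "continuous_on UNIV p" by (rule lipschitz_on_continuous_on[OF step.hyps(3)])
  moreover have c: "continuous_on UNIV (\<lambda>z. F (snd z) (fst z))" using step.IH by (simp add: case_prod_unfold)
  ultimately have "continuous_on UNIV (\<lambda>z. p (F (snd z) (fst z)))"
    by (rule continuous_on_compose2) simp
  then show ?case unfolding case_prod_unfold by (intro continuous_intros c)
qed

lemma flow_inverse:
  assumes "flow F"
  shows "\<exists>G L L'. (\<forall>u. F t (G u) = u) \<and> (\<forall>u. G (F t u) = u) \<and> L-lipschitz_on UNIV (F t) \<and> L'-lipschitz_on UNIV G"
  using assms
proof (induction rule: flow.induct)
  case id
  have "1-lipschitz_on UNIV (\<lambda>u::'a. u)" by (rule lipschitz_onI) auto
  then show ?case by (intro exI[of _ "\<lambda>u. u"] exI[of _ 1]) simp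
next
  case (step F p K v)
  then obtain G L L' where G: "\<And>u. F t (G u) = u" "\<And>u. G (F t u) = u" "L-lipschitz_on UNIV (F t)" "L'-lipschitz_on UNIV G"
    by blast
  define q where "q = (\<lambda>u. t * p u)"
  have qv: "q (u + s *\<^sub>R v) = q u" for u s by (simp add: q_def step.hyps(4))
  have lq: "(\<bar>t\<bar> * K)-lipschitz_on UNIV q" unfolding q_def by (rule lipschitz_cmult[OF step.hyps(3)])
  from lipschitz_cmult[OF lq, of "- 1"] have lq': "(\<bar>- 1\<bar> * (\<bar>t\<bar> * K))-lipschitz_on UNIV (\<lambda>w. - q w)" by simp
  have "\<exists>L. L-lipschitz_on UNIV (\<lambda>u. F t u + q (F t u) *\<^sub>R v)"
    using lipschitz_on_compose2[OF G(3) lipschitz_on_subset[OF lipschitz_shift[OF lq, of v]]] by blast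
  moreover have "\<exists>L. L-lipschitz_on UNIV (\<lambda>u. G (u + (- q u) *\<^sub>R v))"
    using lipschitz_on_compose2[OF lipschitz_shift[OF lq', of v] lipschitz_on_subset[OF G(4)]] by blast
  moreover have "F t (G (u + (- q u) *\<^sub>R v)) + q (F t (G (u + (- q u) *\<^sub>R v))) *\<^sub>R v = u" for u
    unfolding G(1) by (rule shift_inverse(2)[OF qv])
  moreover have "G ((F t u + q (F t u) *\<^sub>R v) + (- q (F t u + q (F t u) *\<^sub>R v)) *\<^sub>R v) = u" for u
    unfolding shift_inverse(1)[OF qv] by (rule G(2))
  ultimately show ?case unfolding q_def[symmetric]
    by (intro exI[of _ "\<lambda>u. G (u + (- q u) *\<^sub>R v)"]) (simp add: q_def)
qed

lemma flow_semialgebraic_bilipschitz: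
  assumes "flow F" shows "semialgebraic_bilipschitz UNIV UNIV (F t)"
proof -
  obtain G L L' where G: "\<And>u. F t (G u) = u" "\<And>u. G (F t u) = u" "L-lipschitz_on UNIV (F t)" "L'-lipschitz_on UNIV G"
    using flow_inverse[OF assms, of t] by blast
  note b = bilipschitz_inverse[of "F t" G, OF G]
  \<comment> \<open>The graph of the inverse is that of \<open>F t\<close> with the components
    exchanged.\<close>
  have "semialgebraic {z. fst z = F t (snd z)}"
    by (intro sa_intros sa_fun_base_intros sa_fun_comp[OF flow_saf_at[OF assms]])
  moreover have "fst z = F t (snd z) \<longleftrightarrow> snd z = G (fst z)" for z using G by metis
  ultimately have "sa_fun G" by (simp add: sa_fun_graph)
  then show ?thesis unfolding semialgebraic_bilipschitz_def using b flow_saf_at[OF assms] by simp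
qed

section \<open>Isotopies to a given embedding\<close>

text \<open>A relation between maps on \<open>X\<close> and not between subsets: the shears act on
  the images, while displacements are prescribed as functions on the fixed set
  \<open>X\<close>.\<close>

definition reach :: "'a::euclidean_space set \<Rightarrow> ('a \<Rightarrow> 'b::euclidean_space) \<Rightarrow> ('a \<Rightarrow> 'b) \<Rightarrow> bool" where
  "reach X g g' \<longleftrightarrow> (\<exists>F. flow F \<and> (\<forall>x\<in>X. F 1 (g x) = g' x))"

lemma reach_refl: "(\<And>x. x \<in> X \<Longrightarrow> g x = g' x) \<Longrightarrow> reach X g g'"
  unfolding reach_def by (intro exI[of _ "\<lambda>t u. u"]) (simp add: flow.id)

lemma reach_trans: "reach X g g' \<Longrightarrow> reach X g' g'' \<Longrightarrow> reach X g g''"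
proof -
  assume "reach X g g'" "reach X g' g''"
  then obtain F G where "flow F" "\<And>x. x \<in> X \<Longrightarrow> F 1 (g x) = g' x" "flow G" "\<And>x. x \<in> X \<Longrightarrow> G 1 (g' x) = g'' x"
    by (auto simp: reach_def)
  then show ?thesis unfolding reach_def
    by (intro exI[of _ "\<lambda>t u. G t (F t u)"]) (simp add: flow_comp)
qed

lemma reach_shift:
  assumes "sa_fun p" "L-lipschitz_on UNIV p" "\<And>u s. p (u + s *\<^sub>R v) = p u"
    and "\<And>x. x \<in> X \<Longrightarrow> g' x = g x + p (g x) *\<^sub>R v"
  shows "reach X g g'"
  unfolding reach_def using flow.step[OF flow.id assms(1-3)] assms(4)
  by (intro exI[of _ "\<lambda>t u. u + (t * p u) *\<^sub>R v"]) simp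

lemma reach_move:
  assumes "semialgebraic X" "X \<noteq> {}" "sa_fun g" "transversal X g v" "v \<noteq> 0" "sa_fun h" "L-lipschitz_on X h"
    and g': "\<And>x. x \<in> X \<Longrightarrow> g' x = g x + h x *\<^sub>R v"
  shows "reach X g g'"
proof (rule invariant_extension[OF assms(1-7)])
  fix p K assume p: "sa_fun p" "K-lipschitz_on UNIV p" "\<And>u s. p (u + s *\<^sub>R v) = p u" "\<And>x. x \<in> X \<Longrightarrow> p (g x) = h x"
  show ?thesis by (rule reach_shift[OF p(1-3)]) (simp add: g' p(4))
qed

text \<open>A linear form that vanishes on v is constant along v on the whole space, so this move is
  available for every map g, whether or not v is transversal to it.\<close>

lemma reach_linear:
  assumes p: "bounded_linear p" and v: "p v = 0"
    and g': "\<And>x. x \<in> X \<Longrightarrow> g' x = g x + p (g x) *\<^sub>R v"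
  shows "reach X g g'"
proof -
  interpret p: bounded_linear p by fact
  obtain K where K: "K > 0" "\<And>u. norm (p u) \<le> norm u * K" using p.pos_bounded by blast
  have "K-lipschitz_on UNIV p"
    by (rule lipschitz_onI) (use K in \<open>auto simp: dist_norm mult.commute p.diff[symmetric]\<close>)
  then show ?thesis
    by (rule reach_shift[OF sa_fun_linear[OF p] _ _ g']) (simp_all add: p.add p.scaleR v)
qed

lemma embeds_reach:
  assumes g: "embeds X g" and r: "reach X g g'" and g': "sa_fun g'"
  shows "embeds X g'"
proof -
  obtain F where F: "flow F" "\<And>x. x \<in> X \<Longrightarrow> F 1 (g x) = g' x" using r by (auto simp: reach_def)
  obtain G L L' where G: "\<And>u. F 1 (G u) = u" "\<And>u. G (F 1 u) = u" "L-lipschitz_on UNIV (F 1)" "L'-lipschitz_on UNIV G"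
    using flow_inverse[OF F(1), of 1] by blast
  obtain K where K: "K-lipschitz_on X g" using g by (auto simp: embeds_def)
  obtain c where c: "c > 0" "\<And>x y. x \<in> X \<Longrightarrow> y \<in> X \<Longrightarrow> c * norm (x - y) \<le> norm (g x - g y)"
    using g by (auto simp: embeds_def)
  have L': "L' \<ge> 0" using G(4) by (rule lipschitz_on_nonneg)
  have "(L * K)-lipschitz_on X (\<lambda>x. F 1 (g x))"
    by (rule lipschitz_on_compose2[OF K lipschitz_on_subset[OF G(3)]]) simp
  then have "(L * K)-lipschitz_on X g'"
    using F(2) by (simp add: lipschitz_on_def)
  moreover have "c / (L' + 1) * norm (x - y) \<le> norm (g' x - g' y)" if xy: "x \<in> X" "y \<in> X" for x y
  proof -
    have "c * norm (x - y) \<le> norm (G (g' x) - G (g' y))"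
      using c(2)[OF xy] by (simp add: G(2) flip: F(2)[OF xy(1)] F(2)[OF xy(2)])
    also have "\<dots> \<le> L' * norm (g' x - g' y)"
      using lipschitz_onD[OF G(4), of "g' x" "g' y"] by (simp add: dist_norm)
    also have "\<dots> \<le> (L' + 1) * norm (g' x - g' y)" by (intro mult_right_mono) auto
    finally show ?thesis using L' by (simp add: field_simps)
  qed
  moreover have "c / (L' + 1) > 0" using c L' by simp
  ultimately show ?thesis unfolding embeds_def using g' by blast
qed

definition coord_proj :: "'n set \<Rightarrow> real^'n \<Rightarrow> real^'n" where
  "coord_proj J x = (\<chi> i. if i \<in> J then x $ i else 0)"

lemma bounded_linear_coord_proj: "bounded_linear (coord_proj J)"
  unfolding linear_conv_bounded_linear[symmetric]
  by (rule linearI) (auto simp: coord_proj_def vec_eq_iff)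

lemma transversal_scale:
  assumes "transversal X g v" "r \<noteq> 0" shows "transversal X g (r *\<^sub>R v)"
proof -
  obtain c where c: "c > 0" "\<And>x y s. x \<in> X \<Longrightarrow> y \<in> X \<Longrightarrow> c * norm (x - y) \<le> norm (g x - g y - s *\<^sub>R v)"
    using assms by (auto simp: transversal_def)
  then have "c * norm (x - y) \<le> norm (g x - g y - s *\<^sub>R (r *\<^sub>R v))" if "x \<in> X" "y \<in> X" for x y s
    using c(2)[OF that, of "s * r"] by simp
  then show ?thesis using c(1) unfolding transversal_def by blast
qed

lemma lipschitz_component:
  fixes g :: "real^'n \<Rightarrow> real^'n"
  assumes "L-lipschitz_on X g" shows "L-lipschitz_on X (\<lambda>x. g x $ j)"
proof (rule lipschitz_onI)
  fix x y assume "x \<in> X" "y \<in> X"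
  then have "dist (g x) (g y) \<le> L * dist x y" by (rule lipschitz_onD[OF assms])
  then show "dist (g x $ j) (g y $ j) \<le> L * dist x y" using dist_vec_nth_le[of "g x" j "g y"] by linarith
qed (rule lipschitz_on_nonneg[OF assms])

text \<open>The coordinates are replaced one at a time. Before coordinate \<open>j\<close> can be moved, the \<open>j\<close>-th axis
  has to become transversal; this costs a linear perturbation, which can be made arbitrarily small.\<close>

lemma reach_perturbed:
  fixes X :: "(real^'n) set" and f :: "real^'n \<Rightarrow> real^'n"
  assumes X: "closed X" "semialgebraic X" "X \<noteq> {}" and dim: "semialgebraic_dim X = int k"
    and n: "2 * k + 2 \<le> CARD('n)" and f: "embeds X f" and e: "e > 0"
  shows "\<exists>B. bounded_linear B \<and> (\<forall>x. norm (B x) \<le> e * norm x) \<and>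
    reach X (\<lambda>x. x) (\<lambda>x. coord_proj J (f x) + (x - coord_proj J x) + B x)"
  using finite[of J] e
proof (induction J arbitrary: e rule: finite_induct)
  case empty
  then show ?case
    by (intro exI[of _ "\<lambda>x. 0"]) (auto simp: coord_proj_def vec_eq_iff intro!: reach_refl)
next
  case (insert j J)
  \<comment> \<open>Half of e remains for the new error, and the bound 1 gives |x_j + (B x)_j| \<le>
    2 |x|.\<close>
  define e' where "e' = min (e / 2) 1"
  have e': "e' > 0" "e' \<le> e / 2" "e' \<le> 1" using insert.prems by (auto simp: e'_def)
  from insert.IH[OF e'(1)] obtain B where B: "bounded_linear B" "\<And>x. norm (B x) \<le> e' * norm x"
    "reach X (\<lambda>x. x) (\<lambda>x. coord_proj J (f x) + (x - coord_proj J x) + B x)" by blast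
  define g where "g = (\<lambda>x. coord_proj J (f x) + (x - coord_proj J x) + B x)"
  have sf: "sa_fun f" using f by (simp add: embeds_def)
  have sg: "sa_fun g" unfolding g_def
    by (intro sa_fun_base_intros sa_fun_comp[OF sa_fun_linear[OF bounded_linear_coord_proj]] sa_fun_comp[OF sa_fun_linear[OF B(1)]] sf)
  have id: "embeds X (\<lambda>x. x)" unfolding embeds_def
    by (auto simp: sa_fun_id lipschitz_on_def intro!: exI[of _ 1])
  have eg: "embeds X g" by (rule embeds_reach[OF id _ sg]) (use B(3) in \<open>simp add: g_def\<close>)
  \<comment> \<open>Since |w| \<le> 4 d, the new error is at most 8 d |x| \<le> e |x| / 2; the bound
    1/2 keeps the coordinate a of v0 away from 0.\<close>
  define d where "d = min (1/2) (e / 16)"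
  have d: "d > 0" "d \<le> 1/2" "d \<le> e / 16" using insert.prems by (auto simp: d_def)
  obtain v0 where v0: "norm (v0 - axis j 1) < d" "v0 \<noteq> 0" "transversal X g v0"
    by (rule transversal_dense[OF X dim n eg d(1), of "axis j 1"])
  define a where "a = v0 $ j"
  have "\<bar>a - 1\<bar> \<le> norm (v0 - axis j 1)" using component_le_norm_cart[of "v0 - axis j 1" j] by (simp add: a_def)
  then have a: "\<bar>a - 1\<bar> < d" "a > 1/2" using v0(1) d(2) by auto
  \<comment> \<open>Normalised to v_j = 1, so that w_j = 0 and moving by h v changes coordinate j by
    exactly h.\<close>
  define v where "v = (1 / a) *\<^sub>R v0"
  define w where "w = v - axis j 1"
  have vj: "v $ j = 1" using a by (simp add: v_def a_def)
  have v: "v \<noteq> 0" "transversal X g v" using v0 a transversal_scale[OF v0(3), of "1 / a"] by (auto simp: v_def)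
  have nw: "norm w \<le> 4 * d"
  proof -
    have "w = (1 / a) *\<^sub>R (v0 - a *\<^sub>R axis j 1)" using a by (simp add: w_def v_def scaleR_diff_right)
    then have "norm w = (1 / a) * norm (v0 - a *\<^sub>R axis j 1)" using a by simp
    also have "\<dots> \<le> 2 * norm (v0 - a *\<^sub>R axis j 1)" using a by (intro mult_right_mono) (auto simp: field_simps)
    also have "v0 - a *\<^sub>R axis j 1 = (v0 - axis j 1) + (1 - a) *\<^sub>R axis j 1" by (simp add: algebra_simps)
    also have "norm \<dots> \<le> norm (v0 - axis j 1) + \<bar>1 - a\<bar>" using norm_triangle_ineq[of "v0 - axis j 1" "(1 - a) *\<^sub>R axis j 1"] by simp
    also have "\<dots> \<le> 2 * d" using v0(1) a(1) by simp
    finally show ?thesis by simp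
  qed
  define h where "h = (\<lambda>x. f x $ j - x $ j)"
  obtain L where L: "L-lipschitz_on X f" using f by (auto simp: embeds_def)
  have lh: "(L + 1)-lipschitz_on X h"
    unfolding h_def by (intro lipschitz_on_diff lipschitz_component L) (auto simp: lipschitz_on_def)
  have sh: "sa_fun h" unfolding h_def by (intro sa_fun_diff sa_fun_component sf sa_fun_id)
  define g1 where "g1 = (\<lambda>x. g x + h x *\<^sub>R v)"
  \<comment> \<open>Coordinate j of g1 is f_j + B_j. Subtracting this multiple of w from h w = (f_j
    - x_j) w cancels f_j w and leaves -(x_j + B_j) w, which is absorbed into
    \<open>B'\<close>.\<close>
  define g2 where "g2 = (\<lambda>x. g1 x + (- (g1 x $ j)) *\<^sub>R w)"
  have "reach X g g1"
    by (rule reach_move[OF X(2,3) sg v(2,1) sh lh]) (simp add: g1_def)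
  moreover have "reach X g1 g2"
  proof (rule reach_linear)
    show "bounded_linear (\<lambda>u::real^'n. - (u $ j))" by (intro bounded_linear_minus bounded_linear_vec_nth)
    show "- (w $ j) = 0" by (simp add: w_def vj)
  qed (simp add: g2_def)
  ultimately have r: "reach X (\<lambda>x. x) g2" using B(3) unfolding g_def[symmetric] by (blast intro: reach_trans)
  define B' where "B' = (\<lambda>x. B x - (x $ j + B x $ j) *\<^sub>R w)"
  have "g2 x = coord_proj (insert j J) (f x) + (x - coord_proj (insert j J) x) + B' x" for x
  proof -
    have "g1 x $ j = f x $ j + B x $ j" using insert.hyps by (simp add: g1_def g_def h_def coord_proj_def vj)
    then show ?thesis using insert.hyps vj
      by (auto simp: vec_eq_iff g2_def g1_def g_def h_def B'_def w_def coord_proj_def axis_def algebra_simps)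
  qed
  then have "reach X (\<lambda>x. x) (\<lambda>x. coord_proj (insert j J) (f x) + (x - coord_proj (insert j J) x) + B' x)"
    using r by presburger
  moreover have "bounded_linear B'" unfolding B'_def
    by (intro bounded_linear_sub B(1) bounded_linear_compose[OF bounded_linear_scaleR_left] bounded_linear_add
       bounded_linear_vec_nth bounded_linear_compose[OF bounded_linear_vec_nth B(1)])
  moreover have "norm (B' x) \<le> e * norm x" for x
  proof -
    have "norm (B' x) \<le> norm (B x) + \<bar>x $ j + B x $ j\<bar> * norm w"
      unfolding B'_def using norm_triangle_ineq4[of "B x" "(x $ j + B x $ j) *\<^sub>R w"] by simp
    also have "\<dots> \<le> e / 2 * norm x + (2 * norm x) * (4 * d)"
    proof (intro add_mono mult_mono)
      show "norm (B x) \<le> e / 2 * norm x" using B(2)[of x] mult_right_mono[OF e'(2), of "norm x"] by simp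
      have "norm (B x) \<le> norm x" using B(2)[of x] mult_right_mono[OF e'(3), of "norm x"] by simp
      then show "\<bar>x $ j + B x $ j\<bar> \<le> 2 * norm x"
        using component_le_norm_cart[of x j] component_le_norm_cart[of "B x" j] by linarith
    qed (use nw in auto)
    also have "(2 * norm x) * (4 * d) \<le> (2 * norm x) * (4 * (e / 16))" using d by (intro mult_left_mono) auto
    finally show ?thesis by simp
  qed
  ultimately show ?case by blast
qed

text \<open>The directions v_j and the constant c depend on \<open>X\<close> and \<open>f\<close>
  alone, so they are fixed before B is chosen and the size of B may depend on them.\<close>

lemma reach_embedding:
  fixes X :: "(real^'n) set" and f :: "real^'n \<Rightarrow> real^'n"
  assumes X: "closed X" "semialgebraic X" "X \<noteq> {}" and dim: "semialgebraic_dim X = int k"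
    and n: "2 * k + 2 \<le> CARD('n)" and f: "embeds X f"
  shows "reach X (\<lambda>x. x) f"
proof -
  define N where "N = real CARD('n)"
  have N: "N \<ge> 1" by (simp add: N_def Suc_leI)
  \<comment> \<open>The n deviations of the v_j from the axes add up to at most 1/2, so |A x - x|
    \<le> |x| / 2, which makes A invertible and the v_j a basis.\<close>
  define e where "e = 1 / (2 * N)"
  have e: "e > 0" "e \<le> 1" using N by (auto simp: e_def field_simps)
  have "\<exists>v. norm (v - axis j 1) < e \<and> v \<noteq> 0 \<and> transversal X f v" for j
  proof -
    obtain v where "norm (v - axis j 1) < e" "v \<noteq> 0" "transversal X f v"
      by (rule transversal_dense[OF X dim n f e(1), of "axis j 1"])
    then show ?thesis by blast
  qed
  then obtain v where v: "\<And>j. norm (v j - axis j 1) < e" "\<And>j. v j \<noteq> 0" "\<And>j. transversal X f (v j)" by metis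
  have nv: "norm (v j) \<le> 2" for j
    using norm_triangle_ineq[of "v j - axis j 1" "axis j 1"] v(1)[of j] e(2) by simp
  from v(3) obtain cc where cc: "\<And>j. cc j > 0"
    "\<And>j x y s. x \<in> X \<Longrightarrow> y \<in> X \<Longrightarrow> cc j * norm (x - y) \<le> norm (f x - f y - s *\<^sub>R v j)"
    unfolding transversal_def by metis
  define c where "c = Min (range cc)"
  have "c \<in> range cc" unfolding c_def by (rule Min_in) auto
  then have c0: "c > 0" using cc(1) by auto
  have c: "c * norm (x - y) \<le> norm (f x - f y - s *\<^sub>R v j)" if "x \<in> X" "y \<in> X" for x y s j
  proof -
    have "c \<le> cc j" unfolding c_def by (rule Min_le) auto
    then have "c * norm (x - y) \<le> cc j * norm (x - y)" by (rule mult_right_mono) simp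
    then show ?thesis using cc(2)[OF that, of j s] by linarith
  qed
  define A where "A = (\<lambda>x::real^'n. \<Sum>j\<in>UNIV. x $ j *\<^sub>R v j)"
  have linA: "linear A" unfolding A_def
    by (rule linearI) (simp_all add: scaleR_add_left sum.distrib scaleR_sum_right)
  have "norm (A x - x) \<le> norm x / 2" for x
  proof -
    have "A x - x = (\<Sum>j\<in>UNIV. x $ j *\<^sub>R v j) - (\<Sum>j\<in>UNIV. x $ j *\<^sub>R axis j 1)"
      using basis_expansion[of x] by (simp add: A_def scalar_mult_eq_scaleR)
    also have "\<dots> = (\<Sum>j\<in>UNIV. x $ j *\<^sub>R (v j - axis j 1))"
      by (simp add: scaleR_diff_right sum_subtractf)
    also have "norm \<dots> \<le> (\<Sum>j\<in>(UNIV :: 'n set). norm x * e)"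
    proof (rule sum_norm_le)
      fix j
      show "norm (x $ j *\<^sub>R (v j - axis j 1)) \<le> norm x * e"
        unfolding norm_scaleR using v(1)[of j] component_le_norm_cart[of x j] by (intro mult_mono) auto
    qed
    also have "\<dots> = norm x / 2" using N by (simp add: e_def N_def)
    finally show ?thesis .
  qed
  then have lowA: "norm x \<le> 2 * norm (A x)" for x
    using norm_triangle_ineq3[of "A x" x] by (smt (verit) field_sum_of_halves)
  have "inj A"
  proof (rule linear_injective_0[OF linA, THEN iffD2], intro allI impI)
    fix x assume "A x = 0" then show "x = 0" using lowA[of x] by simp
  qed
  then obtain A' where A': "linear A'" "\<And>x. A' (A x) = x" "\<And>x. A (A' x) = x"
    using linear_injective_isomorphism[OF linA] by blast
  \<comment> \<open>As |b x| \<le> 2 \<eta> |x| and |v_j| \<le> 2, a sum of n terms is at most 4 n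
    \<eta> |x| = c |x| / 2, which costs half of the transversality constant.\<close>
  define \<eta> where "\<eta> = c / (8 * N)"
  have \<eta>: "\<eta> > 0" using c0 N by (simp add: \<eta>_def)
  obtain B where B: "bounded_linear B" "\<And>x. norm (B x) \<le> \<eta> * norm x"
    "reach X (\<lambda>x. x) (\<lambda>x. coord_proj UNIV (f x) + (x - coord_proj UNIV x) + B x)"
    using reach_perturbed[OF X dim n f \<eta>, of UNIV] by blast
  \<comment> \<open>The coordinates of B x in the basis v_j.\<close>
  define b where "b = (\<lambda>x. A' (B x))"
  have blb: "bounded_linear b" unfolding b_def
    using A'(1) B(1) by (intro bounded_linear_compose[of A' B]) (simp_all add: linear_conv_bounded_linear)
  then interpret b: bounded_linear b .
  have nb: "norm (b x) \<le> 2 * \<eta> * norm x" for x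
    using lowA[of "b x"] B(2)[of x] by (simp add: b_def A'(3))
  have sf: "sa_fun f" using f by (simp add: embeds_def)
  \<comment> \<open>\<open>J\<close> holds the directions in which the perturbation is still
    present; each removal is a move along some v_j, to which all intermediate maps stay
    transversal.\<close>
  define g where "g = (\<lambda>J x. f x + (\<Sum>j\<in>J. (b x $ j) *\<^sub>R v j))"
  have ng: "norm (\<Sum>j\<in>J. (b x $ j) *\<^sub>R v j) \<le> c / 2 * norm x" for J x
  proof -
    have "norm (\<Sum>j\<in>J. (b x $ j) *\<^sub>R v j) \<le> (\<Sum>j\<in>J. 2 * \<eta> * norm x * 2)"
    proof (rule sum_norm_le)
      fix j
      show "norm ((b x $ j) *\<^sub>R v j) \<le> 2 * \<eta> * norm x * 2" unfolding norm_scaleR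
        using nv[of j] nb[of x] component_le_norm_cart[of "b x" j] \<eta> by (intro mult_mono) auto
    qed
    also have "\<dots> \<le> (\<Sum>j\<in>(UNIV :: 'n set). 2 * \<eta> * norm x * 2)" by (rule sum_mono2) (use \<eta> in auto)
    also have "\<dots> = c / 2 * norm x" using N by (simp add: \<eta>_def N_def field_simps)
    finally show ?thesis .
  qed
  have "bounded_linear (\<lambda>x. (b x $ j) *\<^sub>R v j)" for j
    by (intro bounded_linear_compose[OF bounded_linear_scaleR_left] bounded_linear_compose[OF bounded_linear_vec_nth blb])
  then have sg: "sa_fun (g J)" for J
    unfolding g_def
    by (intro sa_fun_add sf sa_fun_linear bounded_linear_sum)
  have tr: "transversal X (g J) (v j)" for J j unfolding transversal_def
  proof (intro exI[of _ "c / 2"] conjI ballI allI)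
    fix x y s assume xy: "x \<in> X" "y \<in> X"
    have "g J x - g J y - s *\<^sub>R v j = (f x - f y - s *\<^sub>R v j) + (\<Sum>j\<in>J. (b (x - y) $ j) *\<^sub>R v j)"
      by (simp add: g_def b.diff scaleR_diff_left sum_subtractf)
    then have "norm (f x - f y - s *\<^sub>R v j) - norm (\<Sum>j\<in>J. (b (x - y) $ j) *\<^sub>R v j) \<le> norm (g J x - g J y - s *\<^sub>R v j)"
      by (metis add_diff_cancel_right' norm_triangle_ineq2 diff_minus_eq_add norm_minus_cancel)
    then show "c / 2 * norm (x - y) \<le> norm (g J x - g J y - s *\<^sub>R v j)"
      using c[OF xy, of s j] ng[where J = J and x = "x - y"] by simp
  qed (use c0 in simp)
  have unwind: "reach X (g J) f" for J
    using finite[of J]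
  proof (induction J rule: finite_induct)
    case empty then show ?case by (intro reach_refl) (simp add: g_def)
  next
    case (insert j J)
    obtain K where K: "K > 0" "\<And>x. norm (b x) \<le> norm x * K" using b.pos_bounded by blast
    have "reach X (g (insert j J)) (g J)"
    proof (rule reach_move[OF X(2,3) sg tr v(2)])
      have bl: "bounded_linear (\<lambda>x. - (b x $ j))"
        by (intro bounded_linear_minus bounded_linear_compose[OF bounded_linear_vec_nth blb])
      then show "sa_fun (\<lambda>x. - (b x $ j))" by (rule sa_fun_linear)
      have "K-lipschitz_on X b"
        by (rule lipschitz_onI) (use K in \<open>auto simp: dist_norm mult.commute b.diff[symmetric]\<close>)
      from lipschitz_component[OF this, of j] show "K-lipschitz_on X (\<lambda>x. - (b x $ j))"
        by (simp add: lipschitz_on_def)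
      show "g J x = g (insert j J) x + (- (b x $ j)) *\<^sub>R v j" for x
        using insert.hyps by (simp add: g_def)
    qed
    then show ?case using insert.IH by (rule reach_trans)
  qed
  have "coord_proj UNIV (f x) + (x - coord_proj UNIV x) + B x = g UNIV x" for x
  proof -
    have "(\<Sum>j\<in>UNIV. (b x $ j) *\<^sub>R v j) = A (b x)" by (simp add: A_def)
    also have "\<dots> = B x" by (simp add: b_def A'(3))
    finally show ?thesis by (simp add: g_def coord_proj_def vec_eq_iff)
  qed
  with B(3) have "reach X (\<lambda>x. x) (g UNIV)" by simp
  then show ?thesis using unwind by (rule reach_trans)
qed

theorem theorem4p5:
  fixes X :: "(real^'n::{finite,linorder}) set"
    and f :: "real^'n::_ \<Rightarrow> real^'n::_"
    and k :: int
  assumes "closed X" and "semialgebraic X" and "semialgebraic_dim X = k"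
    and "semialgebraic_bilipschitz_embedding X f"
    and "int CARD('n) \<ge> 2 * k + 2"
  shows "(\<exists>F :: real^'n::_ \<Rightarrow> real^'n::_.
            tame F \<and> semialgebraic_bilipschitz UNIV UNIV F \<and> (\<forall>x\<in>X. F x = f x)) \<and>
         (\<exists>F :: real \<Rightarrow> real^'n::_ \<Rightarrow> real^'n::_.
            (\<forall>t. tame (F t) \<and> semialgebraic_bilipschitz UNIV UNIV (F t)) \<and>
            continuous_on UNIV (\<lambda>(x, t). F t x) \<and>
            semialgebraic_map UNIV (\<lambda>(x, t). F t x) \<and>
            F 0 = id \<and> (\<forall>x\<in>X. F 1 x = f x))"
proof -
  have "\<exists>F :: real \<Rightarrow> real^'n::_ \<Rightarrow> real^'n::_. flow F \<and> (\<forall>t. tame (F t)) \<and> (\<forall>x\<in>X. F 1 x = f x)"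
  proof (cases "X = {}")
    \<comment> \<open>The empty set has dimension -1, which is no natural number; the identity
      family serves.\<close>
    case True
    then show ?thesis by (intro exI[of _ "\<lambda>t u. u"]) (simp add: flow.id tame_id)
  next
    case False
    then obtain x0 where "x0 \<in> X" by blast
    from contains_cube_dim[OF contains_cube_0[OF this]] have "k \<ge> 0" using assms(3) by simp
    then obtain m where m: "k = int m" using nonneg_int_cases by blast
    have n: "2 * m + 2 \<le> CARD('n)" using assms(5) m by simp
    define f0 where "f0 = (\<lambda>x. if x \<in> X then f x else 0)"
    have f: "semialgebraic_map X f" "bilipschitz X (f ` X) f"
      using assms(4) by (auto simp: semialgebraic_bilipschitz_embedding_def semialgebraic_bilipschitz_def)
    obtain L where L: "L-lipschitz_on X f" using f(2) by (auto simp: bilipschitz_def)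
    obtain L' where L': "L'-lipschitz_on (f ` X) (inv_into X f)" using f(2) by (auto simp: bilipschitz_def)
    have inj: "inj_on f X" using f(2) by (auto simp: bilipschitz_def bij_betw_def)
    have "embeds X f0" unfolding embeds_def
    proof (intro conjI exI ballI)
      show "sa_fun f0" unfolding f0_def by (rule sa_fun_restrict[OF f(1) assms(2)])
      show "L-lipschitz_on X f0" using L by (simp add: f0_def lipschitz_on_def)
      have L0: "L' \<ge> 0" using L' by (rule lipschitz_on_nonneg)
      \<comment> \<open>L' may be 0, for instance if \<open>X\<close> is a single point; hence the
        summand 1.\<close>
      then show "1 / (L' + 1) > 0" by simp
      fix x y assume xy: "x \<in> X" "y \<in> X"
      have "norm (x - y) \<le> L' * norm (f x - f y)"
        using lipschitz_onD[OF L', of "f x" "f y"] xy inj by (simp add: dist_norm)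
      also have "\<dots> \<le> (L' + 1) * norm (f x - f y)" by (intro mult_right_mono) auto
      finally show "1 / (L' + 1) * norm (x - y) \<le> norm (f0 x - f0 y)"
        using L0 xy by (simp add: f0_def field_simps)
    qed
    from reach_embedding[OF assms(1,2) False _ n this] assms(3) m
    have "reach X (\<lambda>x. x) f0" by simp
    then obtain F where "flow F" "\<And>x. x \<in> X \<Longrightarrow> F 1 x = f0 x" by (auto simp: reach_def)
    moreover have "tame (F t)" for t by (rule flow_tame[OF \<open>flow F\<close>]) (use n in simp)
    ultimately show ?thesis by (auto simp: f0_def)
  qed
  then obtain F :: "real \<Rightarrow> real^'n::_ \<Rightarrow> real^'n::_" where
    F: "flow F" "\<And>t. tame (F t)" "\<And>x. x \<in> X \<Longrightarrow> F 1 x = f x" by blast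
  have "F 0 = id" using flow_0[OF F(1)] by auto
  then show ?thesis
    using F flow_semialgebraic_bilipschitz[OF F(1)] flow_continuous[OF F(1)] flow_saf[OF F(1)] by blast
qed

end
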